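(* Every polyhedral cone $\Gamma$ in $\mathbb{R}^d$ is tame. That is: if $\Gamma=\bigcap_{i=1}^m\{x\in\mathbb{R}^d:x\cdot\nu_i<0\}$ is a polyhedral cone and $v\in C^{1,1}(\overline\Gamma)$ is homogeneous of degree two, harmonic in $\Gamma$, and satisfies the homogeneous Neumann condition $D_\nu v=0$ on $\partial\Gamma$, then $v$ is a quadratic function (a polynomial of degree at most two).
   Context: A polyhedral cone in $\mathbb{R}^d$ is a non-empty open set of the form $\Gamma=\bigcap_{i=1}^m\{x\in\mathbb{R}^d:x\cdot\nu_i<0\}$ for finitely many unit vectors $\nu_1,\dots,\nu_m$. The Neumann condition means $D_{\nu_i}v=0$ on each face $\{x\in\overline\Gamma:x\cdot\nu_i=0\}$ of $\Gamma$, $\nu_i$ being the outer unit normal there. $C^{1,1}(\overline\Gamma)$ denotes functions which are $C^1$ up to the boundary with Lipschitz gradient (i.e. with bounded second derivatives). Homogeneous of degree two means $v(rx)=r^2v(x)$ for all $r>0$. *)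

theory Defs
  imports "HOL-Analysis.Analysis"
begin

definition polyhedral_cone :: "nat \<Rightarrow> (nat \<Rightarrow> real ^ 'n) \<Rightarrow> (real ^ 'n) set \<Rightarrow> bool" where
  "polyhedral_cone m \<nu> \<Gamma> \<longleftrightarrow>
     (\<forall>i\<in>{1..m}. norm (\<nu> i) = 1) \<and>
     \<Gamma> = (\<Inter>i\<in>{1..m}. {x. x \<bullet> \<nu> i < 0}) \<and>
     \<Gamma> \<noteq> {}"

(* For open U: v is C^1 up to the boundary of U, and g is its gradient on U, extended by
   continuity to the closure. These conditions determine g on closure U. The values of v and g
   outside closure U are irrelevant. *)
definition C1_gradient_upto_boundary ::
    "(real ^ 'n) set \<Rightarrow> (real ^ 'n \<Rightarrow> real) \<Rightarrow> (real ^ 'n \<Rightarrow> real ^ 'n) \<Rightarrow> bool" where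
  "C1_gradient_upto_boundary U v g \<longleftrightarrow>
     continuous_on (closure U) v \<and>
     continuous_on (closure U) g \<and>
     (\<forall>x\<in>U. GDERIV v x :> g x)"

definition C11_upto_boundary :: "(real ^ 'n) set \<Rightarrow> (real ^ 'n \<Rightarrow> real) \<Rightarrow> bool" where
  "C11_upto_boundary U v \<longleftrightarrow>
     (\<exists>g L. C1_gradient_upto_boundary U v g \<and> L-lipschitz_on (closure U) g)"

(* Twice continuously differentiable on the open set U, with gradient g and Hessian matrix H;
   the Laplacian is the trace of H. *)
definition harmonic_on :: "(real ^ 'n) set \<Rightarrow> (real ^ 'n \<Rightarrow> real) \<Rightarrow> bool" where
  "harmonic_on U v \<longleftrightarrow>
     (\<exists>(g :: real ^ 'n \<Rightarrow> real ^ 'n) (H :: real ^ 'n \<Rightarrow> real ^ 'n ^ 'n).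
        (\<forall>x\<in>U. GDERIV v x :> g x) \<and>
        (\<forall>x\<in>U. (g has_derivative (\<lambda>h. H x *v h)) (at x)) \<and>
        continuous_on U H \<and>
        (\<forall>x\<in>U. trace (H x) = 0))"

(* The normal derivative at a boundary point is taken with the continuous extension of the
   gradient: the segment from x in direction - \<nu> i may leave closure \<Gamma> immediately, so a
   one-sided difference quotient would not make sense at every point of a face. *)
definition neumann_condition ::
    "nat \<Rightarrow> (nat \<Rightarrow> real ^ 'n) \<Rightarrow> (real ^ 'n) set \<Rightarrow> (real ^ 'n \<Rightarrow> real) \<Rightarrow> bool" where
  "neumann_condition m \<nu> \<Gamma> v \<longleftrightarrow>
     (\<exists>g. C1_gradient_upto_boundary \<Gamma> v g \<and>
        (\<forall>i\<in>{1..m}. \<forall>x\<in>{x \<in> closure \<Gamma>. x \<bullet> \<nu> i = 0}. g x \<bullet> \<nu> i = 0))"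

definition homogeneous_degree_two_on :: "(real ^ 'n) set \<Rightarrow> (real ^ 'n \<Rightarrow> real) \<Rightarrow> bool" where
  "homogeneous_degree_two_on S v \<longleftrightarrow> (\<forall>x\<in>S. \<forall>r>0. v (r *\<^sub>R x) = r\<^sup>2 * v x)"

definition quadratic_on :: "(real ^ 'n) set \<Rightarrow> (real ^ 'n \<Rightarrow> real) \<Rightarrow> bool" where
  "quadratic_on S v \<longleftrightarrow>
     (\<exists>(A :: real ^ 'n ^ 'n) b c. \<forall>x\<in>S. v x = x \<bullet> (A *v x) + b \<bullet> x + c)"

end

(* The function w = |D^2 v|^2 is bounded, homogeneous of degree zero and subharmonic, since
   Laplace(w) = 2 |D^3 v|^2, and it satisfies the Neumann condition on the interior of each face because v
   extends evenly across the face. The set where faces meet has codimension two, hence does not matter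
   for bounded subharmonic functions: it is removed with logarithmic barriers. By homogeneity the
   supremum of w is approached at the vertex, and comparison with exp(-a |x-p|^2), where w(p) < sup w,
   contradicts the maximum principle. So w is constant, D^3 v = 0 and v is quadratic.

   Regularity is obtained from the maximum principle alone. For a continuously differentiable function
   that is harmonic off finitely many hyperplanes, comparing its odd part under a reflection with a
   quadratic barrier gives gradient bounds; applied to differences of difference quotients these bounds
   give the convergence of all derivatives, also across the hyperplanes. *)
theory Submission
  imports Defs
begin

section \<open>The Laplacian as a limit of second differences\<close>

text \<open>The Hessian of \<open>v\<close> is bounded but is not known to have limits where faces
  meet, so suprema over the cone need not be attained on its closure: maxima are replaced by
  maximizing sequences, and boundary conditions are tested by functions touching from above. Gluing
  across a face yields only a continuously differentiable function without second derivatives on the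
  face. Hence the comparison arguments behind regularity must tolerate hyperplanes, and affine ones
  in finite number, because difference quotients translate them. For the same reason the Laplacian
  is a pointwise limit of second differences, which makes sense before second derivatives are known.
  The Gaussian can be compared with \<open>w\<close> up to the boundary because its centre p lies in
  the open cone: where x . \<nu>_i = 0, one has (x - p) . \<nu>_i = - p . \<nu>_i > 0, so its normal
  derivative has a strict sign on every face.\<close>

lemma GDERIV_isCont: "GDERIV u x :> g \<Longrightarrow> isCont u x"
  unfolding gderiv_def by (rule has_derivative_continuous)

lemma GDERIV_cmult: "GDERIV u x :> g \<Longrightarrow> GDERIV (\<lambda>x. c * u x) x :> c *\<^sub>R g"
  using GDERIV_mult[OF GDERIV_const[of c] , of u x g] by simp

lemma GDERIV_unique:
  assumes "GDERIV u x :> g" "GDERIV u x :> g'"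
  shows "g = g'"
proof -
  have "(\<lambda>h. h \<bullet> g) = (\<lambda>h. h \<bullet> g')"
    using assms unfolding gderiv_def by (rule has_derivative_unique)
  then show ?thesis by (metis inner_commute vector_eq_ldot)
qed

lemma GDERIV_shift: "GDERIV u (x + a) :> g \<Longrightarrow> GDERIV (\<lambda>x. u (x + a)) x :> g"
  unfolding gderiv_def
  by (rule has_derivative_compose[of "\<lambda>x. x + a" "\<lambda>h. h" x UNIV u]) (auto intro!: derivative_eq_intros)

lemma GDERIV_line:
  assumes "GDERIV u (x + t *\<^sub>R b) :> g"
  shows "((\<lambda>t. u (x + t *\<^sub>R b)) has_real_derivative b \<bullet> g) (at t)"
proof -
  have "((\<lambda>t. u (x + t *\<^sub>R b)) has_derivative (\<lambda>s. (s *\<^sub>R b) \<bullet> g)) (at t)"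
    using assms unfolding gderiv_def
    by (intro has_derivative_compose[of _ "\<lambda>s. s *\<^sub>R b" t UNIV u "\<lambda>k. k \<bullet> g"]) (auto intro!: derivative_eq_intros)
  then show ?thesis by (simp add: has_field_derivative_def mult_commute_abs)
qed

lemma directional_difference_quotient_limit:
  assumes "GDERIV u x :> g"
  shows "((\<lambda>t. (u (x + t *\<^sub>R b) - u x) / t) \<longlongrightarrow> b \<bullet> g) (at 0)"
  using GDERIV_line[of u x 0 b g] assms by (simp add: DERIV_def)

lemma GDERIV_norm_power2: "GDERIV (\<lambda>y. (norm (y - p))\<^sup>2) x :> 2 *\<^sub>R (x - p)"
  unfolding gderiv_def power2_norm_eq_inner
  by (auto intro!: derivative_eq_intros simp: inner_commute)

text \<open>A limit of symmetric second differences along the coordinate axes: it equals the trace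
  of the Hessian where that exists (\<open>has_laplacian_trace\<close>), is linear, and its sign at
  a local maximum is immediate.\<close>

definition has_laplacian :: "('a::euclidean_space \<Rightarrow> real) \<Rightarrow> real \<Rightarrow> 'a \<Rightarrow> bool" where
  "has_laplacian u l x \<longleftrightarrow>
     ((\<lambda>t. (\<Sum>b\<in>Basis. u (x + t *\<^sub>R b) + u (x - t *\<^sub>R b) - 2 * u x) / t\<^sup>2) \<longlongrightarrow> l) (at 0)"

lemma has_laplacian_unique:
  "has_laplacian u l x \<Longrightarrow> has_laplacian u l' x \<Longrightarrow> l = l'"
  unfolding has_laplacian_def using tendsto_unique trivial_limit_at by blast

lemma has_laplacian_const: "has_laplacian (\<lambda>x. c) 0 x"
  by (simp add: has_laplacian_def)

lemma has_laplacian_add: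
  assumes "has_laplacian u l x" "has_laplacian v k x"
  shows "has_laplacian (\<lambda>x. u x + v x) (l + k) x"
proof -
  have "((\<lambda>t. (\<Sum>b\<in>Basis. u (x + t *\<^sub>R b) + u (x - t *\<^sub>R b) - 2 * u x) / t\<^sup>2
      + (\<Sum>b\<in>Basis. v (x + t *\<^sub>R b) + v (x - t *\<^sub>R b) - 2 * v x) / t\<^sup>2) \<longlongrightarrow> l + k) (at 0)"
    using assms unfolding has_laplacian_def by (intro tendsto_add)
  then show ?thesis
    unfolding has_laplacian_def
    by (rule tendsto_eq_rhs[OF Lim_transform_eventually])
      (auto simp: add_divide_distrib[symmetric] sum.distrib[symmetric] algebra_simps)
qed

lemma has_laplacian_cmult:
  assumes "has_laplacian u l x"
  shows "has_laplacian (\<lambda>x. c * u x) (c * l) x"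
proof -
  have "((\<lambda>t. c * ((\<Sum>b\<in>Basis. u (x + t *\<^sub>R b) + u (x - t *\<^sub>R b) - 2 * u x) / t\<^sup>2)) \<longlongrightarrow> c * l) (at 0)"
    using assms unfolding has_laplacian_def by (intro tendsto_mult_left)
  then show ?thesis
    unfolding has_laplacian_def
    by (rule tendsto_eq_rhs[OF Lim_transform_eventually])
      (auto simp: sum_distrib_left algebra_simps)
qed

lemma has_laplacian_minus: "has_laplacian u l x \<Longrightarrow> has_laplacian (\<lambda>x. - u x) (- l) x"
  using has_laplacian_cmult[of u l x "-1"] by simp

lemma has_laplacian_diff:
  "has_laplacian u l x \<Longrightarrow> has_laplacian v k x \<Longrightarrow> has_laplacian (\<lambda>x. u x - v x) (l - k) x"
  using has_laplacian_add[OF _ has_laplacian_minus] by fastforce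

lemma has_laplacian_sum:
  assumes "finite I" "\<And>i. i \<in> I \<Longrightarrow> has_laplacian (u i) (l i) x"
  shows "has_laplacian (\<lambda>x. \<Sum>i\<in>I. u i x) (\<Sum>i\<in>I. l i) x"
  using assms by (induction I) (auto intro: has_laplacian_const has_laplacian_add)

lemma has_laplacian_shift: "has_laplacian (\<lambda>x. u (x + a)) l x \<longleftrightarrow> has_laplacian u l (x + a)"
  by (simp add: has_laplacian_def algebra_simps)

lemma eventually_coordinate_neighbours:
  fixes x :: "'a::euclidean_space"
  assumes "open U" "x \<in> U"
  shows "\<forall>\<^sub>F t in at 0. \<forall>b\<in>Basis. x + t *\<^sub>R b \<in> U \<and> x - t *\<^sub>R b \<in> U"
proof (rule eventually_ball_finite, simp, intro ballI eventually_conj)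
  fix b :: 'a
  have "((\<lambda>t. x + t *\<^sub>R b) \<longlongrightarrow> x + 0 *\<^sub>R b) (at 0)" "((\<lambda>t. x - t *\<^sub>R b) \<longlongrightarrow> x - 0 *\<^sub>R b) (at 0)"
    by (intro tendsto_intros)+
  then show "\<forall>\<^sub>F t in at 0. x + t *\<^sub>R b \<in> U" "\<forall>\<^sub>F t in at 0. x - t *\<^sub>R b \<in> U"
    using assms by (auto dest: topological_tendstoD)
qed

lemma has_laplacian_transform:
  assumes "has_laplacian u l x" "open U" "x \<in> U" "\<And>y. y \<in> U \<Longrightarrow> u y = v y"
  shows "has_laplacian v l x"
proof -
  have "\<forall>\<^sub>F t in at 0. \<forall>b\<in>Basis. x + t *\<^sub>R b \<in> U \<and> x - t *\<^sub>R b \<in> U"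
    using assms(2,3) by (rule eventually_coordinate_neighbours)
  then have "\<forall>\<^sub>F t in at 0. (\<Sum>b\<in>Basis. u (x + t *\<^sub>R b) + u (x - t *\<^sub>R b) - 2 * u x) / t\<^sup>2
      = (\<Sum>b\<in>Basis. v (x + t *\<^sub>R b) + v (x - t *\<^sub>R b) - 2 * v x) / t\<^sup>2"
    by eventually_elim (use assms in auto)
  then show ?thesis
    using assms(1) unfolding has_laplacian_def by (rule Lim_transform_eventually[rotated])
qed

text \<open>One use of l'Hopital's rule leads to the symmetric difference quotient of
  \<open>f'\<close>, the mean of two ordinary quotients at 0. So \<open>f'\<close> has to be
  differentiable at the single point 0 only.\<close>

lemma second_difference_quotient_limit:
  fixes f f' :: "real \<Rightarrow> real"
  assumes "0 < d" and f: "\<And>t. \<bar>t\<bar> < d \<Longrightarrow> (f has_real_derivative f' t) (at t)"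
    and f': "(f' has_real_derivative k) (at 0)"
  shows "((\<lambda>t. (f t + f (- t) - 2 * f 0) / t\<^sup>2) \<longlongrightarrow> k) (at 0)"
proof -
  have ev: "\<forall>\<^sub>F t in at 0. \<bar>t\<bar> < d" if "0 < d" for d :: real
    unfolding eventually_at using that by (intro exI[of _ d]) (auto simp: dist_real_def)
  have q: "((\<lambda>t. (f' t - f' (- t)) / (2 * t)) \<longlongrightarrow> k) (at 0)"
  proof -
    have 1: "((\<lambda>t. (f' (0 + t) - f' 0) / t) \<longlongrightarrow> k) (at 0)"
      using f' unfolding DERIV_def .
    have "filterlim (\<lambda>t::real. - t) (at 0) (at 0)"
      by (auto intro!: tendsto_eq_intros simp: filterlim_at eventually_at_filter)
    from filterlim_compose[OF 1 this]
    have "((\<lambda>t. ((f' (0 + t) - f' 0) / t + (f' (0 + - t) - f' 0) / (- t)) / 2) \<longlongrightarrow> (k + k) / 2) (at 0)"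
      using 1 by (intro tendsto_intros) auto
    then show ?thesis
      by (rule tendsto_eq_rhs[OF Lim_transform_eventually])
        (auto simp: eventually_at_filter divide_simps algebra_simps)
  qed
  show ?thesis
  proof (rule lhopital[OF _ _ _ _ _ _ q])
    have "isCont f 0" using f[of 0] assms(1) DERIV_isCont by simp
    then have "(f \<longlongrightarrow> f 0) (at 0)" "((\<lambda>t. f (- t)) \<longlongrightarrow> f (- 0)) (at 0)"
      by (auto simp: isCont_def intro!: isCont_tendsto_compose[of 0 f] tendsto_eq_intros)
    then show "((\<lambda>t. f t + f (- t) - 2 * f 0) \<longlongrightarrow> 0) (at 0)"
      by (auto intro!: tendsto_eq_intros)
    show "((\<lambda>t::real. t\<^sup>2) \<longlongrightarrow> 0) (at 0)" by (auto intro!: tendsto_eq_intros)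
    show "\<forall>\<^sub>F t::real in at 0. t\<^sup>2 \<noteq> 0" "\<forall>\<^sub>F t::real in at 0. 2 * t \<noteq> 0"
      by (auto simp: eventually_at_filter)
    show "\<forall>\<^sub>F t in at 0. ((\<lambda>t. f t + f (- t) - 2 * f 0) has_real_derivative f' t - f' (- t)) (at t)"
      using ev[OF assms(1)]
    proof eventually_elim
      fix t :: real assume "\<bar>t\<bar> < d"
      then show "((\<lambda>t. f t + f (- t) - 2 * f 0) has_real_derivative f' t - f' (- t)) (at t)"
        using DERIV_mirror[of f "f' (- t)" t] f[of t] f[of "-t"]
        by (auto intro!: derivative_eq_intros)
    qed
    show "\<forall>\<^sub>F t::real in at 0. ((\<lambda>t. t\<^sup>2) has_real_derivative 2 * t) (at t)"
      by (auto intro!: always_eventually derivative_eq_intros)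
  qed
qed

lemma has_laplacian_of_directional:
  assumes "\<And>b. b \<in> Basis \<Longrightarrow>
    ((\<lambda>t. (u (x + t *\<^sub>R b) + u (x - t *\<^sub>R b) - 2 * u x) / t\<^sup>2) \<longlongrightarrow> l b) (at 0)"
  shows "has_laplacian u (\<Sum>b\<in>Basis. l b) x"
  unfolding has_laplacian_def sum_divide_distrib using assms by (intro tendsto_sum) auto

lemma has_laplacian_trace:
  fixes u :: "'a::euclidean_space \<Rightarrow> real"
  assumes "open U" "x \<in> U" and g: "\<And>y. y \<in> U \<Longrightarrow> GDERIV u y :> g y"
    and G: "\<And>b. b \<in> Basis \<Longrightarrow> GDERIV (\<lambda>y. g y \<bullet> b) x :> G b"
  shows "has_laplacian u (\<Sum>b\<in>Basis. G b \<bullet> b) x"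
proof (rule has_laplacian_of_directional)
  fix b :: 'a assume b: "b \<in> Basis"
  obtain d where d: "0 < d" "ball x d \<subseteq> U" using assms(1,2) openE by blast
  have "((\<lambda>t. (u (x + t *\<^sub>R b) + u (x + (- t) *\<^sub>R b) - 2 * u (x + 0 *\<^sub>R b)) / t\<^sup>2) \<longlongrightarrow> b \<bullet> G b) (at 0)"
  proof (rule second_difference_quotient_limit[OF d(1), where f' = "\<lambda>t. b \<bullet> g (x + t *\<^sub>R b)"])
    fix t :: real assume "\<bar>t\<bar> < d"
    then have "x + t *\<^sub>R b \<in> U" using d(2) b by (auto simp: dist_norm)
    from GDERIV_line[OF g[OF this]]
    show "((\<lambda>t. u (x + t *\<^sub>R b)) has_real_derivative b \<bullet> g (x + t *\<^sub>R b)) (at t)" .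
  next
    show "((\<lambda>t. b \<bullet> g (x + t *\<^sub>R b)) has_real_derivative b \<bullet> G b) (at 0)"
      using GDERIV_line[of "\<lambda>y. g y \<bullet> b" x 0 b "G b"] G[OF b] by (simp add: inner_commute)
  qed
  then show "((\<lambda>t. (u (x + t *\<^sub>R b) + u (x - t *\<^sub>R b) - 2 * u x) / t\<^sup>2) \<longlongrightarrow> G b \<bullet> b) (at 0)"
    by (simp add: inner_commute)
qed

text \<open>With p, q the two neighbouring values and c the central one, p^2 + q^2 - 2c^2 = 2c(p + q
  - 2c) + (p - c)^2 + (q - c)^2; the last two squares produce the gradient term. For harmonic
  \<open>u\<close> only that term remains, which is how the squared third derivatives arise.\<close>

lemma has_laplacian_power2:
  fixes u :: "'a::euclidean_space \<Rightarrow> real"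
  assumes g: "GDERIV u x :> g" and l: "has_laplacian u l x"
  shows "has_laplacian (\<lambda>x. (u x)\<^sup>2) (2 * u x * l + 2 * (norm g)\<^sup>2) x"
proof -
  note lim = directional_difference_quotient_limit[OF g]
  have lim2: "((\<lambda>t. ((u (x + t *\<^sub>R b) - u x) / t)\<^sup>2 + ((u (x - t *\<^sub>R b) - u x) / t)\<^sup>2) \<longlongrightarrow> 2 * (g \<bullet> b)\<^sup>2) (at 0)" for b
    using tendsto_add[OF tendsto_power[OF lim[of b], of 2] tendsto_power[OF lim[of "-b"], of 2]]
    by (simp add: inner_commute)
  have "((\<lambda>t. 2 * u x * ((\<Sum>b\<in>Basis. u (x + t *\<^sub>R b) + u (x - t *\<^sub>R b) - 2 * u x) / t\<^sup>2)
     + (\<Sum>b\<in>Basis. ((u (x + t *\<^sub>R b) - u x) / t)\<^sup>2 + ((u (x - t *\<^sub>R b) - u x) / t)\<^sup>2))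
     \<longlongrightarrow> 2 * u x * l + (\<Sum>b\<in>Basis. 2 * (g \<bullet> b)\<^sup>2)) (at 0)"
    using l unfolding has_laplacian_def
    by (intro tendsto_add tendsto_sum lim2 tendsto_mult_left)
  moreover have "(\<Sum>b\<in>Basis. 2 * (g \<bullet> b)\<^sup>2) = 2 * (norm g)\<^sup>2"
    unfolding power2_norm_eq_inner euclidean_inner[of g g] by (simp add: sum_distrib_left power2_eq_square)
  moreover have "2 * u x * ((\<Sum>b\<in>Basis. u (x + t *\<^sub>R b) + u (x - t *\<^sub>R b) - 2 * u x) / t\<^sup>2)
     + (\<Sum>b\<in>Basis. ((u (x + t *\<^sub>R b) - u x) / t)\<^sup>2 + ((u (x - t *\<^sub>R b) - u x) / t)\<^sup>2)
     = (\<Sum>b\<in>Basis. (u (x + t *\<^sub>R b))\<^sup>2 + (u (x - t *\<^sub>R b))\<^sup>2 - 2 * (u x)\<^sup>2) / t\<^sup>2" for t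
    unfolding power_divide add_divide_distrib[symmetric] sum_divide_distrib[symmetric] times_divide_eq_right
      sum_distrib_left sum.distrib[symmetric]
    by (intro arg_cong2[of _ _ _ _ "(/)"] sum.cong) (auto simp: power2_eq_square algebra_simps)
  ultimately show ?thesis by (simp add: has_laplacian_def)
qed

text \<open>\<open>s x\<close> is the squared norm of the orthogonal projection of \<open>x - p\<close> to the span of \<open>B\<close>.\<close>

lemma has_laplacian_radial:
  fixes p :: "'a::euclidean_space" and F F' :: "real \<Rightarrow> real"
  assumes fin: "finite B" and orth: "pairwise orthogonal B" and nrm: "\<And>b. b \<in> B \<Longrightarrow> norm b = 1"
    and s: "\<And>x. s x = (\<Sum>b\<in>B. ((x - p) \<bullet> b)\<^sup>2)"
    and "open U" "s x \<in> U" and F: "\<And>t. t \<in> U \<Longrightarrow> (F has_real_derivative F' t) (at t)"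
    and F': "(F' has_real_derivative F'') (at (s x))"
  shows "has_laplacian (\<lambda>x. F (s x)) (4 * s x * F'' + 2 * card B * F' (s x)) x"
    and "GDERIV (\<lambda>x. F (s x)) x :> (2 * F' (s x)) *\<^sub>R (\<Sum>b\<in>B. ((x - p) \<bullet> b) *\<^sub>R b)"
proof -
  define P where "P y = (\<Sum>b\<in>B. (y \<bullet> b) *\<^sub>R b)" for y
  have PP: "P y \<bullet> z = (\<Sum>b\<in>B. (y \<bullet> b) * (z \<bullet> b))" for y z
    by (simp add: P_def inner_sum_left inner_commute[of z])
  have Pb: "P y \<bullet> b = y \<bullet> b" if "b \<in> B" for y b
  proof -
    have "P y \<bullet> b = (\<Sum>c\<in>B. if c = b then y \<bullet> b else 0)"
      unfolding PP
      using orth nrm that by (intro sum.cong) (auto simp: pairwise_def orthogonal_def norm_eq_1 inner_commute)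
    then show ?thesis using fin that by simp
  qed
  have nP: "P y \<bullet> P y = (\<Sum>b\<in>B. (y \<bullet> b)\<^sup>2)" for y
    by (subst PP) (simp add: Pb power2_eq_square)
  \<comment> \<open>\<open>P\<close> is the orthogonal projection to the span of \<open>B\<close>,
    symmetric and idempotent, so \<open>s\<close> is exactly quadratic along each line and the
    one-variable limit applies to \<open>F\<close> composed with it.\<close>
  have line: "s (x + t *\<^sub>R b) = s x + 2 * t * (P (x - p) \<bullet> b) + t\<^sup>2 * (P b \<bullet> P b)" for t b
  proof -
    have "s (x + t *\<^sub>R b) = (\<Sum>c\<in>B. (((x - p) \<bullet> c) + t * (b \<bullet> c))\<^sup>2)"
      unfolding s by (intro sum.cong) (auto simp: inner_simps algebra_simps)
    also have "\<dots> = s x + 2 * t * (P (x - p) \<bullet> b) + t\<^sup>2 * (P b \<bullet> P b)"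
      unfolding nP[of b] PP[of "x - p"] s sum_distrib_left sum.distrib[symmetric]
      by (intro sum.cong) (auto simp: power2_eq_square algebra_simps)
    finally show ?thesis .
  qed
  have sp: "(s has_derivative (\<lambda>h. h \<bullet> (2 *\<^sub>R P (x - p)))) (at x)"
  proof -
    have "((\<lambda>x. \<Sum>b\<in>B. ((x - p) \<bullet> b)\<^sup>2) has_derivative (\<lambda>h. \<Sum>b\<in>B. 2 * ((x - p) \<bullet> b) * (h \<bullet> b))) (at x)"
      by (auto intro!: derivative_eq_intros simp: mult_ac)
    moreover have "(\<lambda>h. \<Sum>b\<in>B. 2 * ((x - p) \<bullet> b) * (h \<bullet> b)) = (\<lambda>h. h \<bullet> (2 *\<^sub>R P (x - p)))"
      by (auto simp: inner_commute[of _ "P (x - p)"] PP sum_distrib_left mult_ac)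
    ultimately show ?thesis using s by (metis (no_types, lifting) ext)
  qed
  have "GDERIV (\<lambda>x. F (s x)) x :> F' (s x) *\<^sub>R (2 *\<^sub>R P (x - p))"
    using sp F[OF \<open>s x \<in> U\<close>] by (intro GDERIV_DERIV_compose[of s x _ F]) (auto simp: gderiv_def)
  then show "GDERIV (\<lambda>x. F (s x)) x :> (2 * F' (s x)) *\<^sub>R (\<Sum>b\<in>B. ((x - p) \<bullet> b) *\<^sub>R b)"
    by (simp add: P_def mult.commute)
  have "has_laplacian (\<lambda>x. F (s x))
     (\<Sum>b\<in>Basis. 4 * F'' * (P (x - p) \<bullet> b)\<^sup>2 + F' (s x) * (2 * (P b \<bullet> P b))) x"
  proof (rule has_laplacian_of_directional)
    fix b :: 'a assume b: "b \<in> Basis"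
    define r where "r t = s x + 2 * t * (P (x - p) \<bullet> b) + t\<^sup>2 * (P b \<bullet> P b)" for t
    define r' where "r' t = 2 * (P (x - p) \<bullet> b) + 2 * t * (P b \<bullet> P b)" for t
    have r: "(r has_real_derivative r' t) (at t)" for t
      unfolding r_def r'_def by (auto intro!: derivative_eq_intros)
    have r': "(r' has_real_derivative 2 * (P b \<bullet> P b)) (at t)" for t
      unfolding r'_def by (auto intro!: derivative_eq_intros)
    have "continuous_on UNIV r" using r by (auto intro!: DERIV_continuous_on)
    then have "open (r -` U)" using \<open>open U\<close> by (auto simp: continuous_on_open_vimage)
    moreover have "0 \<in> r -` U" using \<open>s x \<in> U\<close> by (simp add: r_def)
    ultimately obtain d where d: "0 < d" "ball 0 d \<subseteq> r -` U" using openE by blast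
    have r0: "r 0 = s x" "r' 0 = 2 * (P (x - p) \<bullet> b)" by (auto simp: r_def r'_def)
    have "((\<lambda>t. (F (r t) + F (r (- t)) - 2 * F (r 0)) / t\<^sup>2) \<longlongrightarrow>
       4 * F'' * (P (x - p) \<bullet> b)\<^sup>2 + F' (s x) * (2 * (P b \<bullet> P b))) (at 0)"
    proof (rule second_difference_quotient_limit[OF d(1)])
      fix t :: real assume "\<bar>t\<bar> < d"
      then have "r t \<in> U" using d(2) by (auto simp: dist_norm)
      then show "((\<lambda>t. F (r t)) has_real_derivative F' (r t) * r' t) (at t)"
        using F r by (intro DERIV_chain2) auto
    next
      have "((\<lambda>t. F' (r t)) has_real_derivative F'' * r' 0) (at 0)"
        using F' r r0(1) by (intro DERIV_chain2) auto
      from DERIV_mult[OF this r'[of 0]]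
      show "((\<lambda>t. F' (r t) * r' t) has_real_derivative
          4 * F'' * (P (x - p) \<bullet> b)\<^sup>2 + F' (s x) * (2 * (P b \<bullet> P b))) (at 0)"
        by (simp add: r0 power2_eq_square algebra_simps)
    qed
    moreover have "r t = s (x + t *\<^sub>R b)" "r (-t) = s (x - t *\<^sub>R b)" for t
      using line[of t b] line[of "-t" b] by (simp_all add: r_def)
    ultimately show "((\<lambda>t. (F (s (x + t *\<^sub>R b)) + F (s (x - t *\<^sub>R b)) - 2 * F (s x)) / t\<^sup>2) \<longlongrightarrow>
       4 * F'' * (P (x - p) \<bullet> b)\<^sup>2 + F' (s x) * (2 * (P b \<bullet> P b))) (at 0)"
      by (simp add: r0)
  qed
  moreover have "(\<Sum>b\<in>Basis. (P (x - p) \<bullet> b)\<^sup>2) = s x"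
    using nP[of "x - p"] euclidean_inner[of "P (x - p)" "P (x - p)"] s by (simp add: power2_eq_square)
  \<comment> \<open>The trace of a projection is its rank. Later \<open>card B\<close> is the
    codimension of a stratum, or the full dimension for the Gaussian.\<close>
  moreover have "(\<Sum>b\<in>Basis. P b \<bullet> P b) = card B"
  proof -
    have "(\<Sum>b\<in>Basis. P b \<bullet> P b) = (\<Sum>c\<in>B. \<Sum>b\<in>Basis. (b \<bullet> c)\<^sup>2)"
      unfolding nP by (rule sum.swap)
    also have "\<dots> = (\<Sum>c\<in>B. 1)"
    proof (intro sum.cong refl)
      fix c assume "c \<in> B"
      then have "c \<bullet> c = 1" using nrm by (simp add: norm_eq_1)
      then show "(\<Sum>b\<in>Basis. (b \<bullet> c)\<^sup>2) = 1"
        using euclidean_inner[of c c] by (simp add: power2_eq_square inner_commute)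
    qed
    finally show ?thesis by simp
  qed
  ultimately show "has_laplacian (\<lambda>x. F (s x)) (4 * s x * F'' + 2 * card B * F' (s x)) x"
    by (simp add: sum.distrib sum_distrib_left[symmetric] algebra_simps)
qed

lemma has_laplacian_inner_power2:
  fixes c :: "'a::euclidean_space"
  shows "has_laplacian (\<lambda>x. ((x - p) \<bullet> c)\<^sup>2) (2 * (norm c)\<^sup>2) x"
proof -
  have g: "GDERIV (\<lambda>x. (x - p) \<bullet> c) x :> c"
    unfolding gderiv_def by (auto intro!: derivative_eq_intros)
  have "has_laplacian (\<lambda>x. (x - p) \<bullet> c) 0 x"
    by (simp add: has_laplacian_def inner_simps)
  from has_laplacian_power2[OF g this] show ?thesis by simp
qed

lemma has_laplacian_norm_power2:
  "has_laplacian (\<lambda>x::'a::euclidean_space. (norm (x - p))\<^sup>2) (2 * DIM('a)) x"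
proof -
  have "has_laplacian (\<lambda>x::'a. \<Sum>b\<in>Basis. ((x - p) \<bullet> b)\<^sup>2) (\<Sum>b\<in>(Basis::'a set). 2 * (norm b)\<^sup>2) x"
    by (intro has_laplacian_sum has_laplacian_inner_power2) auto
  moreover have "(\<Sum>b\<in>Basis. ((x - p) \<bullet> b)\<^sup>2) = (norm (x - p))\<^sup>2" for x :: 'a
    unfolding power2_norm_eq_inner[of "x - p"] euclidean_inner[of "x - p" "x - p"] by (simp add: power2_eq_square)
  ultimately show ?thesis by (simp add: mult.commute)
qed

lemma has_laplacian_inner: "has_laplacian (\<lambda>x. (x - p) \<bullet> c) 0 x"
  by (simp add: has_laplacian_def inner_simps)

section \<open>The maximum principle and piecewise harmonic functions\<close>

text \<open>On the hyperplanes \<open>a \<bullet> x = c\<close> with \<open>(a, c) \<in> N\<close> only differentiability is required: adding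
  \<open>\<epsilon> \<bar>a \<bullet> x - c\<bar>\<close> creates a convex crease there, which excludes a maximum.\<close>

lemma maximum_principle:
  fixes u :: "'a::euclidean_space \<Rightarrow> real"
  assumes K: "compact K" "continuous_on K u"
    and N: "finite N" "\<And>a c. (a, c) \<in> N \<Longrightarrow> a \<noteq> 0"
    and int: "\<And>x. x \<in> K \<Longrightarrow> M < u x \<Longrightarrow> x \<in> interior K"
    and loc: "\<And>x. x \<in> K \<Longrightarrow> M < u x \<Longrightarrow>
      (\<exists>(a, c)\<in>N. a \<bullet> x = c) \<and> (\<exists>g. GDERIV u x :> g) \<or> (\<exists>l\<ge>0. has_laplacian u l x)"
    and "x \<in> K"
  shows "u x \<le> M"
proof (rule ccontr)
  assume "\<not> u x \<le> M"
  define k where "k y = (\<Sum>(a, c)\<in>N. \<bar>a \<bullet> y - c\<bar>)" for y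
  \<comment> \<open>The squared norm takes care of points off the hyperplanes: it makes the
    Laplacian of the perturbed function strictly positive where only \<open>l \<ge> 0\<close> is
    given.\<close>
  define q where "q y = (norm (y - 0))\<^sup>2 + k y" for y
  have kconv: "0 \<le> \<bar>a \<bullet> (y + h) - c\<bar> + \<bar>a \<bullet> (y - h) - c\<bar> - 2 * \<bar>a \<bullet> y - c\<bar>" for a y h :: 'a and c
  proof -
    have "2 * \<bar>p\<bar> \<le> \<bar>p + q\<bar> + \<bar>p - q\<bar>" for p q :: real by (simp add: abs_if)
    from this[of "a \<bullet> y - c" "a \<bullet> h"] show ?thesis by (simp add: inner_simps algebra_simps)
  qed
  have k2: "k (y + h) + k (y - h) - 2 * k y
      = (\<Sum>(a, c)\<in>N. \<bar>a \<bullet> (y + h) - c\<bar> + \<bar>a \<bullet> (y - h) - c\<bar> - 2 * \<bar>a \<bullet> y - c\<bar>)" for y h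
    unfolding k_def sum_distrib_left sum.distrib[symmetric] sum_subtractf[symmetric]
    by (intro sum.cong) auto
  have k0: "0 \<le> k (y + h) + k (y - h) - 2 * k y" for y h
    unfolding k2 using kconv by (intro sum_nonneg) auto
  have kplane: "2 * \<bar>t\<bar> * (a \<bullet> a) \<le> k (y + t *\<^sub>R a) + k (y - t *\<^sub>R a) - 2 * k y"
    if "(a, c) \<in> N" "a \<bullet> y = c" for y t a c
  proof -
    have "(case (a, c) of (a', c) \<Rightarrow>
        \<bar>a' \<bullet> (y + t *\<^sub>R a) - c\<bar> + \<bar>a' \<bullet> (y - t *\<^sub>R a) - c\<bar> - 2 * \<bar>a' \<bullet> y - c\<bar>)
      \<le> k (y + t *\<^sub>R a) + k (y - t *\<^sub>R a) - 2 * k y"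
      unfolding k2 using kconv N(1) that by (intro member_le_sum) auto
    then show ?thesis using that(2) by (simp add: inner_simps abs_mult)
  qed
  have "continuous_on K q"
    unfolding q_def k_def by (intro continuous_intros) (auto simp: case_prod_beta intro!: continuous_intros)
  then have "bounded (q ` K)" using K(1) compact_continuous_image compact_imp_bounded by blast
  then obtain B where B: "0 < B" "\<And>y. y \<in> K \<Longrightarrow> \<bar>q y\<bar> \<le> B"
    unfolding bounded_pos by auto
  \<comment> \<open>The perturbation costs at most half of the excess \<open>u x - M\<close>, so the
    maximum of \<open>u + \<epsilon> * q\<close> is still taken where \<open>u\<close> exceeds
    \<open>M\<close>, hence in the interior.\<close>
  define \<epsilon> where "\<epsilon> = (u x - M) / (2 * B)"
  have \<epsilon>: "0 < \<epsilon>" "\<epsilon> * B < u x - M" using \<open>\<not> u x \<le> M\<close> B(1) by (auto simp: \<epsilon>_def)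
  have q0: "0 \<le> q y" for y by (auto simp: q_def k_def intro!: add_nonneg_nonneg sum_nonneg)
  obtain y where y: "y \<in> K" "\<And>z. z \<in> K \<Longrightarrow> u z + \<epsilon> * q z \<le> u y + \<epsilon> * q y"
  proof -
    have "continuous_on K (\<lambda>z. u z + \<epsilon> * q z)"
      by (intro continuous_intros K \<open>continuous_on K q\<close>)
    with that show ?thesis
      using continuous_attains_sup[of K "\<lambda>z. u z + \<epsilon> * q z"] K(1) \<open>x \<in> K\<close> by blast
  qed
  have "\<epsilon> * q y \<le> \<epsilon> * B" "0 \<le> \<epsilon> * q x" using \<epsilon> B(2)[OF y(1)] q0 by auto
  then have uy: "M < u y" using y(2)[OF \<open>x \<in> K\<close>] \<epsilon>(2) by linarith
  have near: "\<forall>\<^sub>F t in at 0. u (y + t *\<^sub>R b) + u (y - t *\<^sub>R b) - 2 * u y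
      + \<epsilon> * (q (y + t *\<^sub>R b) + q (y - t *\<^sub>R b) - 2 * q y) \<le> 0" for b
  proof -
    have "((\<lambda>t. y + t *\<^sub>R b) \<longlongrightarrow> y + 0 *\<^sub>R b) (at 0)" "((\<lambda>t. y - t *\<^sub>R b) \<longlongrightarrow> y - 0 *\<^sub>R b) (at 0)"
      by (intro tendsto_intros)+
    then have "\<forall>\<^sub>F t in at 0. y + t *\<^sub>R b \<in> interior K" "\<forall>\<^sub>F t in at 0. y - t *\<^sub>R b \<in> interior K"
      using int[OF y(1) uy] open_interior by (auto dest: topological_tendstoD)
    then show ?thesis
    proof eventually_elim
      case (elim t)
      then have "y + t *\<^sub>R b \<in> K" "y - t *\<^sub>R b \<in> K" using interior_subset by auto
      from y(2)[OF this(1)] y(2)[OF this(2)] show ?case by (simp add: algebra_simps)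
    qed
  qed
  have qb: "q (y + t *\<^sub>R b) + q (y - t *\<^sub>R b) - 2 * q y
      = 2 * t\<^sup>2 * (b \<bullet> b) + (k (y + t *\<^sub>R b) + k (y - t *\<^sub>R b) - 2 * k y)" for t b
    unfolding q_def power2_norm_eq_inner by (simp add: inner_simps inner_commute power2_eq_square algebra_simps)
  from loc[OF y(1) uy] show False
  proof (elim disjE conjE exE bexE case_prodE)
    fix p a c g assume p: "p \<in> N" "p = (a, c)" "a \<bullet> y = c" and g: "GDERIV u y :> g"
    \<comment> \<open>Along the normal \<open>a\<close> the second difference of \<open>u\<close> is
      o(t) by differentiability, whereas the crease contributes at least
      \<open>2 * \<epsilon> * \<bar>t\<bar> * (a \<bullet> a)\<close>; a maximum of the sum allows
      no such gain.\<close>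
    have "((\<lambda>t. (u (y + t *\<^sub>R a) - u y) / t - (u (y + t *\<^sub>R (- a)) - u y) / (- t) * 1) \<longlongrightarrow> 0) (at 0)"
      using tendsto_add[OF directional_difference_quotient_limit[OF g, of a] directional_difference_quotient_limit[OF g, of "- a"]]
      by (simp add: diff_divide_distrib)
    then have "\<forall>\<^sub>F t in at 0. dist ((u (y + t *\<^sub>R a) - u y) / t - (u (y + t *\<^sub>R (- a)) - u y) / (- t) * 1) 0 < \<epsilon> * (a \<bullet> a)"
      using \<epsilon> N(2) p by (intro tendstoD) auto
    with near[of a] eventually_neq_at_within[of 0 0 UNIV] have "\<forall>\<^sub>F t :: real in at 0. False"
    proof eventually_elim
      case (elim t)
      then have "t \<noteq> 0" by simp
      show ?case
      proof -
        let ?d = "u (y + t *\<^sub>R a) + u (y - t *\<^sub>R a) - 2 * u y"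
        have "?d \<le> - \<epsilon> * (2 * \<bar>t\<bar> * (a \<bullet> a))"
        proof -
          have "\<epsilon> * (2 * \<bar>t\<bar> * (a \<bullet> a)) \<le> \<epsilon> * (q (y + t *\<^sub>R a) + q (y - t *\<^sub>R a) - 2 * q y)"
            using kplane[of a c y t] p \<epsilon>(1) by (intro mult_left_mono) (auto simp: qb intro: add_increasing)
          then show ?thesis using elim \<open>t \<noteq> 0\<close> by auto
        qed
        moreover have "\<bar>?d / t\<bar> < \<epsilon> * (a \<bullet> a)"
          using elim \<open>t \<noteq> 0\<close> by (simp add: diff_divide_distrib add_divide_distrib)
        then have "\<bar>?d\<bar> < \<epsilon> * (a \<bullet> a) * \<bar>t\<bar>"
          using \<open>t \<noteq> 0\<close> by (simp add: abs_divide pos_divide_less_eq)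
        moreover have "0 \<le> \<epsilon> * (a \<bullet> a) * \<bar>t\<bar>" using \<epsilon>(1) by simp
        ultimately show False by (simp add: algebra_simps)
      qed
    qed
    then show False by (simp add: trivial_limit_def[symmetric])
  next
    fix l :: real assume l: "0 \<le> l" "has_laplacian u l y"
    have "\<forall>\<^sub>F t in at 0. \<forall>b\<in>Basis. u (y + t *\<^sub>R b) + u (y - t *\<^sub>R b) - 2 * u y
      + \<epsilon> * (q (y + t *\<^sub>R b) + q (y - t *\<^sub>R b) - 2 * q y) \<le> 0"
      using near by (intro eventually_ball_finite) auto
    with eventually_neq_at_within[of 0 0 UNIV] have "\<forall>\<^sub>F t in at 0. (\<Sum>b\<in>Basis. u (y + t *\<^sub>R b) + u (y - t *\<^sub>R b) - 2 * u y) / t\<^sup>2 \<le> - 2 * \<epsilon> * DIM('a)"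
    proof eventually_elim
      case (elim t)
      then have t: "t \<noteq> 0" by simp
      show ?case
      proof -
        have "u (y + t *\<^sub>R b) + u (y - t *\<^sub>R b) - 2 * u y \<le> - 2 * \<epsilon> * t\<^sup>2" if "b \<in> Basis" for b
        proof -
          have "\<epsilon> * (2 * t\<^sup>2) \<le> \<epsilon> * (q (y + t *\<^sub>R b) + q (y - t *\<^sub>R b) - 2 * q y)"
            using k0[of y "t *\<^sub>R b"] \<epsilon>(1) that by (intro mult_left_mono) (auto simp: qb)
          then show ?thesis using elim t that by force
        qed
        then have "(\<Sum>b\<in>Basis. u (y + t *\<^sub>R b) + u (y - t *\<^sub>R b) - 2 * u y) \<le> (\<Sum>b\<in>(Basis::'a set). - 2 * \<epsilon> * t\<^sup>2)"
          by (rule sum_mono)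
        then show "(\<Sum>b\<in>Basis. u (y + t *\<^sub>R b) + u (y - t *\<^sub>R b) - 2 * u y) / t\<^sup>2 \<le> - 2 * \<epsilon> * DIM('a)"
          using t by (simp add: pos_divide_le_eq algebra_simps)
      qed
    qed
    then have "l \<le> - 2 * \<epsilon> * DIM('a)"
      using l(2) unfolding has_laplacian_def by (intro tendsto_upperbound) auto
    moreover have "0 < \<epsilon> * DIM('a)" using \<epsilon>(1) by simp
    ultimately show False using l(1) by linarith
  qed
qed

text \<open>A pair \<open>(a, c)\<close> stands for the hyperplane \<open>a \<bullet> x = c\<close>.
  Arbitrary offsets and finite sets of pairs make the class stable under translation and
  subtraction, hence under difference quotients.\<close>

definition piecewise_harmonic :: "('a::euclidean_space) set \<Rightarrow> ('a \<Rightarrow> real) \<Rightarrow> bool" where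
  "piecewise_harmonic U u \<longleftrightarrow>
     (\<forall>x\<in>U. \<exists>g. GDERIV u x :> g) \<and>
     (\<exists>N. finite N \<and> (\<forall>(a, c)\<in>N. a \<noteq> 0) \<and>
        (\<forall>x\<in>U. (\<forall>(a, c)\<in>N. a \<bullet> x \<noteq> c) \<longrightarrow> has_laplacian u 0 x))"

lemma piecewise_harmonicE:
  assumes "piecewise_harmonic U u"
  obtains N where "finite N" "\<And>a c. (a, c) \<in> N \<Longrightarrow> a \<noteq> 0"
    "\<And>x. x \<in> U \<Longrightarrow> (\<And>a c. (a, c) \<in> N \<Longrightarrow> a \<bullet> x \<noteq> c) \<Longrightarrow> has_laplacian u 0 x"
    "\<And>x. x \<in> U \<Longrightarrow> \<exists>g. GDERIV u x :> g"
  using assms unfolding piecewise_harmonic_def by (elim conjE exE) (rule that; fastforce)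

lemma piecewise_harmonicI:
  assumes "finite N" "\<And>a c. (a, c) \<in> N \<Longrightarrow> a \<noteq> 0"
    "\<And>x. x \<in> U \<Longrightarrow> (\<And>a c. (a, c) \<in> N \<Longrightarrow> a \<bullet> x \<noteq> c) \<Longrightarrow> has_laplacian u 0 x"
    "\<And>x. x \<in> U \<Longrightarrow> \<exists>g. GDERIV u x :> g"
  shows "piecewise_harmonic U u"
  unfolding piecewise_harmonic_def
  by (intro conjI exI[of _ N] ballI impI assms(3)) (use assms in auto)

lemma piecewise_harmonic_diff:
  assumes "piecewise_harmonic U u" "piecewise_harmonic U v"
  shows "piecewise_harmonic U (\<lambda>x. u x - v x)"
proof -
  obtain N where N: "finite N" "\<And>a c. (a, c) \<in> N \<Longrightarrow> a \<noteq> 0"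
    "\<And>x. x \<in> U \<Longrightarrow> (\<And>a c. (a, c) \<in> N \<Longrightarrow> a \<bullet> x \<noteq> c) \<Longrightarrow> has_laplacian u 0 x"
    "\<And>x. x \<in> U \<Longrightarrow> \<exists>g. GDERIV u x :> g"
    using assms(1) by (rule piecewise_harmonicE) (rule that; blast)
  obtain N' where N': "finite N'" "\<And>a c. (a, c) \<in> N' \<Longrightarrow> a \<noteq> 0"
    "\<And>x. x \<in> U \<Longrightarrow> (\<And>a c. (a, c) \<in> N' \<Longrightarrow> a \<bullet> x \<noteq> c) \<Longrightarrow> has_laplacian v 0 x"
    "\<And>x. x \<in> U \<Longrightarrow> \<exists>g. GDERIV v x :> g"
    using assms(2) by (rule piecewise_harmonicE) (rule that; blast)
  show ?thesis
  proof (rule piecewise_harmonicI[of "N \<union> N'"])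
    show "has_laplacian (\<lambda>x. u x - v x) 0 x"
      if "x \<in> U" "\<And>a c. (a, c) \<in> N \<union> N' \<Longrightarrow> a \<bullet> x \<noteq> c" for x
      using has_laplacian_diff[OF N(3) N'(3), of x] that by auto
    show "\<exists>g. GDERIV (\<lambda>x. u x - v x) x :> g" if "x \<in> U" for x
      using N(4)[OF that] N'(4)[OF that] by (blast intro: GDERIV_diff)
    show "a \<noteq> 0" if "(a, c) \<in> N \<union> N'" for a c
      using N(2) N'(2) that by blast
  qed (use N N' in auto)
qed

lemma piecewise_harmonic_cmult:
  assumes "piecewise_harmonic U u"
  shows "piecewise_harmonic U (\<lambda>x. c * u x)"
proof -
  obtain N where N: "finite N" "\<And>a c. (a, c) \<in> N \<Longrightarrow> a \<noteq> 0"
    "\<And>x. x \<in> U \<Longrightarrow> (\<And>a c. (a, c) \<in> N \<Longrightarrow> a \<bullet> x \<noteq> c) \<Longrightarrow> has_laplacian u 0 x"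
    "\<And>x. x \<in> U \<Longrightarrow> \<exists>g. GDERIV u x :> g"
    using assms(1) by (rule piecewise_harmonicE) (rule that; blast)
  show ?thesis
  proof (rule piecewise_harmonicI[of N])
    show "has_laplacian (\<lambda>x. c * u x) 0 x"
      if "x \<in> U" "\<And>a c. (a, c) \<in> N \<Longrightarrow> a \<bullet> x \<noteq> c" for x
      using has_laplacian_cmult[OF N(3)] that by auto
    show "\<exists>g. GDERIV (\<lambda>x. c * u x) x :> g" if "x \<in> U" for x
      using N(4)[OF that] by (blast intro: GDERIV_cmult)
  qed (use N in auto)
qed

lemma piecewise_harmonic_shift:
  assumes "piecewise_harmonic U u" "\<And>x. x \<in> V \<Longrightarrow> x + h \<in> U"
  shows "piecewise_harmonic V (\<lambda>x. u (x + h))"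
proof -
  obtain N where N: "finite N" "\<And>a c. (a, c) \<in> N \<Longrightarrow> a \<noteq> 0"
    "\<And>x. x \<in> U \<Longrightarrow> (\<And>a c. (a, c) \<in> N \<Longrightarrow> a \<bullet> x \<noteq> c) \<Longrightarrow> has_laplacian u 0 x"
    "\<And>x. x \<in> U \<Longrightarrow> \<exists>g. GDERIV u x :> g"
    using assms(1) by (rule piecewise_harmonicE) (rule that; blast)
  show ?thesis
  proof (rule piecewise_harmonicI[of "(\<lambda>(a, c). (a, c - a \<bullet> h)) ` N"])
    show "has_laplacian (\<lambda>x. u (x + h)) 0 x"
      if x: "x \<in> V" "\<And>a c. (a, c) \<in> (\<lambda>(a, c). (a, c - a \<bullet> h)) ` N \<Longrightarrow> a \<bullet> x \<noteq> c" for x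
      unfolding has_laplacian_shift
    proof (rule N(3))
      fix a c assume "(a, c) \<in> N"
      then have "a \<bullet> x \<noteq> c - a \<bullet> h" by (intro x(2)) force
      then show "a \<bullet> (x + h) \<noteq> c" by (simp add: inner_simps)
    qed (use assms x in auto)
    show "\<exists>g. GDERIV (\<lambda>x. u (x + h)) x :> g" if "x \<in> V" for x
      using N(4)[OF assms(2)[OF that]] by (blast intro: GDERIV_shift)
  qed (use N in auto)
qed

text \<open>As \<open>n\<close> is a coordinate vector, the reflection swaps the two neighbours of a
  point in direction \<open>n\<close> and moves the others in parallel, so the sum of second
  differences is literally preserved.\<close>

lemma piecewise_harmonic_reflect:
  assumes "piecewise_harmonic U u" "n \<in> Basis"
    and R: "R = (\<lambda>x. x - (2 * ((x - z) \<bullet> n)) *\<^sub>R n)" and V: "\<And>x. x \<in> V \<Longrightarrow> R x \<in> U"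
  shows "piecewise_harmonic V (\<lambda>x. u (R x))"
proof -
  obtain N where N: "finite N" "\<And>a c. (a, c) \<in> N \<Longrightarrow> a \<noteq> 0"
    "\<And>x. x \<in> U \<Longrightarrow> (\<And>a c. (a, c) \<in> N \<Longrightarrow> a \<bullet> x \<noteq> c) \<Longrightarrow> has_laplacian u 0 x"
    "\<And>x. x \<in> U \<Longrightarrow> \<exists>g. GDERIV u x :> g"
    using assms(1) by (rule piecewise_harmonicE) (rule that; blast)
  \<comment> \<open>The preimages of the exceptional hyperplanes under \<open>R\<close>: the linear
    part of \<open>R\<close> is self-adjoint, so it moves to \<open>a\<close>, and the translation
    part changes the offset.\<close>
  define f where "f = (\<lambda>(a, c). (a - (2 * (a \<bullet> n)) *\<^sub>R n, c - 2 * (z \<bullet> n) * (a \<bullet> n)))"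
  have nn: "n \<bullet> n = 1" using assms(2) by simp
  show ?thesis
  proof (rule piecewise_harmonicI[of "f ` N"])
    show "finite (f ` N)" using N by simp
    show "a \<noteq> 0" if "(a, c) \<in> f ` N" for a c
    proof
      assume "a = 0"
      then obtain a' c' where a': "(a', c') \<in> N" "a' - (2 * (a' \<bullet> n)) *\<^sub>R n = 0"
        using \<open>(a, c) \<in> f ` N\<close> unfolding f_def by force
      then have "(a' - (2 * (a' \<bullet> n)) *\<^sub>R n) \<bullet> n = 0" by simp
      then have "a' \<bullet> n = 0" using nn by (simp add: inner_simps)
      then show False using a' N(2) by auto
    qed
    show "has_laplacian (\<lambda>x. u (R x)) 0 x"
      if x: "x \<in> V" "\<And>a c. (a, c) \<in> f ` N \<Longrightarrow> a \<bullet> x \<noteq> c" for x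
    proof -
      have "has_laplacian u 0 (R x)"
      proof (rule N(3))
        fix a c assume "(a, c) \<in> N"
        then have "(a - (2 * (a \<bullet> n)) *\<^sub>R n) \<bullet> x \<noteq> c - 2 * (z \<bullet> n) * (a \<bullet> n)"
          by (intro x(2)) (force simp: f_def)
        then show "a \<bullet> R x \<noteq> c" by (simp add: R inner_simps inner_commute algebra_simps)
      qed (use V x in auto)
      moreover have "u (R (x + t *\<^sub>R b)) + u (R (x - t *\<^sub>R b)) = u (R x + t *\<^sub>R b) + u (R x - t *\<^sub>R b)"
        if b: "b \<in> Basis" for t b
      proof (cases "b = n")
        case True
        then have "R (x + t *\<^sub>R b) = R x - t *\<^sub>R b" "R (x - t *\<^sub>R b) = R x + t *\<^sub>R b"
          using nn by (simp_all add: R inner_simps algebra_simps scaleR_2[symmetric])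
        then show ?thesis by simp
      next
        case False
        then have "b \<bullet> n = 0" using b assms(2) inner_not_same_Basis by blast
        then have "R (x + t *\<^sub>R b) = R x + t *\<^sub>R b" "R (x - t *\<^sub>R b) = R x - t *\<^sub>R b"
          by (simp_all add: R inner_simps algebra_simps)
        then show ?thesis by simp
      qed
      ultimately show ?thesis by (simp add: has_laplacian_def)
    qed
    show "\<exists>g. GDERIV (\<lambda>x. u (R x)) x :> g" if xV: "x \<in> V" for x
    proof -
      obtain g where "GDERIV u (R x) :> g" using N(4)[OF V[OF xV]] by blast
      then have "((\<lambda>x. u (R x)) has_derivative (\<lambda>h. (h - (2 * (h \<bullet> n)) *\<^sub>R n) \<bullet> g)) (at x)"
        unfolding gderiv_def
        by (intro has_derivative_compose[of R _ x UNIV u]) (auto simp: R intro!: derivative_eq_intros)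
      then have "GDERIV (\<lambda>x. u (R x)) x :> g - (2 * (g \<bullet> n)) *\<^sub>R n"
        by (simp add: gderiv_def inner_simps inner_commute algebra_simps)
      then show ?thesis by blast
    qed
  qed
qed

text \<open>Comparison of the odd part of \<open>u\<close> with a quadratic barrier on a half ball.\<close>

lemma piecewise_harmonic_odd_part_le:
  fixes u :: "'a::euclidean_space \<Rightarrow> real" and S :: real
  assumes u: "piecewise_harmonic (ball z r) u" and S: "\<And>x. x \<in> ball z r \<Longrightarrow> \<bar>u x\<bar> \<le> S"
    and n: "n \<in> Basis" and t: "0 < t" "t \<le> \<rho>" "\<rho> < r"
  shows "u (z + t *\<^sub>R n) - u (z - t *\<^sub>R n) \<le> 2 * S * (DIM('a) + 1) * t / \<rho>"
proof -
  \<comment> \<open>The smallest integer for which the barrier \<open>b\<close> is strictly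
    superharmonic: its Laplacian is (2 DIM - 2 D) / \<rho>^2 = -2 / \<rho>^2. On the flat side the
    odd part of \<open>u\<close> vanishes and \<open>b\<close> is nonnegative.\<close>
  define D where "D = real (DIM('a) + 1)"
  define R where "R x = x - (2 * ((x - z) \<bullet> n)) *\<^sub>R n" for x
  define b where "b x = ((norm (x - z))\<^sup>2 - D * ((x - z) \<bullet> n)\<^sup>2) / \<rho>\<^sup>2 + D / \<rho> * ((x - z) \<bullet> n)" for x
  define v where "v x = (u x - u (R x)) - 2 * S * b x" for x
  define K where "K = cball z \<rho> \<inter> {x. n \<bullet> z \<le> n \<bullet> x}"
  have nn: "n \<bullet> n = 1" and \<rho>: "0 < \<rho>" using n t by auto
  have "0 \<le> \<bar>u z\<bar>" by simp
  also have "\<dots> \<le> S" using S[of z] t \<rho> by auto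
  finally have S0: "0 \<le> S" .
  have Rn: "norm (R x - z) = norm (x - z)" for x
    unfolding norm_eq_sqrt_inner using nn
    by (simp add: R_def inner_simps inner_commute algebra_simps)
  have RV: "R x \<in> ball z r" if "x \<in> ball z r" for x
    using that Rn[of x] by (simp add: dist_norm norm_minus_commute)
  have "piecewise_harmonic (ball z r) (\<lambda>x. u (R x))"
    using u n meta_eq_to_obj_eq[OF R_def[abs_def]] RV by (rule piecewise_harmonic_reflect)
  with u have odd: "piecewise_harmonic (ball z r) (\<lambda>x. u x - u (R x))"
    by (rule piecewise_harmonic_diff)
  obtain N where N: "finite N" "\<And>a c. (a, c) \<in> N \<Longrightarrow> a \<noteq> 0"
    "\<And>x. x \<in> ball z r \<Longrightarrow> (\<And>a c. (a, c) \<in> N \<Longrightarrow> a \<bullet> x \<noteq> c) \<Longrightarrow> has_laplacian (\<lambda>x. u x - u (R x)) 0 x"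
    "\<And>x. x \<in> ball z r \<Longrightarrow> \<exists>g. GDERIV (\<lambda>x. u x - u (R x)) x :> g"
    using odd by (rule piecewise_harmonicE) (rule that; blast)
  have Kr: "K \<subseteq> ball z r" using t by (auto simp: K_def)
  have bg: "\<exists>g. GDERIV b x :> g" for x
  proof -
    have "(b has_derivative (\<lambda>h. h \<bullet> ((2 / \<rho>\<^sup>2) *\<^sub>R (x - z) - (2 * D * ((x - z) \<bullet> n) / \<rho>\<^sup>2) *\<^sub>R n + (D / \<rho>) *\<^sub>R n))) (at x)"
      unfolding b_def power2_norm_eq_inner using \<rho>
      by (auto intro!: derivative_eq_intros simp: inner_simps inner_commute field_simps)
    then show ?thesis unfolding gderiv_def by blast
  qed
  have vg: "\<exists>g. GDERIV v x :> g" if xK: "x \<in> K" for x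
  proof -
    obtain g g' where "GDERIV (\<lambda>x. u x - u (R x)) x :> g" "GDERIV b x :> g'"
      using N(4)[of x] bg[of x] Kr xK by blast
    from GDERIV_diff[OF this(1) GDERIV_cmult[OF this(2)]] show ?thesis
      unfolding v_def by (intro exI)
  qed
  have bl: "has_laplacian b (- 2 / \<rho>\<^sup>2) x" for x
  proof -
    have "has_laplacian (\<lambda>x. 1 / \<rho>\<^sup>2 * ((norm (x - z))\<^sup>2 - D * ((x - z) \<bullet> n)\<^sup>2) + D / \<rho> * ((x - z) \<bullet> n))
        (1 / \<rho>\<^sup>2 * (2 * DIM('a) - D * (2 * (norm n)\<^sup>2)) + D / \<rho> * 0) x"
      by (intro has_laplacian_add has_laplacian_diff has_laplacian_cmult has_laplacian_norm_power2
          has_laplacian_inner_power2 has_laplacian_inner)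
    then have "has_laplacian b (1 / \<rho>\<^sup>2 * (2 * DIM('a) - D * (2 * (norm n)\<^sup>2)) + D / \<rho> * 0) x"
      by (simp add: b_def[abs_def])
    then show ?thesis using n by (simp add: D_def algebra_simps)
  qed
  have "v (z + t *\<^sub>R n) \<le> 0"
  proof (rule maximum_principle[of K v N])
    show "compact K"
      unfolding K_def by (intro compact_Int_closed compact_cball closed_halfspace_ge)
    show "continuous_on K v"
      using vg GDERIV_isCont by (intro continuous_at_imp_continuous_on) blast
    show "x \<in> interior K" if x: "x \<in> K" "0 < v x" for x
    proof (rule interiorI)
      show "open (ball z \<rho> \<inter> {x. n \<bullet> z < n \<bullet> x})"
        by (intro open_Int open_ball open_halfspace_gt)
      have "(x - z) \<bullet> n \<noteq> 0"
      proof
        assume "(x - z) \<bullet> n = 0"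
        then have "v x \<le> 0" using S0 by (simp add: v_def R_def b_def)
        with x show False by simp
      qed
      moreover have "norm (x - z) \<noteq> \<rho>"
      proof
        assume e: "norm (x - z) = \<rho>"
        define s where "s = ((x - z) \<bullet> n) / \<rho>"
        have "(x - z) \<bullet> n \<le> norm (x - z) * norm n" by (rule norm_cauchy_schwarz)
        then have s: "0 \<le> s" "s \<le> 1"
          using x \<rho> e n unfolding s_def K_def by (auto simp: inner_simps inner_commute)
        \<comment> \<open>On the spherical side the linear term of \<open>b\<close> compensates its
          negative quadratic term, so \<open>b\<close> is at least 1 there and
          \<open>2 * S * b\<close> dominates the odd part.\<close>
        have "b x = 1 + D * (s * (1 - s))"
          using \<rho> e by (simp add: b_def s_def field_simps power2_eq_square)
        moreover have "0 \<le> D * (s * (1 - s))" using s by (simp add: D_def)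
        ultimately have "S * 1 \<le> S * b x" using S0 by (intro mult_left_mono) auto
        moreover have "\<bar>u x\<bar> \<le> S" "\<bar>u (R x)\<bar> \<le> S" using S RV Kr x by auto
        ultimately have "v x \<le> 0" by (simp add: v_def)
        with x show False by simp
      qed
      ultimately show "x \<in> ball z \<rho> \<inter> {x. n \<bullet> z < n \<bullet> x}"
        using x by (auto simp: K_def inner_simps inner_commute dist_norm norm_minus_commute)
    qed (auto simp: K_def)
    show "(\<exists>(a, c)\<in>N. a \<bullet> x = c) \<and> (\<exists>g. GDERIV v x :> g) \<or> (\<exists>l\<ge>0. has_laplacian v l x)"
      if x: "x \<in> K" "0 < v x" for x
    proof (cases "\<exists>(a, c)\<in>N. a \<bullet> x = c")
      case False
      then have "has_laplacian (\<lambda>x. u x - u (R x)) 0 x" using x Kr by (intro N(3)) auto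
      from has_laplacian_diff[OF this has_laplacian_cmult[OF bl, where c = "2 * S"]]
      have "has_laplacian v (0 - 2 * S * (- 2 / \<rho>\<^sup>2)) x" by (simp add: v_def[abs_def])
      then show ?thesis using S0 by (intro disjI2 exI conjI) auto
    qed (use vg x in auto)
    show "z + t *\<^sub>R n \<in> K" using t n by (auto simp: K_def dist_norm inner_simps)
  qed (use N in auto)
  moreover have "R (z + t *\<^sub>R n) = z - t *\<^sub>R n"
    using nn by (simp add: R_def algebra_simps scaleR_2[symmetric])
  moreover have "b (z + t *\<^sub>R n) \<le> D * t / \<rho>"
  proof -
    have "b (z + t *\<^sub>R n) = (1 - D) * (t\<^sup>2 / \<rho>\<^sup>2) + D * t / \<rho>"
      using n nn by (simp add: b_def power_mult_distrib algebra_simps diff_divide_distrib)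
    moreover have "(1 - D) * (t\<^sup>2 / \<rho>\<^sup>2) \<le> 0" by (intro mult_nonpos_nonneg) (auto simp: D_def)
    ultimately show ?thesis by simp
  qed
  then have "S * b (z + t *\<^sub>R n) \<le> S * (D * t / \<rho>)" using S0 by (intro mult_left_mono)
  ultimately have "u (z + t *\<^sub>R n) - u (z - t *\<^sub>R n) \<le> 2 * (S * (D * t / \<rho>))" by (simp add: v_def)
  then show ?thesis by (simp add: D_def mult.assoc)
qed

section \<open>Interior regularity\<close>

text \<open>Uniform limits are admitted because the derivatives of a function of this class belong to it again,
  as limits of difference quotients, before anything is known about their second derivatives.\<close>

definition approx_harmonic :: "'a::euclidean_space \<Rightarrow> real \<Rightarrow> ('a \<Rightarrow> real) \<Rightarrow> bool" where
  "approx_harmonic z r u \<longleftrightarrow>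
     (\<forall>e>0. \<exists>f. piecewise_harmonic (ball z r) f \<and> (\<forall>x\<in>ball z r. \<bar>u x - f x\<bar> \<le> e))"

lemma piecewise_imp_approx_harmonic: "piecewise_harmonic (ball z r) u \<Longrightarrow> approx_harmonic z r u"
  unfolding approx_harmonic_def by (intro allI impI exI[of _ u]) auto

lemma approx_harmonic_shift:
  assumes "approx_harmonic z r u" "norm h \<le> r - r'"
  shows "approx_harmonic z r' (\<lambda>x. u (x + h))"
  unfolding approx_harmonic_def
proof (intro allI impI)
  fix e :: real assume "0 < e"
  then obtain f where f: "piecewise_harmonic (ball z r) f" "\<forall>x\<in>ball z r. \<bar>u x - f x\<bar> \<le> e"
    using assms(1) unfolding approx_harmonic_def by blast
  have "x + h \<in> ball z r" if "x \<in> ball z r'" for x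
    using norm_triangle_ineq4[of "z - x" h] that assms(2) by (simp add: dist_norm algebra_simps)
  then show "\<exists>f. piecewise_harmonic (ball z r') f \<and> (\<forall>x\<in>ball z r'. \<bar>u (x + h) - f x\<bar> \<le> e)"
    using f piecewise_harmonic_shift[OF f(1), of "ball z r'" h] by (intro exI[of _ "\<lambda>x. f (x + h)"]) auto
qed

lemma approx_harmonic_mono: "approx_harmonic z r u \<Longrightarrow> r' \<le> r \<Longrightarrow> approx_harmonic z r' u"
  using approx_harmonic_shift[of z r u 0 r'] by simp

lemma approx_harmonic_diff:
  assumes "approx_harmonic z r u" "approx_harmonic z r v"
  shows "approx_harmonic z r (\<lambda>x. u x - v x)"
  unfolding approx_harmonic_def
proof (intro allI impI)
  fix e :: real assume "0 < e"
  then have "0 < e / 2" by simp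
  obtain f where f: "piecewise_harmonic (ball z r) f" "\<forall>x\<in>ball z r. \<bar>u x - f x\<bar> \<le> e / 2"
    using assms(1) \<open>0 < e / 2\<close> unfolding approx_harmonic_def by blast
  obtain f' where f': "piecewise_harmonic (ball z r) f'" "\<forall>x\<in>ball z r. \<bar>v x - f' x\<bar> \<le> e / 2"
    using assms(2) \<open>0 < e / 2\<close> unfolding approx_harmonic_def by blast
  show "\<exists>f. piecewise_harmonic (ball z r) f \<and> (\<forall>x\<in>ball z r. \<bar>u x - v x - f x\<bar> \<le> e)"
  proof (intro exI[of _ "\<lambda>x. f x - f' x"] conjI ballI piecewise_harmonic_diff f(1) f'(1))
    fix x assume "x \<in> ball z r"
    then have "\<bar>u x - f x\<bar> \<le> e / 2" "\<bar>v x - f' x\<bar> \<le> e / 2" using f(2) f'(2) by auto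
    then show "\<bar>u x - v x - (f x - f' x)\<bar> \<le> e" by linarith
  qed
qed

lemma approx_harmonic_cmult:
  assumes "approx_harmonic z r u"
  shows "approx_harmonic z r (\<lambda>x. c * u x)"
  unfolding approx_harmonic_def
proof (intro allI impI)
  fix e :: real assume "0 < e"
  then have "0 < e / (\<bar>c\<bar> + 1)" by simp
  then obtain f where f: "piecewise_harmonic (ball z r) f" "\<forall>x\<in>ball z r. \<bar>u x - f x\<bar> \<le> e / (\<bar>c\<bar> + 1)"
    using assms unfolding approx_harmonic_def by blast
  have "\<bar>c * u x - c * f x\<bar> \<le> e" if "x \<in> ball z r" for x
  proof -
    have "\<bar>c * u x - c * f x\<bar> = \<bar>c\<bar> * \<bar>u x - f x\<bar>" by (simp add: abs_mult right_diff_distrib[symmetric])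
    also have "\<dots> \<le> (\<bar>c\<bar> + 1) * (e / (\<bar>c\<bar> + 1))" using f that by (intro mult_mono) auto
    finally show ?thesis by simp
  qed
  then show "\<exists>f. piecewise_harmonic (ball z r) f \<and> (\<forall>x\<in>ball z r. \<bar>c * u x - f x\<bar> \<le> e)"
    using f(1) by (intro exI[of _ "\<lambda>x. c * f x"]) (auto intro: piecewise_harmonic_cmult)
qed

lemma approx_harmonic_limit:
  assumes "\<And>e. 0 < e \<Longrightarrow> \<exists>f. approx_harmonic z r f \<and> (\<forall>x\<in>ball z r. \<bar>u x - f x\<bar> \<le> e)"
  shows "approx_harmonic z r u"
  unfolding approx_harmonic_def
proof (intro allI impI)
  fix e :: real assume e: "0 < e"
  then obtain f where f: "approx_harmonic z r f" "\<forall>x\<in>ball z r. \<bar>u x - f x\<bar> \<le> e / 2"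
    using assms[of "e / 2"] by auto
  obtain f' where f': "piecewise_harmonic (ball z r) f'" "\<forall>x\<in>ball z r. \<bar>f x - f' x\<bar> \<le> e / 2"
    using f(1) half_gt_zero[OF e] unfolding approx_harmonic_def by blast
  show "\<exists>f. piecewise_harmonic (ball z r) f \<and> (\<forall>x\<in>ball z r. \<bar>u x - f x\<bar> \<le> e)"
  proof (intro exI[of _ f'] conjI ballI f'(1))
    fix x assume "x \<in> ball z r"
    then have "\<bar>u x - f x\<bar> \<le> e / 2" "\<bar>f x - f' x\<bar> \<le> e / 2" using f(2) f'(2) by auto
    then show "\<bar>u x - f' x\<bar> \<le> e" by linarith
  qed
qed

text \<open>The odd-part estimate involves function values only, so it survives uniform limits; it
  is applied on the largest ball about \<open>x\<close> inside \<open>ball z r\<close>.\<close>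

lemma approx_harmonic_symmetric_difference_le:
  fixes u :: "'a::euclidean_space \<Rightarrow> real" and S :: real
  assumes u: "approx_harmonic z r u" and S: "\<And>x. x \<in> ball z r \<Longrightarrow> \<bar>u x\<bar> \<le> S"
    and n: "n \<in> Basis" and t: "0 < t" "t \<le> \<rho>" "dist z x + \<rho> < r"
  shows "u (x + t *\<^sub>R n) - u (x - t *\<^sub>R n) \<le> 2 * S * (DIM('a) + 1) * t / \<rho>"
proof -
  define A where "A = 2 * (DIM('a) + 1) * t / \<rho>"
  have A: "0 \<le> A" using t by (simp add: A_def)
  have sub: "ball x (r - dist z x) \<subseteq> ball z r"
  proof
    fix y assume "y \<in> ball x (r - dist z x)"
    then show "y \<in> ball z r" using dist_triangle[of z y x] by simp
  qed
  have "u (x + t *\<^sub>R n) - u (x - t *\<^sub>R n) \<le> S * A + e" if "0 < e" for e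
  proof -
    \<comment> \<open>Replacing \<open>u\<close> by \<open>f\<close> raises the bound
      \<open>S\<close> by \<open>d\<close>, which costs \<open>d * A\<close>, and changes the two
      values by \<open>d\<close> each: \<open>d * (A + 2) = e\<close> in total.\<close>
    define d where "d = e / (A + 2)"
    have d: "0 < d" "e = d * (A + 2)" using that A by (auto simp: d_def)
    obtain f where f: "piecewise_harmonic (ball z r) f" "\<forall>x\<in>ball z r. \<bar>u x - f x\<bar> \<le> d"
      using u d(1) unfolding approx_harmonic_def by blast
    have f': "piecewise_harmonic (ball x (r - dist z x)) f"
      using piecewise_harmonic_shift[OF f(1), of "ball x (r - dist z x)" 0] subsetD[OF sub] by simp
    have "\<bar>f y\<bar> \<le> S + d" if "y \<in> ball x (r - dist z x)" for y
      using f(2) S[of y] sub that by fastforce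
    then have "f (x + t *\<^sub>R n) - f (x - t *\<^sub>R n) \<le> 2 * (S + d) * (DIM('a) + 1) * t / \<rho>"
      using t by (intro piecewise_harmonic_odd_part_le[OF f' _ n]) auto
    also have "\<dots> = (S + d) * A" by (simp add: A_def field_simps)
    finally have *: "f (x + t *\<^sub>R n) - f (x - t *\<^sub>R n) \<le> (S + d) * A" .
    have "x + t *\<^sub>R n \<in> ball x (r - dist z x)" "x - t *\<^sub>R n \<in> ball x (r - dist z x)"
      using n t by (auto simp: dist_norm)
    then have "\<bar>u (x + t *\<^sub>R n) - f (x + t *\<^sub>R n)\<bar> \<le> d" "\<bar>u (x - t *\<^sub>R n) - f (x - t *\<^sub>R n)\<bar> \<le> d"
      using f(2) sub by blast+
    with * show ?thesis by (simp add: d(2) algebra_simps)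
  qed
  then have "u (x + t *\<^sub>R n) - u (x - t *\<^sub>R n) \<le> S * A" by (rule field_le_epsilon)
  then show ?thesis by (simp add: A_def algebra_simps)
qed

text \<open>Dividing the symmetric difference by 2t and letting t tend to 0 from the right bounds
  each partial derivative, from both sides by using \<open>- u\<close> as well; summing the
  coordinates gives the factor \<open>DIM('a)\<close>.\<close>

lemma approx_harmonic_gradient_bound:
  fixes u :: "'a::euclidean_space \<Rightarrow> real" and S :: real
  assumes u: "approx_harmonic z r u" and S: "\<And>x. x \<in> ball z r \<Longrightarrow> \<bar>u x\<bar> \<le> S"
    and g: "GDERIV u x :> g" and \<rho>: "0 < \<rho>" "dist z x + \<rho> < r"
  shows "norm g \<le> DIM('a) * (DIM('a) + 1) * S / \<rho>"
proof -
  have le: "b \<bullet> k \<le> S * (DIM('a) + 1) / \<rho>"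
    if v: "approx_harmonic z r v" and S: "\<And>x. x \<in> ball z r \<Longrightarrow> \<bar>v x\<bar> \<le> S"
      and k: "GDERIV v x :> k" and b: "b \<in> Basis" for v :: "'a \<Rightarrow> real" and k b
  proof -
    have "((\<lambda>t. ((v (x + t *\<^sub>R b) - v x) / t + (v (x + t *\<^sub>R (- b)) - v x) / t * (- 1)) / 2)
        \<longlongrightarrow> (b \<bullet> k + (- b) \<bullet> k * (- 1)) / 2) (at 0)"
      by (intro tendsto_intros directional_difference_quotient_limit[OF k]) auto
    then have lim: "((\<lambda>t. ((v (x + t *\<^sub>R b) - v x) / t + (v (x + t *\<^sub>R (- b)) - v x) / t * (- 1)) / 2)
        \<longlongrightarrow> b \<bullet> k) (at_right 0)"
      by (intro tendsto_within_subset[of _ _ 0 UNIV "{0<..}"]) auto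
    have "\<forall>\<^sub>F t in at_right 0. 0 < t \<and> t < \<rho>"
      using \<rho> eventually_at_right[of 0 \<rho>] by (auto simp: eventually_at_right_less)
    then have "\<forall>\<^sub>F t in at_right 0. ((v (x + t *\<^sub>R b) - v x) / t + (v (x + t *\<^sub>R (- b)) - v x) / t * (- 1)) / 2
        \<le> S * (DIM('a) + 1) / \<rho>"
    proof eventually_elim
      case (elim t)
      have "((v (x + t *\<^sub>R b) - v x) / t + (v (x + t *\<^sub>R (- b)) - v x) / t * (- 1)) / 2
          = (v (x + t *\<^sub>R b) - v (x - t *\<^sub>R b)) / (2 * t)"
        using elim by (simp add: field_simps)
      also have "\<dots> \<le> (2 * S * (DIM('a) + 1) * t / \<rho>) / (2 * t)"
        using elim \<rho>
        by (intro divide_right_mono approx_harmonic_symmetric_difference_le[OF v S b]) auto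
      also have "\<dots> = S * (DIM('a) + 1) / \<rho>" using elim by (simp add: field_simps)
      finally show ?case .
    qed
    then show ?thesis using lim by (intro tendsto_upperbound[OF lim]) auto
  qed
  have "approx_harmonic z r (\<lambda>x. - u x)" using approx_harmonic_cmult[OF u, of "-1"] by simp
  then have "\<bar>g \<bullet> b\<bar> \<le> S * (DIM('a) + 1) / \<rho>" if "b \<in> Basis" for b
    using le[OF u S g that] le[of "\<lambda>x. - u x" "- g" b] S GDERIV_minus[OF g] that
    by (auto simp: inner_commute)
  then have "(\<Sum>b\<in>Basis. \<bar>g \<bullet> b\<bar>) \<le> (\<Sum>b\<in>(Basis::'a set). S * (DIM('a) + 1) / \<rho>)"
    by (rule sum_mono)
  with norm_le_l1[of g] show ?thesis by (simp add: algebra_simps)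
qed

text \<open>The step that gains one derivative. Difference quotients belong to the class and
  converge uniformly to \<open>g x \<bullet> n\<close>, since \<open>g\<close> is continuous; the
  gradient bound applied to their differences makes their gradients uniformly Cauchy.\<close>

lemma approx_harmonic_gradient_C1:
  fixes u :: "'a::euclidean_space \<Rightarrow> real"
  assumes u: "approx_harmonic z r u" and g: "\<And>x. x \<in> ball z r \<Longrightarrow> GDERIV u x :> g x"
    and cg: "continuous_on (ball z r) g" and r': "0 < r'" "r' < r" and n: "n \<in> Basis"
  shows "approx_harmonic z r' (\<lambda>x. g x \<bullet> n)"
    and "\<exists>G. continuous_on (ball z r') G \<and> (\<forall>x\<in>ball z r'. GDERIV (\<lambda>x. g x \<bullet> n) x :> G x)"
proof -
  \<comment> \<open>One third leaves a compact ball on which \<open>g\<close> is uniformly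
    continuous, one is room for the translations, and one is the radius used in the gradient
    bound.\<close>
  define \<delta> where "\<delta> = (r - r') / 3"
  have \<delta>: "0 < \<delta>" "r' = r - 3 * \<delta>" using r' by (simp_all add: \<delta>_def field_simps)
  \<comment> \<open>The offset 2 gives \<open>h k < \<delta>\<close> already for
    \<open>k = 0\<close>.\<close>
  define h where "h k = \<delta> / real (k + 2)" for k :: nat
  have h: "0 < h k" "h k < \<delta>" for k using \<delta>(1) by (auto simp: h_def divide_simps)
  have h0: "h \<longlonglongrightarrow> 0"
    unfolding h_def using LIMSEQ_ignore_initial_segment[OF lim_const_over_n[of \<delta>], of 2] by simp
  define f where "f k x = 1 / h k * (u (x + h k *\<^sub>R n) - u x)" for k x
  define F where "F k x = (1 / h k) *\<^sub>R (g (x + h k *\<^sub>R n) - g x)" for k x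
  have in1: "x + s *\<^sub>R n \<in> cball z (r - \<delta>)" if "x \<in> ball z (r - 2 * \<delta>)" "\<bar>s\<bar> \<le> \<delta>" for x s
    using norm_triangle_ineq4[of "z - x" "s *\<^sub>R n"] that n by (simp add: dist_norm algebra_simps)
  have cb: "cball z (r - \<delta>) \<subseteq> ball z r" using \<delta> by auto
  have in2: "x + s *\<^sub>R n \<in> ball z r" if "x \<in> ball z (r - 2 * \<delta>)" "\<bar>s\<bar> \<le> \<delta>" for x s
    using in1[OF that] cb by blast
  have b2: "ball z (r - 2 * \<delta>) \<subseteq> ball z r" using \<delta> by auto
  \<comment> \<open>By the mean value theorem \<open>f k x\<close> is the component of
    \<open>g\<close> at an intermediate point, so the error is controlled by the modulus of
    continuity of \<open>g\<close>.\<close>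
  have conv: "\<exists>K. \<forall>k\<ge>K. \<forall>x\<in>ball z (r - 2 * \<delta>). \<bar>f k x - g x \<bullet> n\<bar> \<le> e" if "0 < e" for e
  proof -
    have "uniformly_continuous_on (cball z (r - \<delta>)) g"
      using cg cb by (intro compact_uniformly_continuous) (auto intro: continuous_on_subset)
    then obtain d where d: "0 < d"
      "\<forall>x\<in>cball z (r - \<delta>). \<forall>y\<in>cball z (r - \<delta>). dist y x < d \<longrightarrow> dist (g y) (g x) < e"
      using \<open>0 < e\<close> unfolding uniformly_continuous_on_def by blast
    obtain K where K: "\<And>k. K \<le> k \<Longrightarrow> h k < d"
      using order_tendstoD(2)[OF h0 d(1)] unfolding eventually_sequentially by blast
    have "\<bar>f k x - g x \<bullet> n\<bar> \<le> e" if k: "K \<le> k" and x: "x \<in> ball z (r - 2 * \<delta>)" for k x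
    proof -
      have der: "((\<lambda>s. u (x + s *\<^sub>R n)) has_real_derivative n \<bullet> g (x + s *\<^sub>R n)) (at s)" if "0 \<le> s" "s \<le> h k" for s
      proof -
        have "GDERIV u (x + s *\<^sub>R n) :> g (x + s *\<^sub>R n)" using that h[of k] x by (intro g in2) auto
        then show ?thesis by (rule GDERIV_line)
      qed
      obtain s where s: "0 < s" "s < h k" "u (x + h k *\<^sub>R n) - u (x + 0 *\<^sub>R n) = (h k - 0) * (n \<bullet> g (x + s *\<^sub>R n))"
        using MVT2[OF h(1)[of k], of "\<lambda>s. u (x + s *\<^sub>R n)" "\<lambda>s. n \<bullet> g (x + s *\<^sub>R n)"] der by blast
      have "f k x - g x \<bullet> n = (g (x + s *\<^sub>R n) - g x) \<bullet> n"
        using s(3) h[of k] by (simp add: f_def inner_simps inner_commute)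
      also have "\<bar>\<dots>\<bar> \<le> norm (g (x + s *\<^sub>R n) - g x) * norm n" by (rule Cauchy_Schwarz_ineq2)
      also have "\<dots> < e"
        using d(2)[rule_format, of x "x + s *\<^sub>R n"] in1[OF x, of s] in1[OF x, of 0] s h[of k] K[OF k] n \<delta>(1)
        by (simp add: dist_norm)
      finally show ?thesis by simp
    qed
    then show ?thesis by blast
  qed
  have fa: "approx_harmonic z (r - 2 * \<delta>) (f k)" for k
  proof -
    have "approx_harmonic z (r - 2 * \<delta>) (\<lambda>x. u (x + h k *\<^sub>R n))"
      using h[of k] \<delta>(1) n by (intro approx_harmonic_shift[OF u]) simp
    moreover have "approx_harmonic z (r - 2 * \<delta>) u"
      using \<delta>(1) by (intro approx_harmonic_mono[OF u]) simp
    ultimately show ?thesis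
      unfolding f_def by (intro approx_harmonic_cmult approx_harmonic_diff)
  qed
  have "approx_harmonic z (r - 2 * \<delta>) (\<lambda>x. g x \<bullet> n)"
  proof (rule approx_harmonic_limit)
    fix e :: real assume "0 < e"
    then obtain k where k: "\<forall>i\<ge>k. \<forall>x\<in>ball z (r - 2 * \<delta>). \<bar>f i x - g x \<bullet> n\<bar> \<le> e"
      using conv[OF \<open>0 < e\<close>] by (elim exE)
    show "\<exists>f. approx_harmonic z (r - 2 * \<delta>) f \<and> (\<forall>x\<in>ball z (r - 2 * \<delta>). \<bar>g x \<bullet> n - f x\<bar> \<le> e)"
    proof (intro exI[of _ "f k"] conjI ballI fa)
      show "\<bar>g x \<bullet> n - f k x\<bar> \<le> e" if "x \<in> ball z (r - 2 * \<delta>)" for x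
        unfolding abs_minus_commute[of "g x \<bullet> n"] using k that by blast
    qed
  qed
  then show "approx_harmonic z r' (\<lambda>x. g x \<bullet> n)" by (rule approx_harmonic_mono) (use \<delta> in simp)
  have Fg: "GDERIV (f k) x :> F k x" if "x \<in> ball z (r - 2 * \<delta>)" for k x
    unfolding f_def F_def using in2[OF that, of "h k"] b2 that h[of k]
    by (intro GDERIV_cmult GDERIV_diff GDERIV_shift g) auto
  define C where "C = real (DIM('a) * (DIM('a) + 1))"
  have C: "0 < C" unfolding C_def by (simp only: of_nat_0_less_iff) simp
  have "uniformly_Cauchy_on (ball z r') F"
  proof (rule uniformly_Cauchy_onI)
    fix e :: real assume "0 < e"
    \<comment> \<open>Two quotients differ by at most \<open>2 * e'\<close>, and the gradient bound
      turns this into \<open>C * (2 * e') / \<delta> = e / 2\<close>.\<close>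
    define e' where "e' = e * \<delta> / (4 * C)"
    have e': "0 < e'" using \<open>0 < e\<close> C \<delta> by (simp add: e'_def)
    then obtain K where K: "\<And>k x. K \<le> k \<Longrightarrow> x \<in> ball z (r - 2 * \<delta>) \<Longrightarrow> \<bar>f k x - g x \<bullet> n\<bar> \<le> e'"
      using conv by blast
    have "dist (F k x) (F l x) < e" if kl: "K \<le> k" "K \<le> l" and x: "x \<in> ball z r'" for k l x
    proof -
      have x2: "x \<in> ball z (r - 2 * \<delta>)" using x \<delta> by auto
      have "norm (F k x - F l x) \<le> DIM('a) * (DIM('a) + 1) * (2 * e') / \<delta>"
      proof (rule approx_harmonic_gradient_bound)
        show "approx_harmonic z (r - 2 * \<delta>) (\<lambda>x. f k x - f l x)" by (intro approx_harmonic_diff fa)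
        show "\<bar>f k x - f l x\<bar> \<le> 2 * e'" if "x \<in> ball z (r - 2 * \<delta>)" for x
          using K[OF kl(1) that] K[OF kl(2) that] by linarith
        show "GDERIV (\<lambda>x. f k x - f l x) x :> F k x - F l x" by (intro GDERIV_diff Fg x2)
      qed (use \<delta> x in auto)
      also have "\<dots> = C * (2 * e') / \<delta>" by (simp add: C_def)
      also have "\<dots> = e / 2" using C \<delta> by (simp add: e'_def)
      finally show ?thesis using \<open>0 < e\<close> by (simp add: dist_norm)
    qed
    then show "\<exists>M. \<forall>x\<in>ball z r'. \<forall>m\<ge>M. \<forall>n\<ge>M. dist (F m x) (F n x) < e" by blast
  qed
  then obtain G where G: "uniform_limit (ball z r') F G sequentially"
    using Cauchy_uniformly_convergent unfolding uniformly_convergent_on_def by blast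
  have sub: "x \<in> ball z (r - 2 * \<delta>)" if "x \<in> ball z r'" for x using that \<delta> by auto
  have "continuous_on (ball z r') (F k)" for k
  proof -
    have "continuous_on (ball z r') (\<lambda>x. g (x + h k *\<^sub>R n))"
      using in2[OF sub, of _ "h k"] h[of k]
      by (intro continuous_on_compose2[OF cg]) (auto intro!: continuous_intros)
    moreover have "continuous_on (ball z r') g" using cg sub b2 by (blast intro: continuous_on_subset)
    ultimately show ?thesis unfolding F_def by (intro continuous_intros)
  qed
  then have "continuous_on (ball z r') G"
    using G by (intro uniform_limit_theorem[of _ F sequentially]) auto
  moreover have "\<exists>k. \<forall>x\<in>ball z r'. (\<lambda>i. f i x) \<longlonglongrightarrow> k x \<and> (k has_derivative (\<lambda>h. h \<bullet> G x)) (at x within ball z r')"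
  proof (rule has_derivative_sequence[of _ _ "\<lambda>k x h. h \<bullet> F k x" _ z "g z \<bullet> n"])
    show "(f k has_derivative (\<lambda>h. h \<bullet> F k x)) (at x within ball z r')" if "x \<in> ball z r'" for k x
      using Fg[OF sub[OF that]] unfolding gderiv_def by (rule has_derivative_at_withinI)
    show "\<forall>\<^sub>F k in sequentially. \<forall>x\<in>ball z r'. \<forall>h. norm (h \<bullet> F k x - h \<bullet> G x) \<le> e * norm h" if "0 < e" for e
      using uniform_limitD[OF G \<open>0 < e\<close>]
    proof eventually_elim
      case (elim k)
      show ?case
      proof (intro ballI allI)
        fix x h :: 'a assume "x \<in> ball z r'"
        then have "norm (F k x - G x) \<le> e" using elim by (fastforce simp: dist_norm)
        then have "norm h * norm (F k x - G x) \<le> norm h * e" by (intro mult_left_mono) auto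
        with Cauchy_Schwarz_ineq2[of h "F k x - G x"]
        show "norm (h \<bullet> F k x - h \<bullet> G x) \<le> e * norm h" by (simp add: inner_simps mult.commute)
      qed
    qed
    show "(\<lambda>k. f k z) \<longlonglongrightarrow> g z \<bullet> n"
      unfolding LIMSEQ_def
    proof (intro allI impI)
      fix e :: real assume "0 < e"
      then have "0 < e / 2" by simp
      from conv[OF this] obtain K where K: "\<forall>k\<ge>K. \<forall>x\<in>ball z (r - 2 * \<delta>). \<bar>f k x - g x \<bullet> n\<bar> \<le> e / 2" by blast
      moreover have "z \<in> ball z (r - 2 * \<delta>)" using sub[of z] r' by auto
      ultimately show "\<exists>K. \<forall>k\<ge>K. dist (f k z) (g z \<bullet> n) < e"
        using \<open>0 < e\<close> by (intro exI[of _ K]) (fastforce simp: dist_real_def)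
    qed
  qed (use r' in auto)
  then obtain k where k: "\<And>x. x \<in> ball z r' \<Longrightarrow> (\<lambda>i. f i x) \<longlonglongrightarrow> k x"
    "\<And>x. x \<in> ball z r' \<Longrightarrow> (k has_derivative (\<lambda>h. h \<bullet> G x)) (at x within ball z r')" by blast
  have kg: "k x = g x \<bullet> n" if "x \<in> ball z r'" for x
  proof (rule LIMSEQ_unique[OF k(1)[OF that]])
    show "(\<lambda>i. f i x) \<longlonglongrightarrow> g x \<bullet> n"
      unfolding LIMSEQ_def
    proof (intro allI impI)
      fix e :: real assume "0 < e"
      then have "0 < e / 2" by simp
      from conv[OF this] obtain K where K: "\<forall>k\<ge>K. \<forall>x\<in>ball z (r - 2 * \<delta>). \<bar>f k x - g x \<bullet> n\<bar> \<le> e / 2" by blast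
      with sub[OF that] show "\<exists>K. \<forall>k\<ge>K. dist (f k x) (g x \<bullet> n) < e"
        using \<open>0 < e\<close> by (intro exI[of _ K]) (fastforce simp: dist_real_def)
    qed
  qed
  have "GDERIV (\<lambda>x. g x \<bullet> n) x :> G x" if x: "x \<in> ball z r'" for x
  proof -
    have "(k has_derivative (\<lambda>h. h \<bullet> G x)) (at x)"
      using k(2)[OF x] at_within_open[OF x open_ball] by simp
    then show ?thesis
      unfolding gderiv_def by (rule has_derivative_transform_within_open[OF _ open_ball x kg])
  qed
  ultimately show "\<exists>G. continuous_on (ball z r') G \<and> (\<forall>x\<in>ball z r'. GDERIV (\<lambda>x. g x \<bullet> n) x :> G x)"
    by blast
qed

text \<open>A uniform limit carries no equation by definition; this recovers it once the Laplacian
  exists and is continuous. If \<open>l\<close> were positive at \<open>x\<close>, then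
  \<open>u\<close> minus a nearby piecewise harmonic function would be strictly subharmonic on a
  small ball while uniformly small, against the maximum principle.\<close>

lemma approx_harmonic_laplacian_eq_0:
  fixes u :: "'a::euclidean_space \<Rightarrow> real"
  assumes u: "approx_harmonic z r u" and g: "\<And>x. x \<in> ball z r \<Longrightarrow> \<exists>g. GDERIV u x :> g"
    and l: "\<And>x. x \<in> ball z r \<Longrightarrow> has_laplacian u (l x) x" and cl: "continuous_on (ball z r) l"
    and x: "x \<in> ball z r"
  shows "l x = 0"
proof -
  have le: "k x \<le> 0"
    if v: "approx_harmonic z r v" and g: "\<And>x. x \<in> ball z r \<Longrightarrow> \<exists>g. GDERIV v x :> g"
      and k: "\<And>x. x \<in> ball z r \<Longrightarrow> has_laplacian v (k x) x" and ck: "continuous_on (ball z r) k" for v k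
  proof (rule ccontr)
    assume "\<not> k x \<le> 0"
    then have kx: "0 < k x" by simp
    \<comment> \<open>The Laplacian of \<open>d\<close> times the squared distance is
      \<open>k x / 2\<close>, the lower bound of \<open>k\<close> on the small ball, so subtracting
      that term keeps the function subharmonic.\<close>
    define d where "d = k x / (4 * DIM('a))"
    have d: "0 < d" "2 * DIM('a) * d = k x / 2" using kx by (auto simp: d_def)
    have "isCont k x" using ck x by (simp add: continuous_on_eq_continuous_at)
    then have "\<forall>\<^sub>F y in at x. k x / 2 < k y"
      using kx by (intro order_tendstoD(1)[of k "k x"]) (auto simp: isCont_def)
    moreover have "\<forall>\<^sub>F y in at x. y \<in> ball z r"
      using x by (intro eventually_at_in_open') auto
    ultimately have "\<forall>\<^sub>F y in at x. k x / 2 < k y \<and> y \<in> ball z r" by (rule eventually_conj)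
    then obtain s where s: "0 < s" "\<And>y. y \<noteq> x \<Longrightarrow> dist y x < s \<Longrightarrow> k x / 2 < k y \<and> y \<in> ball z r"
      unfolding eventually_at by auto
    have near: "k x / 2 < k y" "y \<in> ball z r" if "y \<in> cball x (s / 2)" for y
      using s(2)[of y] that kx x s(1) by (cases "y = x"; auto simp: dist_commute)+
    \<comment> \<open>The maximum principle gives \<open>- e \<le> w x \<le> e - 4 * e\<close>, a
      contradiction.\<close>
    define e where "e = d * (s / 2)\<^sup>2 / 4"
    have e: "0 < e" using d s(1) by (simp add: e_def)
    obtain f where f: "piecewise_harmonic (ball z r) f" "\<forall>x\<in>ball z r. \<bar>v x - f x\<bar> \<le> e"
      using v e unfolding approx_harmonic_def by blast
    obtain N where N: "finite N" "\<And>a c. (a, c) \<in> N \<Longrightarrow> a \<noteq> 0"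
      "\<And>x. x \<in> ball z r \<Longrightarrow> (\<And>a c. (a, c) \<in> N \<Longrightarrow> a \<bullet> x \<noteq> c) \<Longrightarrow> has_laplacian f 0 x"
      "\<And>x. x \<in> ball z r \<Longrightarrow> \<exists>g. GDERIV f x :> g"
      using f(1) by (rule piecewise_harmonicE) (rule that; blast)
    define w where "w y = (v y - f y) - d * (norm (y - x))\<^sup>2" for y
    have wg: "\<exists>g. GDERIV w y :> g" if y: "y \<in> ball z r" for y
    proof -
      obtain g1 g2 where "GDERIV v y :> g1" "GDERIV f y :> g2" using g[OF y] N(4)[OF y] by blast
      from GDERIV_diff[OF GDERIV_diff[OF this] GDERIV_cmult[OF GDERIV_norm_power2]] show ?thesis
        unfolding w_def by (rule exI)
    qed
    have "w x \<le> e - d * (s / 2)\<^sup>2"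
    proof (rule maximum_principle[of "cball x (s / 2)" w N])
      show "continuous_on (cball x (s / 2)) w"
        using wg near(2) GDERIV_isCont by (intro continuous_at_imp_continuous_on) blast
      show "y \<in> interior (cball x (s / 2))" if y: "y \<in> cball x (s / 2)" "e - d * (s / 2)\<^sup>2 < w y" for y
      proof -
        have "w y \<le> e - d * (norm (y - x))\<^sup>2"
          using f(2) near(2)[OF y(1)] by (fastforce simp: w_def)
        with y have "norm (y - x) \<noteq> s / 2" by auto
        with y(1) show ?thesis by (simp add: dist_norm norm_minus_commute)
      qed
      show "(\<exists>(a, c)\<in>N. a \<bullet> y = c) \<and> (\<exists>g. GDERIV w y :> g) \<or> (\<exists>l\<ge>0. has_laplacian w l y)"
        if y: "y \<in> cball x (s / 2)" "e - d * (s / 2)\<^sup>2 < w y" for y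
      proof (cases "\<exists>(a, c)\<in>N. a \<bullet> y = c")
        case False
        then have "has_laplacian f 0 y" using near(2)[OF y(1)] by (intro N(3)) auto
        then have "has_laplacian w ((k y - 0) - d * (2 * DIM('a))) y"
          unfolding w_def
          by (intro has_laplacian_diff has_laplacian_cmult has_laplacian_norm_power2 k near(2)[OF y(1)])
        then show ?thesis using near(1)[OF y(1)] d(2) by (intro disjI2 exI conjI) (auto simp: algebra_simps)
      qed (use wg near(2)[OF y(1)] in auto)
    qed (use N s(1) in auto)
    moreover have "- e \<le> w x" using f(2) x by (fastforce simp: w_def)
    ultimately show False using e by (simp add: e_def)
  qed
  have "approx_harmonic z r (\<lambda>x. - u x)" using approx_harmonic_cmult[OF u, of "-1"] by simp
  then have "- l x \<le> 0"
  proof (rule le)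
    show "\<exists>g. GDERIV (\<lambda>x. - u x) x :> g" if "x \<in> ball z r" for x
      using g[OF that] GDERIV_minus by blast
    show "has_laplacian (\<lambda>x. - u x) (- l x) x" if "x \<in> ball z r" for x
      using l[OF that] by (rule has_laplacian_minus)
  qed (auto intro: continuous_intros cl)
  moreover have "l x \<le> 0" using le[OF u g l cl] .
  ultimately show ?thesis by simp
qed

text \<open>The derivative-gaining step is applied three times, on balls shrinking by a third of
  \<open>r - r'\<close> each time.\<close>

lemma piecewise_harmonic_third_derivatives:
  fixes u :: "'a::euclidean_space \<Rightarrow> real"
  assumes u: "piecewise_harmonic (ball z r) u" and g: "\<And>x. x \<in> ball z r \<Longrightarrow> GDERIV u x :> g x"
    and cg: "continuous_on (ball z r) g" and r': "0 < r'" "r' < r"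
  shows "\<exists>G T. \<forall>x\<in>ball z r'. \<forall>b\<in>Basis. GDERIV (\<lambda>x. g x \<bullet> b) x :> G b x \<and>
    (\<forall>c\<in>Basis. GDERIV (\<lambda>x. G b x \<bullet> c) x :> T b c x \<and> has_laplacian (\<lambda>x. G b x \<bullet> c) 0 x)"
proof -
  define d where "d = (r - r') / 3"
  define r1 r2 where "r1 = r - d" and "r2 = r - 2 * d"
  have r: "0 < r1" "r1 < r" "0 < r2" "r2 < r1" "r' < r2" using r' by (auto simp: d_def r1_def r2_def field_simps)
  have sub: "x \<in> ball z r1" "x \<in> ball z r2" if "x \<in> ball z r'" for x using that r by auto
  have "\<forall>b\<in>Basis. \<exists>G. continuous_on (ball z r1) G \<and> (\<forall>x\<in>ball z r1. GDERIV (\<lambda>x. g x \<bullet> b) x :> G x)"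
    using approx_harmonic_gradient_C1(2)[OF piecewise_imp_approx_harmonic[OF u] g cg r(1,2)] by blast
  then have "\<exists>G. \<forall>b\<in>Basis. continuous_on (ball z r1) (G b) \<and> (\<forall>x\<in>ball z r1. GDERIV (\<lambda>x. g x \<bullet> b) x :> G b x)"
    by (simp only: bchoice_iff)
  then obtain G where G: "\<And>b. b \<in> Basis \<Longrightarrow> continuous_on (ball z r1) (G b)"
    "\<And>b x. b \<in> Basis \<Longrightarrow> x \<in> ball z r1 \<Longrightarrow> GDERIV (\<lambda>x. g x \<bullet> b) x :> G b x"
    by blast
  have ga: "approx_harmonic z r1 (\<lambda>x. g x \<bullet> b)" if "b \<in> Basis" for b
    using approx_harmonic_gradient_C1(1)[OF piecewise_imp_approx_harmonic[OF u] g cg r(1,2) that] .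
  have Ga: "approx_harmonic z r2 (\<lambda>x. G b x \<bullet> c)" if "b \<in> Basis" "c \<in> Basis" for b c
    using approx_harmonic_gradient_C1(1)[OF ga[OF that(1)] G(2)[OF that(1)] G(1)[OF that(1)] r(3,4) that(2)] .
  have "\<forall>b\<in>Basis. \<forall>c\<in>Basis. \<exists>T. continuous_on (ball z r2) T \<and> (\<forall>x\<in>ball z r2. GDERIV (\<lambda>x. G b x \<bullet> c) x :> T x)"
    using approx_harmonic_gradient_C1(2)[OF ga G(2) G(1) r(3,4)] by blast
  then have "\<exists>T. \<forall>b\<in>Basis. \<forall>c\<in>Basis. continuous_on (ball z r2) (T b c) \<and>
      (\<forall>x\<in>ball z r2. GDERIV (\<lambda>x. G b x \<bullet> c) x :> T b c x)"
    by (simp only: bchoice_iff)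
  then obtain T where T: "\<And>b c. b \<in> Basis \<Longrightarrow> c \<in> Basis \<Longrightarrow> continuous_on (ball z r2) (T b c)"
    "\<And>b c x. b \<in> Basis \<Longrightarrow> c \<in> Basis \<Longrightarrow> x \<in> ball z r2 \<Longrightarrow> GDERIV (\<lambda>x. G b x \<bullet> c) x :> T b c x"
    by blast
  have lap: "has_laplacian (\<lambda>x. G b x \<bullet> c) 0 x" if bc: "b \<in> Basis" "c \<in> Basis" and x: "x \<in> ball z r'" for b c x
  proof -
    \<comment> \<open>Fourth derivatives enter only to make the Laplacian of a Hessian entry exist
      and be continuous, so that it can be shown to vanish.\<close>
    have "\<forall>e\<in>Basis. \<exists>Q. continuous_on (ball z r') Q \<and> (\<forall>x\<in>ball z r'. GDERIV (\<lambda>x. T b c x \<bullet> e) x :> Q x)"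
      using approx_harmonic_gradient_C1(2)[OF Ga[OF bc] T(2)[OF bc] T(1)[OF bc] r'(1) r(5)] by blast
    then have "\<exists>Q. \<forall>e\<in>Basis. continuous_on (ball z r') (Q e) \<and> (\<forall>x\<in>ball z r'. GDERIV (\<lambda>x. T b c x \<bullet> e) x :> Q e x)"
      by (simp only: bchoice_iff)
    then obtain Q where Q: "\<And>e. e \<in> Basis \<Longrightarrow> continuous_on (ball z r') (Q e)"
      "\<And>e x. e \<in> Basis \<Longrightarrow> x \<in> ball z r' \<Longrightarrow> GDERIV (\<lambda>x. T b c x \<bullet> e) x :> Q e x"
      by blast
    have l: "has_laplacian (\<lambda>x. G b x \<bullet> c) (\<Sum>e\<in>Basis. Q e x \<bullet> e) x" if "x \<in> ball z r'" for x
      using T(2)[OF bc] sub Q(2) that by (intro has_laplacian_trace[of "ball z r'" _ _ "T b c"]) auto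
    have "(\<Sum>e\<in>Basis. Q e x \<bullet> e) = 0"
    proof (rule approx_harmonic_laplacian_eq_0[OF approx_harmonic_mono[OF Ga[OF bc]] _ l _ x])
      show "\<exists>g. GDERIV (\<lambda>x. G b x \<bullet> c) x :> g" if "x \<in> ball z r'" for x
        using T(2)[OF bc sub(2)[OF that]] by (rule exI)
    qed (use r in \<open>auto intro!: continuous_intros Q(1)\<close>)
    with l[OF x] show ?thesis by simp
  qed
  show ?thesis
    using G(2) T(2) lap sub by (intro exI[of _ G] exI[of _ T]) blast
qed

section \<open>Subharmonic functions on a cone with the Neumann condition\<close>

text \<open>A substitute for an attained maximum: \<open>f\<close> need not be continuous and
  \<open>A\<close> need not be closed, so the limit point \<open>y\<close> may lie outside
  \<open>A\<close>.\<close>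

lemma maximizing_sequence:
  fixes f :: "'a::heine_borel \<Rightarrow> real"
  assumes "bounded A" "A \<noteq> {}" and le: "\<forall>x\<in>A. f x \<le> c"
  shows "\<exists>s y z. (\<forall>x\<in>A. f x \<le> s) \<and> (\<forall>k::nat. z k \<in> A) \<and> z \<longlonglongrightarrow> y \<and> (\<lambda>k. f (z k)) \<longlonglongrightarrow> s"
proof -
  define s where "s = Sup (f ` A)"
  have bd: "bdd_above (f ` A)" using le by (auto intro: bdd_aboveI2)
  have s: "f x \<le> s" if "x \<in> A" for x unfolding s_def using bd that by (rule cSUP_upper2) simp
  have "\<exists>x\<in>A. s - 1 / real (Suc k) < f x" for k
    using less_cSUP_iff[OF assms(2) bd, of "s - 1 / real (Suc k)"] by (simp add: s_def)
  then obtain x where x: "\<And>k. x k \<in> A" "\<And>k. s - 1 / real (Suc k) < f (x k)" by metis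
  have "(\<lambda>k. s - 1 / real (Suc k)) \<longlonglongrightarrow> s - 0"
    by (intro tendsto_intros LIMSEQ_Suc lim_1_over_n)
  then have lim0: "(\<lambda>k. s - 1 / real (Suc k)) \<longlonglongrightarrow> s" by simp
  have lim: "(\<lambda>k. f (x k)) \<longlonglongrightarrow> s"
    by (rule tendsto_sandwich[OF _ _ lim0 tendsto_const]) (use x s in \<open>auto intro!: always_eventually less_imp_le\<close>)
  have "bounded (range x)" using assms(1) x(1) by (auto intro: bounded_subset)
  then obtain y r where "strict_mono (r :: nat \<Rightarrow> nat)" "(x \<circ> r) \<longlonglongrightarrow> y"
    using bounded_imp_convergent_subsequence by blast
  then show ?thesis
    using x(1) s LIMSEQ_subseq_LIMSEQ[OF lim]
    by (intro exI[of _ s] exI[of _ y] exI[of _ "x \<circ> r"]) (auto simp: o_def)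
qed

lemma has_laplacian_local_maximum:
  assumes "has_laplacian u l x" "open U" "x \<in> U" "\<And>y. y \<in> U \<Longrightarrow> u y \<le> u x"
  shows "l \<le> 0"
proof -
  have "\<forall>\<^sub>F t in at 0. \<forall>b\<in>Basis. x + t *\<^sub>R b \<in> U \<and> x - t *\<^sub>R b \<in> U"
    using assms(2,3) by (rule eventually_coordinate_neighbours)
  then have "\<forall>\<^sub>F t in at 0. (\<Sum>b\<in>Basis. u (x + t *\<^sub>R b) + u (x - t *\<^sub>R b) - 2 * u x) / t\<^sup>2 \<le> 0"
  proof eventually_elim
    case (elim t)
    have "u (x + t *\<^sub>R b) + u (x - t *\<^sub>R b) - 2 * u x \<le> 0" if "b \<in> Basis" for b
      using assms(4)[of "x + t *\<^sub>R b"] assms(4)[of "x - t *\<^sub>R b"] elim that by auto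
    then show ?case by (intro divide_nonpos_nonneg sum_nonpos) auto
  qed
  then show ?thesis using assms(1) unfolding has_laplacian_def by (intro tendsto_upperbound) auto
qed

lemma open_polyhedral_cone:
  fixes \<nu> :: "'i \<Rightarrow> 'a::euclidean_space"
  assumes "finite J"
  shows "open {x. \<forall>i\<in>J. x \<bullet> \<nu> i < 0}"
proof -
  have "{x. \<forall>i\<in>J. x \<bullet> \<nu> i < 0} = (\<Inter>i\<in>J. {x. \<nu> i \<bullet> x < 0})" by (auto simp: inner_commute)
  then show ?thesis using assms by (auto intro: open_halfspace_lt)
qed

text \<open>In \<open>neumann\<close> the point lies in the relative interior of one face; normals
  may be listed repeatedly, so equality of normals is compared, not of indices. Where distinct faces
  meet only the upper bound for \<open>w\<close> is available.\<close>

locale subharmonic_on_cone =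
  fixes J :: "'i set" and \<nu> :: "'i \<Rightarrow> 'a::euclidean_space" and \<Gamma> :: "'a set" and w :: "'a \<Rightarrow> real" and C :: real
  assumes finite_J: "finite J"
    and cone: "\<Gamma> = {x. \<forall>i\<in>J. x \<bullet> \<nu> i < 0}" "\<Gamma> \<noteq> {}"
    and norm_\<nu>: "\<And>i. i \<in> J \<Longrightarrow> norm (\<nu> i) = 1"
    and bounded_above: "\<And>x. x \<in> \<Gamma> \<Longrightarrow> w x \<le> C"
    and cont: "\<And>x. x \<in> \<Gamma> \<Longrightarrow> isCont w x"
    and subharmonic: "\<And>x. x \<in> \<Gamma> \<Longrightarrow> \<exists>l\<ge>0. has_laplacian w l x"
    and neumann: "\<And>x i. i \<in> J \<Longrightarrow> x \<bullet> \<nu> i = 0 \<Longrightarrow> (\<And>j. j \<in> J \<Longrightarrow> x \<bullet> \<nu> j < 0 \<or> x \<bullet> \<nu> j = 0 \<and> \<nu> j = \<nu> i) \<Longrightarrow>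
      \<exists>W U g. open U \<and> x \<in> U \<and> (\<forall>y\<in>U \<inter> \<Gamma>. W y = w y) \<and> GDERIV W x :> g \<and> g \<bullet> \<nu> i = 0"
begin

lemma open_cone: "open \<Gamma>"
  unfolding cone(1) using finite_J by (rule open_polyhedral_cone)

abbreviation active :: "'a \<Rightarrow> 'i set" where "active x \<equiv> {i \<in> J. x \<bullet> \<nu> i = 0}"

text \<open>In the sense of viscosity, \<open>w\<close> is a subsolution of the Neumann problem up to the boundary of the
  cone: a strict supersolution \<open>\<phi>\<close> cannot touch it from above, even at points where faces meet. There
  the gap between \<open>w\<close> and \<open>\<phi>\<close> is penalised by the logarithm of the distance to the stratum, which is
  superharmonic because strata have codimension at least two and which satisfies the Neumann
  condition on the faces through the stratum; this moves the touching point to a larger stratum.\<close>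

lemma no_touching:
  assumes x0: "\<And>i. i \<in> J \<Longrightarrow> x0 \<bullet> \<nu> i \<le> 0" and r: "0 < r" and c: "0 < c"
    and lap: "\<And>x. x \<in> ball x0 r \<Longrightarrow> \<exists>l\<le>- c. has_laplacian \<phi> l x"
    and grad: "\<And>x. x \<in> ball x0 r \<Longrightarrow> GDERIV \<phi> x :> \<gamma> x"
    and normal: "\<And>x i. x \<in> ball x0 r \<Longrightarrow> i \<in> J \<Longrightarrow> x \<bullet> \<nu> i = 0 \<Longrightarrow> 0 < \<gamma> x \<bullet> \<nu> i"
    and le: "\<And>x. x \<in> ball x0 r \<Longrightarrow> x \<in> \<Gamma> \<Longrightarrow> w x - \<phi> x \<le> s"
    and z: "\<And>k. z k \<in> \<Gamma>" "z \<longlonglongrightarrow> x0" "(\<lambda>k::nat. w (z k) - \<phi> (z k)) \<longlonglongrightarrow> s"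
  shows False
  using assms
\<comment> \<open>The new touching point \<open>y\<close> found below satisfies
  \<open>q y \<noteq> 0\<close>, so some constraint active at \<open>x0\<close> is inactive at
  \<open>y\<close>, and no new one has become active.\<close>
proof (induction "card (active x0)" arbitrary: x0 r c \<phi> \<gamma> s z rule: less_induct)
  case less
  note x0 = less.prems(1) and r = less.prems(2) and c = less.prems(3) and lap = less.prems(4)
    and grad = less.prems(5) and normal = less.prems(6) and le = less.prems(7) and z = less.prems(8-10)
  have x0r: "x0 \<in> ball x0 r" using r by simp
  have cont\<phi>: "isCont \<phi> x0" using GDERIV_isCont[OF grad[OF x0r]] .
  have zr: "\<forall>\<^sub>F k in sequentially. z k \<in> ball x0 r"
    using z(2) r by (intro topological_tendstoD) auto
  consider "active x0 = {}"
    | i where "i \<in> active x0" "\<And>j. j \<in> active x0 \<Longrightarrow> \<nu> j = \<nu> i"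
    | i j where "i \<in> active x0" "j \<in> active x0" "\<nu> i \<noteq> \<nu> j"
    by blast
  then show False
  proof cases
    case 1
    then have x0\<Gamma>: "x0 \<in> \<Gamma>" unfolding cone(1) using x0 by (force simp: order_less_le)
    have "(\<lambda>k. w (z k) - \<phi> (z k)) \<longlonglongrightarrow> w x0 - \<phi> x0"
      using isCont_tendsto_compose[OF cont[OF x0\<Gamma>] z(2)] isCont_tendsto_compose[OF cont\<phi> z(2)]
      by (rule tendsto_diff)
    then have s: "s = w x0 - \<phi> x0" using z(3) LIMSEQ_unique by blast
    obtain l where l: "0 \<le> l" "has_laplacian w l x0" using subharmonic[OF x0\<Gamma>] by blast
    obtain k where k: "k \<le> - c" "has_laplacian \<phi> k x0" using lap[OF x0r] by blast
    have "l - k \<le> 0"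
      by (rule has_laplacian_local_maximum[OF has_laplacian_diff[OF l(2) k(2)], of "ball x0 r \<inter> \<Gamma>"])
        (use le x0\<Gamma> r open_cone in \<open>auto simp: s[symmetric]\<close>)
    then show False using l k c by simp
  next
    case (2 i)
    have i: "i \<in> J" "x0 \<bullet> \<nu> i = 0" using 2(1) by auto
    have act: "x0 \<bullet> \<nu> j < 0 \<or> x0 \<bullet> \<nu> j = 0 \<and> \<nu> j = \<nu> i" if "j \<in> J" for j
    proof (cases "x0 \<bullet> \<nu> j = 0")
      case True
      with that have "\<nu> j = \<nu> i" by (intro 2(2)) simp
      with True show ?thesis by blast
    next
      case False
      with x0[OF that] show ?thesis by simp
    qed
    from neumann[OF i this] obtain W U g
      where W: "open U" "x0 \<in> U" "\<forall>y\<in>U \<inter> \<Gamma>. W y = w y" "GDERIV W x0 :> g" "g \<bullet> \<nu> i = 0"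
      by blast
    have d: "GDERIV (\<lambda>x. W x - \<phi> x) x0 :> g - \<gamma> x0"
      using W(4) grad[OF x0r] by (rule GDERIV_diff)
    have "(\<lambda>k. W (z k) - \<phi> (z k)) \<longlonglongrightarrow> W x0 - \<phi> x0"
      using isCont_tendsto_compose[OF GDERIV_isCont[OF d] z(2)] .
    moreover have "\<forall>\<^sub>F k in sequentially. w (z k) - \<phi> (z k) = W (z k) - \<phi> (z k)"
      using topological_tendstoD[OF z(2) W(1,2)] by eventually_elim (use z(1) W(3) in auto)
    then have "(\<lambda>k. W (z k) - \<phi> (z k)) \<longlonglongrightarrow> s" using z(3) by (rule Lim_transform_eventually[rotated])
    ultimately have s: "s = W x0 - \<phi> x0" using LIMSEQ_unique by blast
    \<comment> \<open>The ray along the inner normal enters the cone, and on it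
      \<open>W - \<phi>\<close> stays below its value \<open>s\<close> at \<open>x0\<close>; but its
      one-sided derivative there is \<open>\<gamma> x0 \<bullet> \<nu> i\<close>, which is
      positive.\<close>
    have path: "((\<lambda>t. x0 + t *\<^sub>R (- \<nu> i)) \<longlongrightarrow> x0 + 0 *\<^sub>R (- \<nu> i)) (at_right 0)"
      by (intro tendsto_intros)
    have "\<forall>\<^sub>F t in at_right 0. x0 + t *\<^sub>R (- \<nu> i) \<in> U \<inter> ball x0 r"
      using path W(1,2) r by (intro topological_tendstoD) auto
    moreover have "\<forall>\<^sub>F t in at_right 0. \<forall>j\<in>J. (x0 + t *\<^sub>R (- \<nu> i)) \<bullet> \<nu> j < 0"
    proof (rule eventually_ball_finite[OF finite_J], rule ballI)
      fix j assume j: "j \<in> J"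
      show "\<forall>\<^sub>F t in at_right 0. (x0 + t *\<^sub>R (- \<nu> i)) \<bullet> \<nu> j < 0"
      proof (cases "x0 \<bullet> \<nu> j = 0")
        case True
        then have "\<nu> j = \<nu> i" using act[OF j] by auto
        then have "\<nu> i \<bullet> \<nu> j = 1" using norm_\<nu>[OF j] by (simp add: norm_eq_1)
        with True show ?thesis by (simp add: inner_simps eventually_at_right_less)
      next
        case False
        then have "x0 \<bullet> \<nu> j < 0" using act[OF j] by auto
        moreover have "((\<lambda>t. (x0 + t *\<^sub>R (- \<nu> i)) \<bullet> \<nu> j) \<longlongrightarrow> (x0 + 0 *\<^sub>R (- \<nu> i)) \<bullet> \<nu> j) (at_right 0)"
          by (intro tendsto_intros)
        ultimately show ?thesis by (intro order_tendstoD(2)) auto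
      qed
    qed
    ultimately have "\<forall>\<^sub>F t in at_right 0. (W (x0 + t *\<^sub>R (- \<nu> i)) - \<phi> (x0 + t *\<^sub>R (- \<nu> i)) - (W x0 - \<phi> x0)) / t \<le> 0"
      using eventually_at_right_less[of 0]
    proof eventually_elim
      case (elim t)
      then have "x0 + t *\<^sub>R (- \<nu> i) \<in> \<Gamma>" unfolding cone(1) by blast
      with le[of "x0 + t *\<^sub>R (- \<nu> i)"] W(3) elim
      have "W (x0 + t *\<^sub>R (- \<nu> i)) - \<phi> (x0 + t *\<^sub>R (- \<nu> i)) \<le> s" by auto
      with elim show ?case by (intro divide_nonpos_pos) (auto simp: s)
    qed
    moreover have "((\<lambda>t. (W (x0 + t *\<^sub>R (- \<nu> i)) - \<phi> (x0 + t *\<^sub>R (- \<nu> i)) - (W x0 - \<phi> x0)) / t)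
        \<longlongrightarrow> (- \<nu> i) \<bullet> (g - \<gamma> x0)) (at_right 0)"
      using directional_difference_quotient_limit[OF d, of "- \<nu> i"]
      by (rule tendsto_within_subset) auto
    ultimately have "(- \<nu> i) \<bullet> (g - \<gamma> x0) \<le> 0" by (intro tendsto_upperbound) auto
    then show False using normal[OF x0r i] W(5) by (simp add: inner_simps inner_commute)
  next
    case (3 i j)
    obtain B where B: "pairwise orthogonal B" "\<And>b. b \<in> B \<Longrightarrow> norm b = 1"
      "independent B" "span B = span (\<nu> ` active x0)" "B \<subseteq> span (\<nu> ` active x0)"
      by (rule orthonormal_basis_subspace[OF subspace_span[of "\<nu> ` active x0"]]) (rule that; blast)
    have finB: "finite B" using B(3) by (rule independent_imp_finite)
    have \<nu>B: "\<nu> k \<in> span B" if "k \<in> active x0" for k unfolding B(4) using that by (intro span_base) auto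
    \<comment> \<open>If two distinct unit normals span only a line they are opposite, and then the
      cone would be empty.\<close>
    have card: "2 \<le> card B"
    proof (rule ccontr)
      assume "\<not> 2 \<le> card B"
      then consider "card B = 0" | "card B = 1" by linarith
      then obtain b where b: "B \<subseteq> {b}" "norm b \<le> 1"
      proof cases
        case 1
        then show ?thesis using finB that[of 0] by auto
      next
        case 2
        then obtain b where "B = {b}" by (rule card_1_singletonE)
        then show ?thesis using that[of b] B(2) by auto
      qed
      have "\<exists>a. \<nu> k = a *\<^sub>R b" if "k \<in> active x0" for k
        using \<nu>B[OF that] span_mono[OF b(1)] unfolding span_singleton by blast
      then obtain a a' where a: "\<nu> i = a *\<^sub>R b" "\<nu> j = a' *\<^sub>R b" using 3 by meson
      have "\<bar>a\<bar> * norm b = 1" "\<bar>a'\<bar> * norm b = 1" using norm_\<nu>[of i] norm_\<nu>[of j] 3 a by auto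
      then have "\<bar>a\<bar> = \<bar>a'\<bar>" by (metis mult_cancel_right mult_zero_right zero_neq_one)
      then have "\<nu> i = - \<nu> j" using a 3(3) by (auto simp: abs_if split: if_splits)
      moreover obtain p where "p \<in> \<Gamma>" using cone(2) by blast
      then have "p \<bullet> \<nu> i < 0" "p \<bullet> \<nu> j < 0" using 3 unfolding cone(1) by auto
      ultimately show False by simp
    qed
    define q where "q x = (\<Sum>b\<in>B. ((x - x0) \<bullet> b)\<^sup>2)" for x
    \<comment> \<open>\<open>q\<close> is the squared distance to the stratum through
      \<open>x0\<close>, so \<open>F (q x)\<close> is minus twice the logarithm of that distance, up
      to a constant. The constant makes it nonnegative on the unit ball, where each of the
      \<open>card B\<close> squares in \<open>q\<close> is at most 1.\<close>
    define F :: "real \<Rightarrow> real" where "F t = ln (card B) - ln t" for t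
    have qcont: "continuous_on UNIV q" unfolding q_def by (intro continuous_intros)
    have q0: "0 \<le> q x" for x unfolding q_def by (intro sum_nonneg) auto
    \<comment> \<open>The gradient of \<open>q\<close> is twice this projection, and the projection
      does not change products with active normals; so it is tangential on each face through the
      stratum.\<close>
    have proj: "(\<Sum>b\<in>B. ((x - x0) \<bullet> b) *\<^sub>R b) \<bullet> \<nu> k = x \<bullet> \<nu> k" if k: "k \<in> active x0" for x k
    proof -
      have "(\<Sum>b\<in>B. ((x - x0) \<bullet> b) *\<^sub>R b) \<bullet> y = (x - x0) \<bullet> y" if "y \<in> span B" for y
        using that
      proof (induction rule: span_induct_alt)
        case (step c b y)
        have "(\<Sum>d\<in>B. ((x - x0) \<bullet> d) * (d \<bullet> b)) = (\<Sum>d\<in>B. if d = b then (x - x0) \<bullet> b else 0)"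
          using B(1) B(2)[OF step(1)] step(1)
          by (intro sum.cong) (auto simp: pairwise_def orthogonal_def norm_eq_1)
        then have "(\<Sum>b\<in>B. ((x - x0) \<bullet> b) *\<^sub>R b) \<bullet> b = (x - x0) \<bullet> b"
          using finB step(1) by (simp add: inner_sum_left)
        with step show ?case by (simp add: inner_add_right)
      qed simp
      from this[OF \<nu>B[OF k]] show ?thesis using k by (simp add: inner_diff_left)
    qed
    have q_pos: "q x \<noteq> 0" if "k \<in> active x0" "x \<bullet> \<nu> k \<noteq> 0" for x k
    proof
      assume "q x = 0"
      then have "\<forall>b\<in>B. (x - x0) \<bullet> b = 0"
        using finB by (simp add: q_def sum_nonneg_eq_0_iff)
      then show False using proj[OF that(1), of x] that(2) by simp
    qed
    have q_pos\<Gamma>: "0 < q x" if "x \<in> \<Gamma>" for x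
    proof -
      have "x \<bullet> \<nu> i < 0" using that 3(1) unfolding cone(1) by auto
      then have "q x \<noteq> 0" using q_pos[OF 3(1)] by simp
      with q0[of x] show ?thesis by simp
    qed
    have q_zero: "q x = 0" if "\<And>k. k \<in> active x0 \<Longrightarrow> x \<bullet> \<nu> k = 0" for x
    proof -
      have "(x - x0) \<bullet> y = 0" if "y \<in> span (\<nu> ` active x0)" for y
        using that
        by (induction rule: span_induct_alt)
          (auto simp: inner_add_right inner_diff_left \<open>\<And>k. k \<in> active x0 \<Longrightarrow> x \<bullet> \<nu> k = 0\<close>)
      then show ?thesis using B(5) by (auto simp: q_def intro!: sum.neutral)
    qed
    \<comment> \<open>Besides the given ball: the unit ball for the sign of \<open>F\<close>, and a
      neighbourhood in which inactive constraints remain strict, so that no further face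
      appears.\<close>
    define U where "U = ball x0 r \<inter> ball x0 1 \<inter> (\<Inter>k\<in>J - active x0. {x. \<nu> k \<bullet> x < 0})"
    have "open U" unfolding U_def using finite_J by (intro open_Int open_ball open_INT ballI open_halfspace_lt) auto
    moreover have "x0 \<in> U" using x0 r by (force simp: U_def inner_commute order_less_le)
    ultimately obtain \<rho> where \<rho>: "0 < \<rho>" "cball x0 \<rho> \<subseteq> U" using open_contains_cball by blast
    have \<rho>r: "x \<in> ball x0 r" "dist x0 x < 1" if "x \<in> cball x0 \<rho>" for x
      using \<rho>(2) that unfolding U_def by (auto dest!: subsetD)
    have inactive: "k \<in> active x0" if "x \<in> cball x0 \<rho>" "k \<in> J" "x \<bullet> \<nu> k = 0" for x k
    proof (rule ccontr)
      assume "k \<notin> active x0"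
      then have "\<nu> k \<bullet> x < 0"
        using subsetD[OF \<rho>(2) that(1)] that(2) unfolding U_def by blast
      with that(3) show False by (simp add: inner_commute)
    qed
    have h0: "0 \<le> F (q x)" if "x \<in> cball x0 \<rho>" "0 < q x" for x
    proof -
      have "q x \<le> (\<Sum>b\<in>B. 1)"
        unfolding q_def
      proof (rule sum_mono)
        fix b assume "b \<in> B"
        then have "\<bar>(x - x0) \<bullet> b\<bar> \<le> norm (x - x0)" using Cauchy_Schwarz_ineq2[of "x - x0" b] B(2) by simp
        also have "\<dots> \<le> 1" using \<rho>r(2)[OF that(1)] by (simp add: dist_norm norm_minus_commute)
        finally show "((x - x0) \<bullet> b)\<^sup>2 \<le> 1" by (simp add: abs_square_le_1)
      qed
      then have "ln (q x) \<le> ln (card B)" using that(2) by (intro ln_mono) auto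
      then show ?thesis by (simp add: F_def)
    qed
    \<comment> \<open>The quadratic penalty keeps the new touching point near \<open>x0\<close>; its
      Laplacian \<open>c / 2\<close> uses up half of the strictness \<open>c\<close>.\<close>
    define \<delta> where "\<delta> = c / (4 * DIM('a))"
    have \<delta>: "0 < \<delta>" "2 * DIM('a) * \<delta> = c / 2" using c by (auto simp: \<delta>_def)
    \<comment> \<open>At \<open>z N\<close> the gap to \<open>s\<close>, the logarithmic penalty and
      the quadratic penalty lose at most \<open>\<eta>\<close> each, whereas the quadratic penalty
      on the sphere of radius \<open>\<rho>\<close> costs \<open>4 * \<eta>\<close>. So the maximum
      is not approached on that sphere.\<close>
    define \<eta> where "\<eta> = \<delta> * \<rho>\<^sup>2 / 4"
    have \<eta>: "0 < \<eta>" using \<delta> \<rho> by (simp add: \<eta>_def)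
    have "\<forall>\<^sub>F k in sequentially. z k \<in> ball x0 (\<rho> / 2)"
      using z(2) \<rho>(1) by (intro topological_tendstoD) auto
    moreover have "\<forall>\<^sub>F k in sequentially. s - \<eta> < w (z k) - \<phi> (z k)"
      using z(3) \<eta> by (intro order_tendstoD(1)) auto
    ultimately have "\<forall>\<^sub>F k in sequentially. z k \<in> ball x0 (\<rho> / 2) \<and> s - \<eta> < w (z k) - \<phi> (z k)"
      by (rule eventually_conj)
    then obtain N where N: "z N \<in> ball x0 (\<rho> / 2)" "s - \<eta> < w (z N) - \<phi> (z N)"
      unfolding eventually_sequentially by blast
    \<comment> \<open>Chosen after the point \<open>z N\<close>, where the logarithm is finite; the
      added 1 keeps the denominator positive.\<close>
    define \<epsilon> where "\<epsilon> = \<eta> / (F (q (z N)) + 1)"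
    have hN: "0 \<le> F (q (z N))" using N \<rho>(1) by (intro h0 q_pos\<Gamma> z(1)) auto
    have \<epsilon>: "0 < \<epsilon>" "\<epsilon> * F (q (z N)) \<le> \<eta>"
      using \<eta> hN by (auto simp: \<epsilon>_def divide_simps)
    define \<psi> where "\<psi> x = \<phi> x + \<epsilon> * F (q x) + \<delta> * (norm (x - x0))\<^sup>2" for x
    define A where "A = \<Gamma> \<inter> cball x0 \<rho>"
    have AN: "z N \<in> A" using N \<rho>(1) z(1) by (auto simp: A_def)
    have \<psi>le: "w x - \<psi> x \<le> s - \<epsilon> * F (q x) - \<delta> * (norm (x - x0))\<^sup>2" if "x \<in> A" for x
      using le[of x] \<rho>r(1)[of x] that by (auto simp: \<psi>_def A_def)
    have \<psi>le': "w x - \<psi> x \<le> s - \<delta> * (norm (x - x0))\<^sup>2" if "x \<in> A" for x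
    proof -
      have "0 \<le> \<epsilon> * F (q x)" using h0[of x] q_pos\<Gamma>[of x] \<epsilon>(1) that by (auto simp: A_def)
      with \<psi>le[OF that] show ?thesis by linarith
    qed
    have A: "bounded A" "A \<noteq> {}" using AN by (auto simp: A_def)
    have A_le: "w x - \<psi> x \<le> s" if "x \<in> A" for x
    proof -
      have "0 \<le> \<delta> * (norm (x - x0))\<^sup>2" using \<delta> by simp
      with \<psi>le'[OF that] show ?thesis by linarith
    qed
    obtain s' y z' where s': "\<And>x. x \<in> A \<Longrightarrow> w x - \<psi> x \<le> s'"
      and z': "\<And>k. z' k \<in> A" "z' \<longlonglongrightarrow> y" "(\<lambda>k. w (z' k) - \<psi> (z' k)) \<longlonglongrightarrow> s'"
      using maximizing_sequence[OF A, of "\<lambda>x. w x - \<psi> x" s] A_le by blast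
    have "(norm (z N - x0))\<^sup>2 \<le> (\<rho> / 2)\<^sup>2"
      using N(1) by (intro power_mono) (auto simp: dist_norm norm_minus_commute)
    then have "\<delta> * (norm (z N - x0))\<^sup>2 \<le> \<eta>"
      using \<delta>(1) unfolding \<eta>_def by (simp add: power_divide)
    then have s's: "s - 3 * \<eta> < s'"
      using s'[OF AN] N(2) \<epsilon>(2) by (simp add: \<psi>_def)
    have "y \<in> cball x0 \<rho>" using z' by (intro closed_sequentially[OF closed_cball _ z'(2)]) (auto simp: A_def)
    have y: "y \<bullet> \<nu> k \<le> 0" if "k \<in> J" for k
    proof (rule LIMSEQ_le_const2)
      show "(\<lambda>k'. z' k' \<bullet> \<nu> k) \<longlonglongrightarrow> y \<bullet> \<nu> k" by (intro tendsto_intros z')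
      show "\<exists>N. \<forall>n\<ge>N. z' n \<bullet> \<nu> k \<le> 0"
        using z'(1) that unfolding A_def cone(1) by (auto intro!: less_imp_le)
    qed
    have "s' \<le> s - \<delta> * (norm (y - x0))\<^sup>2"
    proof (rule LIMSEQ_le[OF z'(3)])
      show "(\<lambda>k. s - \<delta> * (norm (z' k - x0))\<^sup>2) \<longlonglongrightarrow> s - \<delta> * (norm (y - x0))\<^sup>2"
        by (intro tendsto_intros z')
    qed (use \<psi>le' z'(1) in auto)
    with s's have "\<delta> * (norm (y - x0))\<^sup>2 < \<delta> * \<rho>\<^sup>2" using \<eta> by (simp add: \<eta>_def)
    then have "norm (y - x0) < \<rho>" using \<delta>(1) \<rho>(1) by (simp add: power_less_imp_less_base)
    then have y\<rho>: "y \<in> ball x0 \<rho>" by (simp add: dist_norm norm_minus_commute)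
    have qlim: "(\<lambda>k. q (z' k)) \<longlonglongrightarrow> q y"
      using qcont z'(2) by (intro isCont_tendsto_compose[of y q]) (auto simp: continuous_on_eq_continuous_at)
    \<comment> \<open>At the stratum the logarithmic penalty is infinite, so a maximizing sequence
      cannot converge to it.\<close>
    have qy: "q y \<noteq> 0"
    proof
      assume "q y = 0"
      have "filterlim (\<lambda>k. q (z' k)) (at_right 0) sequentially"
        unfolding filterlim_at using qlim q_pos\<Gamma> z'(1) \<open>q y = 0\<close>
        by (auto simp: A_def order_less_imp_not_eq2)
      from filterlim_compose[OF ln_at_0 this]
      have "\<forall>\<^sub>F k in sequentially. ln (q (z' k)) < ln (card B) - (s - s' + 1) / \<epsilon>"
        unfolding filterlim_at_bot_dense by blast
      moreover have "\<forall>\<^sub>F k in sequentially. s' - 1 < w (z' k) - \<psi> (z' k)"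
        using z'(3) by (intro order_tendstoD(1)) auto
      ultimately have "\<forall>\<^sub>F k in sequentially. False"
      proof eventually_elim
        case (elim k)
        have "(s - s' + 1) / \<epsilon> < F (q (z' k))" using elim(1) by (simp add: F_def)
        then have "s - s' + 1 < \<epsilon> * F (q (z' k))" using \<epsilon>(1) by (simp add: pos_divide_less_eq mult.commute)
        moreover have "0 \<le> \<delta> * (norm (z' k - x0))\<^sup>2" using \<delta>(1) by simp
        ultimately show False using \<psi>le[OF z'(1), of k] elim(2) by linarith
      qed
      then show False by simp
    qed
    have "open (ball x0 \<rho> \<inter> q -` (- {0}))"
      using qcont by (intro open_Int open_ball) (auto simp: continuous_on_open_vimage)
    then obtain r' where r': "0 < r'" "ball y r' \<subseteq> ball x0 \<rho> \<inter> q -` (- {0})"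
      using y\<rho> qy openE by (metis IntI ComplI singletonD vimageI)
    have b\<rho>: "x \<in> cball x0 \<rho>" and bq: "0 < q x" if "x \<in> ball y r'" for x
      using subsetD[OF r'(2) that] q0[of x] by auto
    define G where "G x = \<gamma> x + \<epsilon> *\<^sub>R ((2 * (- 1 / q x)) *\<^sub>R (\<Sum>b\<in>B. ((x - x0) \<bullet> b) *\<^sub>R b)) + \<delta> *\<^sub>R (2 *\<^sub>R (x - x0))" for x
    have F1: "(F has_real_derivative - 1 / t) (at t)" if "t \<in> {0<..}" for t
      unfolding F_def[abs_def] using that by (auto intro!: derivative_eq_intros)
    have F2: "((\<lambda>t. - 1 / t) has_real_derivative 1 / t\<^sup>2) (at t)" if "0 < t" for t :: real
      using that by (auto intro!: derivative_eq_intros simp: power2_eq_square)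
    note radial = has_laplacian_radial[OF finB B(1,2) q_def open_greaterThan _ F1 F2]
    show False
    proof (rule less.hyps[of y r' "c / 2" \<psi> G s' z'])
      have "active y \<subseteq> active x0" using inactive[OF \<open>y \<in> cball x0 \<rho>\<close>] by blast
      moreover have "active y \<noteq> active x0"
      proof
        assume "active y = active x0"
        then have "q y = 0" by (intro q_zero) blast
        with qy show False by simp
      qed
      ultimately show "card (active y) < card (active x0)"
        using finite_J by (intro psubset_card_mono) auto
      show "\<exists>l\<le>- (c / 2). has_laplacian \<psi> l x" if x: "x \<in> ball y r'" for x
      proof -
        obtain l where l: "l \<le> - c" "has_laplacian \<phi> l x" using lap[OF \<rho>r(1)[OF b\<rho>[OF x]]] by blast
        have "has_laplacian \<psi> (l + \<epsilon> * (4 * q x * (1 / (q x)\<^sup>2) + 2 * card B * (- 1 / q x)) + \<delta> * (2 * DIM('a))) x"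
          unfolding \<psi>_def
          by (intro has_laplacian_add has_laplacian_cmult has_laplacian_norm_power2 l(2) radial(1))
            (use bq[OF x] in auto)
        \<comment> \<open>This is nonpositive because \<open>card B\<close> is at least 2: the
          logarithm of the distance is admissible exactly in codimension two and higher.\<close>
        moreover have "4 * q x * (1 / (q x)\<^sup>2) + 2 * card B * (- 1 / q x) = (4 - 2 * real (card B)) / q x"
          using bq[OF x] by (simp add: field_simps power2_eq_square)
        moreover have "\<epsilon> * ((4 - 2 * real (card B)) / q x) \<le> 0"
          using \<epsilon>(1) bq[OF x] card by (intro mult_nonneg_nonpos divide_nonpos_pos) auto
        ultimately show ?thesis using l(1) \<delta>(2) by (intro exI conjI[rotated]) (auto simp: mult_ac)
      qed
      show "GDERIV \<psi> x :> G x" if x: "x \<in> ball y r'" for x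
        unfolding \<psi>_def G_def
        by (intro GDERIV_add GDERIV_cmult GDERIV_norm_power2 grad \<rho>r(1) b\<rho> x radial(2)) (use bq[OF x] in auto)
      show "0 < G x \<bullet> \<nu> k" if x: "x \<in> ball y r'" and k: "k \<in> J" "x \<bullet> \<nu> k = 0" for x k
      proof -
        have act: "k \<in> active x0" using inactive[OF b\<rho>[OF x] k] .
        \<comment> \<open>Both penalties have zero normal derivative here: \<open>x\<close> and
          \<open>x0\<close> are orthogonal to \<open>\<nu> k\<close>.\<close>
        then have "G x \<bullet> \<nu> k = \<gamma> x \<bullet> \<nu> k"
          using proj[OF act, of x] k(2) by (simp add: G_def inner_add_left inner_diff_left)
        then show ?thesis using normal[OF \<rho>r(1)[OF b\<rho>[OF x]] k] by simp
      qed
      show "w x - \<psi> x \<le> s'" if "x \<in> ball y r'" "x \<in> \<Gamma>" for x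
        using s' b\<rho>[OF that(1)] that(2) by (auto simp: A_def)
    qed (use y r' c z' in \<open>auto simp: A_def\<close>)
  qed
qed

text \<open>Since \<open>w\<close> is constant on rays, its supremum \<open>M\<close> is approached
  at the vertex, where the added bump \<open>\<epsilon> * E (q x)\<close> has the value
  \<open>\<epsilon> * E (q 0)\<close>. A maximizing sequence of the sum must do at least as well, so
  its limit is no farther from \<open>p\<close> than the vertex is; it is also not close to
  \<open>p\<close>, where \<open>w\<close> stays below \<open>M - \<delta>\<close>. In between,
  \<open>- \<epsilon> * E (q x)\<close> is a strict supersolution touching \<open>w\<close> up to a
  constant.\<close>

lemma homogeneous_imp_constant:
  assumes hom: "\<And>t x. 0 < t \<Longrightarrow> x \<in> \<Gamma> \<Longrightarrow> w (t *\<^sub>R x) = w x" and p: "p \<in> \<Gamma>" and "x \<in> \<Gamma>"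
  shows "w x \<le> w p"
proof (rule ccontr)
  assume "\<not> w x \<le> w p"
  define M where "M = Sup (w ` \<Gamma>)"
  have bd: "bdd_above (w ` \<Gamma>)" using bounded_above by (rule bdd_aboveI2)
  have M: "w y \<le> M" if "y \<in> \<Gamma>" for y unfolding M_def using bd that by (rule cSUP_upper2) simp
  define \<delta> where "\<delta> = (M - w p) / 2"
  have \<delta>: "0 < \<delta>" "w p < M - \<delta>" using M[OF \<open>x \<in> \<Gamma>\<close>] \<open>\<not> w x \<le> w p\<close> by (auto simp: \<delta>_def field_simps)
  have "\<forall>\<^sub>F y in at p. w y < M - \<delta>"
    using cont[OF p] \<delta>(2) by (intro order_tendstoD(2)[of w "w p"]) (auto simp: isCont_def)
  then obtain \<rho> where \<rho>: "0 < \<rho>" "\<And>y. y \<noteq> p \<Longrightarrow> dist y p < \<rho> \<Longrightarrow> w y < M - \<delta>"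
    unfolding eventually_at by auto
  have wp: "w y \<le> M - \<delta>" if "dist y p < \<rho>" for y
    using \<rho>(2)[of y] that \<delta>(2) by (cases "y = p") auto
  \<comment> \<open>The Laplacian of the bump is
    \<open>a * E (q x) * (4 * a * q x - 2 * DIM('a))\<close>. Where
    \<open>norm (x - p) \<ge> \<rho> / 2\<close> the last factor is at least 1, and the added 1
    ensures \<open>a \<ge> 1\<close>.\<close>
  define a where "a = (2 * DIM('a) + 1) / \<rho>\<^sup>2 + 1"
  have a: "1 \<le> a" "2 * DIM('a) + 1 \<le> a * \<rho>\<^sup>2" using \<rho>(1) by (auto simp: a_def field_simps)
  define q where "q y = (\<Sum>b\<in>Basis. ((y - p) \<bullet> b)\<^sup>2)" for y
  have q: "q y = (norm (y - p))\<^sup>2" for y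
    unfolding q_def power2_norm_eq_inner[of "y - p"] euclidean_inner[of "y - p" "y - p"] by (simp add: power2_eq_square)
  define E where "E t = exp (- a * t)" for t
  have E1: "(E has_real_derivative - a * E t) (at t)" if "t \<in> UNIV" for t
    unfolding E_def[abs_def] by (auto intro!: derivative_eq_intros)
  have E2: "((\<lambda>t. - a * E t) has_real_derivative a\<^sup>2 * E t) (at t)" for t
    unfolding E_def[abs_def] by (auto intro!: derivative_eq_intros simp: power2_eq_square)
  have Epos: "0 < E t" for t by (simp add: E_def)
  have Emono: "E t < E t'" if "t' < t" for t t' using that a(1) by (simp add: E_def)
  have "pairwise orthogonal (Basis :: 'a set)"
    by (auto simp: pairwise_def orthogonal_def inner_not_same_Basis)
  note radial = has_laplacian_radial[OF finite_Basis this norm_Basis q_def open_UNIV UNIV_I E1 E2]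
  have Econt: "isCont (\<lambda>y. E (q y)) y" for y using GDERIV_isCont[OF radial(2)] .
  \<comment> \<open>As \<open>E (q x) \<le> 1\<close>, a bump of size below \<open>\<delta>\<close>
    cannot make up for the deficit of \<open>w\<close> near \<open>p\<close>.\<close>
  define \<epsilon> where "\<epsilon> = \<delta> / 2"
  have \<epsilon>: "0 < \<epsilon>" "\<epsilon> < \<delta>" using \<delta>(1) by (auto simp: \<epsilon>_def)
  \<comment> \<open>The limit point satisfies \<open>norm (y - p) \<le> norm p\<close>, hence
    \<open>norm y \<le> 2 * norm p < R\<close>, and the truncation of the cone is not felt
    there.\<close>
  define R where "R = 2 * norm p + 1"
  define A where "A = \<Gamma> \<inter> cball 0 R"
  have scale: "t *\<^sub>R y \<in> \<Gamma>" if "0 < t" "y \<in> \<Gamma>" for t y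
    using that unfolding cone(1) by (auto simp: mult_pos_neg)
  have inA: "\<forall>\<^sub>F t in at_right 0. t *\<^sub>R y \<in> A" if "y \<in> \<Gamma>" for y
  proof -
    have "((\<lambda>t. t *\<^sub>R y) \<longlongrightarrow> 0 *\<^sub>R y) (at_right 0)" by (intro tendsto_intros)
    then have "\<forall>\<^sub>F t in at_right 0. t *\<^sub>R y \<in> ball 0 R"
      by (intro topological_tendstoD) (auto simp: R_def add_nonneg_pos)
    then show ?thesis
      using eventually_at_right_less[of 0] by eventually_elim (use that scale in \<open>auto simp: A_def\<close>)
  qed
  have A: "bounded A" "A \<noteq> {}"
    using eventually_happens[OF inA[OF p]] by (auto simp: A_def)
  have A_le: "w y + \<epsilon> * E (q y) \<le> M + \<epsilon>" if "y \<in> A" for y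
  proof -
    have "E (q y) \<le> 1" using a(1) by (simp add: E_def q)
    then have "\<epsilon> * E (q y) \<le> \<epsilon> * 1" using \<epsilon>(1) by (intro mult_left_mono) auto
    moreover have "w y \<le> M" using that by (intro M) (auto simp: A_def)
    ultimately show ?thesis by simp
  qed
  obtain s y z where s: "\<And>x. x \<in> A \<Longrightarrow> w x + \<epsilon> * E (q x) \<le> s"
    and z: "\<And>k. z k \<in> A" "z \<longlonglongrightarrow> y" "(\<lambda>k. w (z k) + \<epsilon> * E (q (z k))) \<longlonglongrightarrow> s"
    using maximizing_sequence[OF A, of "\<lambda>x. w x + \<epsilon> * E (q x)" "M + \<epsilon>"] A_le by blast
  \<comment> \<open>The point \<open>y\<close> is moved to the vertex along its ray, which does not
    change \<open>w\<close> and brings it into \<open>A\<close>.\<close>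
  have "w y \<le> s - \<epsilon> * E (q 0)" if y: "y \<in> \<Gamma>" for y
  proof -
    have "((\<lambda>t. t *\<^sub>R y) \<longlongrightarrow> 0 *\<^sub>R y) (at_right 0)" by (intro tendsto_intros)
    then have "((\<lambda>t. E (q (t *\<^sub>R y))) \<longlongrightarrow> E (q 0)) (at_right 0)"
      by (intro isCont_tendsto_compose[OF Econt]) auto
    then have "((\<lambda>t. s - \<epsilon> * E (q (t *\<^sub>R y))) \<longlongrightarrow> s - \<epsilon> * E (q 0)) (at_right 0)"
      by (intro tendsto_intros)
    moreover have "\<forall>\<^sub>F t in at_right 0. w y \<le> s - \<epsilon> * E (q (t *\<^sub>R y))"
      using inA[OF y] eventually_at_right_less[of 0]
    proof eventually_elim
      case (elim t)
      with s[of "t *\<^sub>R y"] hom[OF _ y, of t] show ?case by simp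
    qed
    ultimately show ?thesis by (intro tendsto_lowerbound) auto
  qed
  then have Ms: "M + \<epsilon> * E (q 0) \<le> s"
    unfolding M_def using cone(2) cSUP_least[of \<Gamma> w "s - \<epsilon> * E (q 0)"] by simp
  have Elim: "(\<lambda>k. \<epsilon> * E (q (z k))) \<longlonglongrightarrow> \<epsilon> * E (q y)"
    by (intro tendsto_mult_left isCont_tendsto_compose[OF Econt z(2)])
  have "s \<le> M + \<epsilon> * E (q y)"
  proof (rule LIMSEQ_le[OF z(3) tendsto_add[OF tendsto_const Elim]])
    show "\<exists>N. \<forall>n\<ge>N. w (z n) + \<epsilon> * E (q (z n)) \<le> M + \<epsilon> * E (q (z n))"
      using M z(1) by (auto simp: A_def)
  qed
  with Ms have "\<epsilon> * E (q 0) \<le> \<epsilon> * E (q y)" by simp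
  then have "E (q 0) \<le> E (q y)" using \<epsilon>(1) by simp
  then have "q y \<le> q 0" using Emono[of "q 0" "q y"] by linarith
  then have "norm (y - p) \<le> norm p" by (simp add: q)
  then have yR: "norm y < R" using norm_triangle_sub[of y p] by (simp add: R_def)
  have y\<rho>: "\<rho> \<le> norm (y - p)"
  proof (rule ccontr)
    assume "\<not> \<rho> \<le> norm (y - p)"
    then have "\<forall>\<^sub>F k in sequentially. z k \<in> ball p \<rho>"
      using z(2) by (intro topological_tendstoD) (auto simp: dist_norm norm_minus_commute)
    then have "\<forall>\<^sub>F k in sequentially. w (z k) + \<epsilon> * E (q (z k)) \<le> (M - \<delta>) + \<epsilon>"
    proof eventually_elim
      case (elim k)
      have "E (q (z k)) \<le> 1" using a(1) by (simp add: E_def q)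
      then have "\<epsilon> * E (q (z k)) \<le> \<epsilon> * 1" using \<epsilon>(1) by (intro mult_left_mono) auto
      with wp[of "z k"] elim show ?case by (simp add: dist_commute)
    qed
    then have "s \<le> (M - \<delta>) + \<epsilon>" using z(3) by (intro tendsto_upperbound[OF z(3)]) auto
    moreover have "0 < \<epsilon> * E (q 0)" using \<epsilon> Epos by simp
    ultimately show False using Ms \<epsilon> by linarith
  qed
  \<comment> \<open>Both conditions persist on the ball: distance at least \<open>\<rho> / 2\<close>
    from \<open>p\<close>, and membership in \<open>cball 0 R\<close>.\<close>
  define r where "r = min (\<rho> / 2) (R - norm y)"
  have r: "0 < r" using \<rho>(1) yR by (simp add: r_def)
  have far: "\<rho> / 2 \<le> norm (x - p)" and xR: "norm x \<le> R" if "x \<in> ball y r" for x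
  proof -
    have "norm (y - x) < \<rho> / 2" "norm (y - x) < R - norm y" using that by (auto simp: r_def dist_norm)
    then show "\<rho> / 2 \<le> norm (x - p)" "norm x \<le> R"
      using y\<rho> norm_triangle_ineq[of "y - x" "x - p"] norm_triangle_ineq[of y "x - y"]
      by (auto simp: norm_minus_commute)
  qed
  \<comment> \<open>On that ball \<open>norm (x - p)\<close> is at most \<open>R + norm p\<close>,
    so \<open>\<epsilon> * E (q x)\<close> is at least \<open>c\<close>.\<close>
  define c where "c = \<epsilon> * E ((R + norm p)\<^sup>2)"
  show False
  proof (rule no_touching[of y r c "\<lambda>x. - \<epsilon> * E (q x)"
        "\<lambda>x. (- \<epsilon>) *\<^sub>R ((2 * (- a * E (q x))) *\<^sub>R (\<Sum>b\<in>Basis. ((x - p) \<bullet> b) *\<^sub>R b))" s z])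
    show "y \<bullet> \<nu> k \<le> 0" if "k \<in> J" for k
    proof (rule LIMSEQ_le_const2)
      show "(\<lambda>k'. z k' \<bullet> \<nu> k) \<longlonglongrightarrow> y \<bullet> \<nu> k" by (intro tendsto_intros z)
      show "\<exists>N. \<forall>n\<ge>N. z n \<bullet> \<nu> k \<le> 0"
        using z(1) that unfolding A_def cone(1) by (auto intro!: less_imp_le)
    qed
    show "0 < c" using \<epsilon>(1) Epos by (simp add: c_def)
    show "\<exists>l\<le>- c. has_laplacian (\<lambda>x. - \<epsilon> * E (q x)) l x" if x: "x \<in> ball y r" for x
    proof (intro exI conjI)
      show "has_laplacian (\<lambda>x. - \<epsilon> * E (q x))
          (- \<epsilon> * (4 * q x * (a\<^sup>2 * E (q x)) + 2 * DIM('a) * (- a * E (q x)))) x"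
        by (intro has_laplacian_cmult radial(1))
      have "(\<rho> / 2)\<^sup>2 \<le> q x" unfolding q using far[OF x] \<rho>(1) by (intro power_mono) auto
      then have "\<rho>\<^sup>2 \<le> 4 * q x" by (simp add: power_divide)
      then have "a * \<rho>\<^sup>2 \<le> a * (4 * q x)" using a(1) by (intro mult_left_mono) auto
      then have "1 \<le> a * (4 * q x) - 2 * DIM('a)" using a(2) by linarith
      then have "1 * 1 \<le> a * (a * (4 * q x) - 2 * DIM('a))" using a(1) by (intro mult_mono) auto
      moreover have "E ((R + norm p)\<^sup>2) \<le> E (q x)"
      proof -
        have "q x \<le> (R + norm p)\<^sup>2"
          unfolding q using xR[OF x] norm_triangle_ineq4[of x p] by (intro power_mono) auto
        then show ?thesis using Emono[of "q x" "(R + norm p)\<^sup>2"] by (cases "q x = (R + norm p)\<^sup>2") auto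
      qed
      ultimately have "E ((R + norm p)\<^sup>2) * 1 \<le> E (q x) * (a * (a * (4 * q x) - 2 * DIM('a)))"
        using Epos by (intro mult_mono) (auto intro: less_imp_le)
      then have "\<epsilon> * E ((R + norm p)\<^sup>2) \<le> \<epsilon> * (E (q x) * (a * (a * (4 * q x) - 2 * DIM('a))))"
        using \<epsilon>(1) by simp
      then show "- \<epsilon> * (4 * q x * (a\<^sup>2 * E (q x)) + 2 * DIM('a) * (- a * E (q x))) \<le> - c"
        by (simp add: c_def power2_eq_square algebra_simps)
    qed
    show "GDERIV (\<lambda>x. - \<epsilon> * E (q x)) x :>
        (- \<epsilon>) *\<^sub>R ((2 * (- a * E (q x))) *\<^sub>R (\<Sum>b\<in>Basis. ((x - p) \<bullet> b) *\<^sub>R b))" for x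
      by (intro GDERIV_cmult radial(2))
    show "0 < (- \<epsilon>) *\<^sub>R ((2 * (- a * E (q x))) *\<^sub>R (\<Sum>b\<in>Basis. ((x - p) \<bullet> b) *\<^sub>R b)) \<bullet> \<nu> k"
      if "k \<in> J" "x \<bullet> \<nu> k = 0" for x k
    proof -
      have "p \<bullet> \<nu> k < 0" using p that(1) unfolding cone(1) by blast
      then have "0 < \<epsilon> * (2 * (a * E (q x))) * (- (p \<bullet> \<nu> k))"
        using \<epsilon>(1) a(1) Epos[of "q x"] by (intro mult_pos_pos) auto
      then show ?thesis
        unfolding euclidean_representation using that(2) by (simp add: inner_diff_left algebra_simps)
    qed
    show "w x - - \<epsilon> * E (q x) \<le> s" if "x \<in> ball y r" "x \<in> \<Gamma>" for x
      using s[of x] xR[OF that(1)] that(2) by (simp add: A_def)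
    show "(\<lambda>k. w (z k) - - \<epsilon> * E (q (z k))) \<longlonglongrightarrow> s" using z(3) by simp
  qed (use r z in \<open>auto simp: A_def\<close>)
qed

end

section \<open>Homogeneous solutions of degree two\<close>

definition reflect :: "'a::euclidean_space \<Rightarrow> 'a \<Rightarrow> 'a" where
  "reflect n x = x - (2 * (x \<bullet> n)) *\<^sub>R n"

lemma linear_reflect: "linear (reflect n)"
  by (rule linearI) (simp_all add: reflect_def inner_simps algebra_simps)

lemma has_derivative_reflect: "(reflect n has_derivative reflect n) F"
  using linear_reflect by (intro bounded_linear_imp_has_derivative) (simp add: linear_conv_bounded_linear)

lemma reflect_inner: "reflect n x \<bullet> y = x \<bullet> reflect n y"
  by (simp add: reflect_def inner_simps inner_commute)

lemma reflect_reflect: "norm n = 1 \<Longrightarrow> reflect n (reflect n x) = x"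
  by (simp add: reflect_def inner_simps norm_eq_1 algebra_simps)

lemma norm_reflect: "norm n = 1 \<Longrightarrow> norm (reflect n x) = norm x"
  by (simp add: norm_eq_sqrt_inner reflect_inner reflect_reflect)

lemma reflect_eq_self: "x \<bullet> n = 0 \<Longrightarrow> reflect n x = x"
  by (simp add: reflect_def)

lemma reflect_inner_normal: "norm n = 1 \<Longrightarrow> reflect n x \<bullet> n = - (x \<bullet> n)"
  by (simp add: reflect_def inner_simps norm_eq_1)

lemma sum_inner_reflect:
  assumes "norm n = 1"
  shows "(\<Sum>b\<in>Basis. (x \<bullet> reflect n b) * (y \<bullet> reflect n b)) = x \<bullet> y"
  using euclidean_inner[of "reflect n x" "reflect n y"] assms by (simp add: reflect_inner reflect_reflect)

text \<open>Each diagonal entry is expanded in the coordinate basis through the adjoint; after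
  exchanging the sums, Parseval's identity for the reflected basis applies.\<close>

lemma trace_reflect:
  fixes A :: "'a::euclidean_space \<Rightarrow> 'a"
  assumes "linear A" "norm n = 1"
  shows "(\<Sum>b\<in>Basis. A (reflect n b) \<bullet> reflect n b) = (\<Sum>b\<in>Basis. A b \<bullet> b)"
proof -
  have "A x \<bullet> x = (\<Sum>c\<in>Basis. (adjoint A x \<bullet> c) * (x \<bullet> c))" for x
    using euclidean_inner[of "adjoint A x" x] adjoint_works[OF assms(1), of x x] by (simp add: inner_commute)
  then have "(\<Sum>b\<in>Basis. A (reflect n b) \<bullet> reflect n b)
      = (\<Sum>b\<in>Basis. \<Sum>c\<in>Basis. (adjoint A (reflect n b) \<bullet> c) * (reflect n b \<bullet> c))"
    by simp
  also have "\<dots> = (\<Sum>c\<in>Basis. \<Sum>b\<in>Basis. (A c \<bullet> reflect n b) * (c \<bullet> reflect n b))"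
    using adjoint_works[OF assms(1)] by (subst sum.swap) (simp add: inner_commute)
  finally show ?thesis by (simp add: sum_inner_reflect assms(2))
qed

text \<open>The squared Hilbert-Schmidt norm is the trace of the adjoint of \<open>A\<close>
  composed with \<open>A\<close>.\<close>

lemma sum_norm_power2_reflect:
  fixes A :: "'a::euclidean_space \<Rightarrow> 'a"
  assumes "linear A" "norm n = 1"
  shows "(\<Sum>b\<in>Basis. (norm (A (reflect n b)))\<^sup>2) = (\<Sum>b\<in>Basis. (norm (A b))\<^sup>2)"
proof -
  have "linear (adjoint A \<circ> A)" using assms(1) adjoint_linear by (intro linear_compose) auto
  from trace_reflect[OF this assms(2)] show ?thesis
    using adjoint_works[OF assms(1)] by (simp add: power2_norm_eq_inner inner_commute)
qed

lemma GDERIV_component: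
  fixes g :: "'a::euclidean_space \<Rightarrow> 'a"
  assumes "(g has_derivative A) (at x)"
  shows "GDERIV (\<lambda>y. g y \<bullet> b) x :> adjoint A b"
proof -
  have "linear A" using assms has_derivative_linear by blast
  then have "(\<lambda>h. A h \<bullet> b) = (\<lambda>h. h \<bullet> adjoint A b)" by (simp add: adjoint_works)
  then show ?thesis
    using has_derivative_inner_left[OF assms, of b] by (simp add: gderiv_def)
qed

lemma has_laplacian_of_derivative:
  assumes "open U" "x \<in> U" "\<And>y. y \<in> U \<Longrightarrow> GDERIV u y :> g y" "(g has_derivative A) (at x)"
  shows "has_laplacian u (\<Sum>b\<in>Basis. A b \<bullet> b) x"
proof -
  have "linear A" using assms(4) has_derivative_linear by blast
  then have "(\<Sum>b\<in>Basis. adjoint A b \<bullet> b) = (\<Sum>b\<in>Basis. A b \<bullet> b)"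
    by (simp add: adjoint_works inner_commute[of "adjoint A b" b for b])
  with has_laplacian_trace[OF assms(1-3) GDERIV_component[OF assms(4)]] show ?thesis by simp
qed

lemma has_derivative_norm_le_lipschitz:
  assumes "open U" "x \<in> U" "L-lipschitz_on U g" "(g has_derivative A) (at x)"
  shows "norm (A h) \<le> L * norm h"
proof (cases "h = 0")
  case True
  then show ?thesis using has_derivative_linear[OF assms(4)] by (simp add: linear_0)
next
  case False
  have "norm (A h) \<le> L * norm h + e" if "0 < e" for e
  proof -
    have "0 < e / norm h" using False that by simp
    then obtain d where d: "0 < d"
      "\<And>y. norm (y - x) < d \<Longrightarrow> norm (g y - g x - A (y - x)) \<le> e / norm h * norm (y - x)"
      using assms(4) unfolding has_derivative_within_alt by blast
    obtain d' where d': "0 < d'" "ball x d' \<subseteq> U" using assms(1,2) openE by blast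
    define t where "t = min d d' / (2 * norm h)"
    have t: "0 < t" "t * norm h < d" "t * norm h < d'" using d(1) d'(1) False by (auto simp: t_def min_def)
    have "x + t *\<^sub>R h \<in> U" using t d'(2) by (auto simp: dist_norm subset_iff)
    then have "norm (g (x + t *\<^sub>R h) - g x) \<le> L * (t * norm h)"
      using lipschitz_onD[OF assms(3) _ assms(2)] t(1) by (fastforce simp: dist_norm)
    moreover have "norm (g (x + t *\<^sub>R h) - g x - t *\<^sub>R A h) \<le> e * t"
      using d(2)[of "x + t *\<^sub>R h"] t(1,2) False has_derivative_linear[OF assms(4)] by (simp add: linear_scale)
    ultimately have "norm (t *\<^sub>R A h) \<le> L * (t * norm h) + e * t"
      using norm_triangle_ineq4[of "g (x + t *\<^sub>R h) - g x" "g (x + t *\<^sub>R h) - g x - t *\<^sub>R A h"] by simp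
    then have "t * norm (A h) \<le> t * (L * norm h + e)" using t(1) by (simp add: algebra_simps)
    then show ?thesis using t(1) by simp
  qed
  then show ?thesis by (rule field_le_epsilon)
qed

text \<open>On the convex set \<open>U \<inter> ball x d\<close> the map
  \<open>y \<mapsto> v y - y \<bullet> g x\<close> has a derivative of norm at most
  \<open>e\<close>. The mean value inequality between two points of \<open>U\<close> then passes to
  the closure by approximating both. It provides the one-sided expansion needed to glue across a
  face.\<close>

lemma has_derivative_within_closure:
  fixes v :: "'a::euclidean_space \<Rightarrow> real"
  assumes "convex U" "open U" and cv: "continuous_on (closure U) v" and cg: "continuous_on (closure U) g"
    and g: "\<And>x. x \<in> U \<Longrightarrow> GDERIV v x :> g x" and x: "x \<in> closure U"
  shows "(v has_derivative (\<lambda>h. h \<bullet> g x)) (at x within closure U)"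
  unfolding has_derivative_within_alt
proof (intro conjI allI impI)
  show "bounded_linear (\<lambda>h. h \<bullet> g x)" by (rule bounded_linear_inner_left)
  fix e :: real assume "0 < e"
  then obtain d where d: "0 < d" "\<And>y. y \<in> closure U \<Longrightarrow> dist y x < d \<Longrightarrow> dist (g y) (g x) < e"
    using cg x unfolding continuous_on_iff by blast
  have inner: "\<bar>v y - v z - (y - z) \<bullet> g x\<bar> \<le> e * norm (y - z)"
    if yz: "y \<in> U \<inter> ball x d" "z \<in> U \<inter> ball x d" for y z
  proof -
    have "norm ((v y - y \<bullet> g x) - (v z - z \<bullet> g x)) \<le> e * norm (y - z)"
    proof (rule differentiable_bound[of "U \<inter> ball x d" _ "\<lambda>y h. h \<bullet> g y - h \<bullet> g x"])
      show "convex (U \<inter> ball x d)" using assms(1) by (intro convex_Int convex_ball)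
      fix y assume y: "y \<in> U \<inter> ball x d"
      then show "((\<lambda>y. v y - y \<bullet> g x) has_derivative (\<lambda>h. h \<bullet> g y - h \<bullet> g x)) (at y within U \<inter> ball x d)"
        using g[of y] unfolding gderiv_def
        by (intro has_derivative_diff has_derivative_inner_left has_derivative_ident)
          (auto intro: has_derivative_at_withinI)
      show "onorm (\<lambda>h. h \<bullet> g y - h \<bullet> g x) \<le> e"
      proof (rule onorm_le)
        fix h
        have "\<bar>h \<bullet> (g y - g x)\<bar> \<le> norm h * norm (g y - g x)" by (rule Cauchy_Schwarz_ineq2)
        also have "\<dots> \<le> norm h * e"
          using d(2)[of y] y subsetD[OF closure_subset, of y U] by (intro mult_left_mono) (auto simp: dist_norm norm_minus_commute)
        finally show "norm (h \<bullet> g y - h \<bullet> g x) \<le> e * norm h" by (simp add: inner_diff_right mult.commute)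
      qed
    qed (use yz in auto)
    then show ?thesis by (simp add: inner_diff_left algebra_simps)
  qed
  have sub: "closure U \<inter> ball x d \<subseteq> closure (U \<inter> ball x d)"
    using open_Int_closure_subset[of "ball x d" U] by (simp add: Int_commute)
  have outer: "\<bar>v y - v z - (y - z) \<bullet> g x\<bar> \<le> e * norm (y - z)"
    if yz: "y \<in> closure U \<inter> ball x d" "z \<in> closure U \<inter> ball x d" for y z
  proof -
    obtain y' where y': "\<And>k. y' k \<in> U \<inter> ball x d" "y' \<longlonglongrightarrow> y" using subsetD[OF sub yz(1)] unfolding closure_sequential by blast
    obtain z' where z': "\<And>k. z' k \<in> U \<inter> ball x d" "z' \<longlonglongrightarrow> z" using subsetD[OF sub yz(2)] unfolding closure_sequential by blast
    have "(\<lambda>k. v (y' k)) \<longlonglongrightarrow> v y" "(\<lambda>k. v (z' k)) \<longlonglongrightarrow> v z"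
      using subsetD[OF closure_subset, of _ U] y' z' yz
      by (auto intro!: continuous_on_tendsto_compose[OF cv] always_eventually)
    then have "(\<lambda>k. \<bar>v (y' k) - v (z' k) - (y' k - z' k) \<bullet> g x\<bar>) \<longlonglongrightarrow> \<bar>v y - v z - (y - z) \<bullet> g x\<bar>"
      using y'(2) z'(2) by (intro tendsto_intros)
    moreover have "(\<lambda>k. e * norm (y' k - z' k)) \<longlonglongrightarrow> e * norm (y - z)"
      using y'(2) z'(2) by (intro tendsto_intros)
    ultimately show ?thesis using inner y'(1) z'(1) by (intro LIMSEQ_le) auto
  qed
  show "\<exists>d>0. \<forall>y\<in>closure U. norm (y - x) < d \<longrightarrow> norm (v y - v x - (y - x) \<bullet> g x) \<le> e * norm (y - x)"
    using outer x d(1) by (intro exI[of _ d]) (auto simp: dist_norm norm_minus_commute)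
qed

text \<open>Every Hessian entry is harmonic and differentiable, so its square has Laplacian twice
  the squared norm of its gradient. It serves both in the interior and for the even extension across
  a face.\<close>

lemma hessian_norm_regularity:
  fixes u :: "'a::euclidean_space \<Rightarrow> real"
  assumes u: "piecewise_harmonic (ball z r) u" and g: "\<And>x. x \<in> ball z r \<Longrightarrow> GDERIV u x :> g x"
    and cg: "continuous_on (ball z r) g" and r': "0 < r'" "r' < r"
  shows "\<exists>A T. \<forall>x\<in>ball z r'. (g has_derivative A x) (at x) \<and>
     (\<forall>b\<in>Basis. \<forall>c\<in>Basis. GDERIV (\<lambda>x. A x c \<bullet> b) x :> T b c x) \<and>
     has_laplacian (\<lambda>x. \<Sum>c\<in>Basis. (norm (A x c))\<^sup>2) (\<Sum>b\<in>Basis. \<Sum>c\<in>Basis. 2 * (norm (T b c x))\<^sup>2) x"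
proof -
  obtain G T where all: "\<forall>x\<in>ball z r'. \<forall>b\<in>Basis. GDERIV (\<lambda>x. g x \<bullet> b) x :> G b x \<and>
      (\<forall>c\<in>Basis. GDERIV (\<lambda>x. G b x \<bullet> c) x :> T b c x \<and> has_laplacian (\<lambda>x. G b x \<bullet> c) 0 x)"
  proof -
    have "\<exists>G T. \<forall>x\<in>ball z r'. \<forall>b\<in>Basis. GDERIV (\<lambda>x. g x \<bullet> b) x :> G b x \<and>
      (\<forall>c\<in>Basis. GDERIV (\<lambda>x. G b x \<bullet> c) x :> T b c x \<and> has_laplacian (\<lambda>x. G b x \<bullet> c) 0 x)"
      by (rule piecewise_harmonic_third_derivatives[OF u g cg r'])
    then show thesis by (elim exE) (rule that)
  qed
  have GT: "GDERIV (\<lambda>x. g x \<bullet> b) x :> G b x" if "x \<in> ball z r'" "b \<in> Basis" for x b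
    using bspec[OF bspec[OF all that(1)] that(2)] by (rule conjunct1)
  have GT2: "GDERIV (\<lambda>x. G b x \<bullet> c) x :> T b c x \<and> has_laplacian (\<lambda>x. G b x \<bullet> c) 0 x"
    if "x \<in> ball z r'" "b \<in> Basis" "c \<in> Basis" for x b c
    using bspec[OF conjunct2[OF bspec[OF bspec[OF all that(1)] that(2)]] that(3)] .
  define A where "A x h = (\<Sum>b\<in>Basis. (h \<bullet> G b x) *\<^sub>R b)" for x h
  have Ab: "A x h \<bullet> b = h \<bullet> G b x" if "b \<in> Basis" for x h b
    using that by (simp add: A_def)
  have "has_laplacian (\<lambda>x. \<Sum>c\<in>Basis. (norm (A x c))\<^sup>2) (\<Sum>b\<in>Basis. \<Sum>c\<in>Basis. 2 * (norm (T b c x))\<^sup>2) x"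
    if x: "x \<in> ball z r'" for x
  proof -
    have "has_laplacian (\<lambda>x. (G b x \<bullet> c)\<^sup>2) (2 * (norm (T b c x))\<^sup>2) x" if "b \<in> Basis" "c \<in> Basis" for b c
      using has_laplacian_power2[OF conjunct1[OF GT2[OF x that]] conjunct2[OF GT2[OF x that]]] by simp
    then have "has_laplacian (\<lambda>x. \<Sum>b\<in>Basis. \<Sum>c\<in>Basis. (G b x \<bullet> c)\<^sup>2) (\<Sum>b\<in>Basis. \<Sum>c\<in>Basis. 2 * (norm (T b c x))\<^sup>2) x"
      by (intro has_laplacian_sum) auto
    moreover have "(\<Sum>b\<in>Basis. \<Sum>c\<in>Basis. (G b x \<bullet> c)\<^sup>2) = (\<Sum>c\<in>Basis. (norm (A x c))\<^sup>2)" for x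
    proof -
      have "(norm (A x c))\<^sup>2 = (\<Sum>b\<in>Basis. (G b x \<bullet> c)\<^sup>2)" for c
        unfolding power2_norm_eq_inner euclidean_inner[of "A x c" "A x c"]
        by (intro sum.cong) (auto simp: Ab power2_eq_square inner_commute[of "G b x" c for b])
      then show ?thesis by (subst sum.swap) simp
    qed
    ultimately show ?thesis by simp
  qed
  moreover have "(g has_derivative A x) (at x)" if "x \<in> ball z r'" for x
    unfolding has_derivative_componentwise_within[of g]
    using GT[OF that] by (simp add: gderiv_def Ab)
  moreover have "GDERIV (\<lambda>x. A x c \<bullet> b) x :> T b c x" if "x \<in> ball z r'" "b \<in> Basis" "c \<in> Basis" for x b c
    using conjunct1[OF GT2[OF that]] unfolding Ab[OF that(2)] by (simp only: inner_commute[of c])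
  ultimately show ?thesis by (intro exI[of _ A] exI[of _ T]) blast
qed

section \<open>Rigidity of the homogeneous Neumann solution\<close>

locale homogeneous_neumann_solution =
  fixes J :: "'i set" and \<nu> :: "'i \<Rightarrow> 'a::euclidean_space" and \<Gamma> :: "'a set"
    and v :: "'a \<Rightarrow> real" and g :: "'a \<Rightarrow> 'a" and D :: "'a \<Rightarrow> 'a \<Rightarrow> 'a" and L :: real
  assumes finite_J: "finite J"
    and cone: "\<Gamma> = {x. \<forall>i\<in>J. x \<bullet> \<nu> i < 0}" "\<Gamma> \<noteq> {}"
    and norm_\<nu>: "\<And>i. i \<in> J \<Longrightarrow> norm (\<nu> i) = 1"
    and cont_v: "continuous_on (closure \<Gamma>) v"
    and cont_g: "continuous_on (closure \<Gamma>) g"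
    and gradient: "\<And>x. x \<in> \<Gamma> \<Longrightarrow> GDERIV v x :> g x"
    and hessian: "\<And>x. x \<in> \<Gamma> \<Longrightarrow> (g has_derivative D x) (at x)"
    and trace_0: "\<And>x. x \<in> \<Gamma> \<Longrightarrow> (\<Sum>b\<in>Basis. D x b \<bullet> b) = 0"
    and lipschitz: "L-lipschitz_on \<Gamma> g"
    and neumann_g: "\<And>x i. x \<in> closure \<Gamma> \<Longrightarrow> i \<in> J \<Longrightarrow> x \<bullet> \<nu> i = 0 \<Longrightarrow> g x \<bullet> \<nu> i = 0"
    and homogeneous: "\<And>x t. x \<in> \<Gamma> \<Longrightarrow> 0 < t \<Longrightarrow> v (t *\<^sub>R x) = t\<^sup>2 * v x"
begin

lemma open_\<Gamma>: "open \<Gamma>"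
  unfolding cone(1) using finite_J by (rule open_polyhedral_cone)

lemma convex_\<Gamma>: "convex \<Gamma>"
proof -
  have "\<Gamma> = (\<Inter>i\<in>J. {x. \<nu> i \<bullet> x < 0})" unfolding cone(1) by (auto simp: inner_commute)
  then show ?thesis by (auto intro: convex_INT convex_halfspace_lt)
qed

lemma scale_\<Gamma>: "0 < t \<Longrightarrow> x \<in> \<Gamma> \<Longrightarrow> t *\<^sub>R x \<in> \<Gamma>"
  unfolding cone(1) by (auto simp: mult_pos_neg)

text \<open>Adding small multiples of a point of the open cone makes all the weak inequalities
  strict.\<close>

lemma closure_\<Gamma>I:
  assumes "\<And>i. i \<in> J \<Longrightarrow> x \<bullet> \<nu> i \<le> 0"
  shows "x \<in> closure \<Gamma>"
proof -
  obtain p where p: "p \<in> \<Gamma>" using cone(2) by blast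
  have "(\<lambda>k. x + (1 / real (Suc k)) *\<^sub>R p) \<longlonglongrightarrow> x + 0 *\<^sub>R p"
    by (intro tendsto_intros LIMSEQ_Suc lim_1_over_n)
  moreover have "x + (1 / real (Suc k)) *\<^sub>R p \<in> \<Gamma>" for k
    using p assms unfolding cone(1)
    by (auto simp: inner_add_left intro!: add_nonpos_neg divide_neg_pos)
  ultimately show ?thesis unfolding closure_sequential by (intro exI[of _ "\<lambda>k. x + (1 / real (Suc k)) *\<^sub>R p"]) simp
qed

lemma gradient_homogeneous:
  assumes "x \<in> \<Gamma>" "0 < t"
  shows "g (t *\<^sub>R x) = t *\<^sub>R g x"
proof -
  have "((\<lambda>y. v (t *\<^sub>R y)) has_derivative (\<lambda>h. (t *\<^sub>R h) \<bullet> g (t *\<^sub>R x))) (at x)"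
    using gradient[OF scale_\<Gamma>[OF assms(2,1)]] unfolding gderiv_def
    by (intro has_derivative_compose[of "\<lambda>y. t *\<^sub>R y" "\<lambda>y. t *\<^sub>R y" x UNIV v]) (auto intro!: derivative_eq_intros)
  then have "GDERIV (\<lambda>y. t\<^sup>2 * v y) x :> t *\<^sub>R g (t *\<^sub>R x)"
    unfolding gderiv_def
    by (intro has_derivative_transform_within_open[OF _ open_\<Gamma> assms(1) homogeneous[OF _ assms(2)]]) auto
  from GDERIV_unique[OF this GDERIV_cmult[OF gradient[OF assms(1)]]]
  have "t *\<^sub>R g (t *\<^sub>R x) = t *\<^sub>R (t *\<^sub>R g x)" by (simp add: power2_eq_square)
  then show ?thesis by (rule scaleR_left_imp_eq[rotated]) (use assms(2) in simp)
qed

text \<open>Differentiating the degree-one homogeneity of \<open>g\<close> once more leaves degree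
  zero; this is what makes the Hessian norm constant along rays.\<close>

lemma hessian_homogeneous:
  assumes "x \<in> \<Gamma>" "0 < t"
  shows "D (t *\<^sub>R x) = D x"
proof -
  have "((\<lambda>y. g (t *\<^sub>R y)) has_derivative (\<lambda>h. D (t *\<^sub>R x) (t *\<^sub>R h))) (at x)"
    by (intro has_derivative_compose[of "\<lambda>y. t *\<^sub>R y" "\<lambda>y. t *\<^sub>R y" x UNIV g] hessian scale_\<Gamma> assms)
      (auto intro!: derivative_eq_intros)
  then have "((\<lambda>y. t *\<^sub>R g y) has_derivative (\<lambda>h. D (t *\<^sub>R x) (t *\<^sub>R h))) (at x)"
    by (rule has_derivative_transform_within_open[OF _ open_\<Gamma> assms(1) gradient_homogeneous[OF _ assms(2)]])
  moreover have "((\<lambda>y. t *\<^sub>R g y) has_derivative (\<lambda>h. t *\<^sub>R D x h)) (at x)"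
    by (intro has_derivative_scaleR_right hessian assms)
  ultimately have "(\<lambda>h. D (t *\<^sub>R x) (t *\<^sub>R h)) = (\<lambda>h. t *\<^sub>R D x h)" by (rule has_derivative_unique)
  moreover have "linear (D (t *\<^sub>R x))" using hessian[OF scale_\<Gamma>[OF assms(2,1)]] has_derivative_linear by blast
  ultimately show ?thesis using assms(2) by (intro ext) (metis linear_scale real_vector.scale_cancel_left less_irrefl)
qed

lemma interior_piecewise_harmonic:
  assumes "U \<subseteq> \<Gamma>"
  shows "piecewise_harmonic U v"
proof (rule piecewise_harmonicI[of "{}"])
  show "has_laplacian v 0 x" if "x \<in> U" for x
    using has_laplacian_of_derivative[OF open_\<Gamma> _ gradient hessian, of x] trace_0 assms that by auto
  show "\<exists>g. GDERIV v x :> g" if "x \<in> U" for x using gradient assms that by blast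
qed auto

text \<open>The function w of the overview, with the Hilbert-Schmidt norm because that norm is
  invariant under reflections.\<close>

definition hessian_sq :: "'a \<Rightarrow> real" where "hessian_sq x = (\<Sum>b\<in>Basis. (norm (D x b))\<^sup>2)"

text \<open>On a small ball \<open>D\<close> agrees, by uniqueness of derivatives, with the Hessian
  supplied by \<open>hessian_norm_regularity\<close>. The explicit sum of squares is kept because
  its vanishing later forces every \<open>T b c\<close> to be 0.\<close>

lemma interior_regularity:
  assumes "x \<in> \<Gamma>"
  shows "isCont hessian_sq x"
    and "\<exists>T. (\<forall>b\<in>Basis. \<forall>c\<in>Basis. GDERIV (\<lambda>y. D y c \<bullet> b) x :> T b c) \<and>
      has_laplacian hessian_sq (\<Sum>b\<in>Basis. \<Sum>c\<in>Basis. 2 * (norm (T b c))\<^sup>2) x"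
proof -
  obtain r where r: "0 < r" "ball x r \<subseteq> \<Gamma>" using open_\<Gamma> assms openE by blast
  have cg: "continuous_on (ball x r) g"
    using cont_g r(2) closure_subset by (blast intro: continuous_on_subset)
  have r2: "0 < r / 2" "r / 2 < r" using r(1) by auto
  have "\<And>y. y \<in> ball x r \<Longrightarrow> GDERIV v y :> g y" using gradient r(2) by blast
  from hessian_norm_regularity[OF interior_piecewise_harmonic[OF r(2)] this cg r2]
  obtain A T where AT: "\<And>y. y \<in> ball x (r / 2) \<Longrightarrow> (g has_derivative A y) (at y)"
    "\<And>y b c. y \<in> ball x (r / 2) \<Longrightarrow> b \<in> Basis \<Longrightarrow> c \<in> Basis \<Longrightarrow> GDERIV (\<lambda>x. A x c \<bullet> b) y :> T b c y"
    "\<And>y. y \<in> ball x (r / 2) \<Longrightarrow>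
      has_laplacian (\<lambda>x. \<Sum>c\<in>Basis. (norm (A x c))\<^sup>2) (\<Sum>b\<in>Basis. \<Sum>c\<in>Basis. 2 * (norm (T b c y))\<^sup>2) y"
    by blast
  have sub: "ball x (r / 2) \<subseteq> \<Gamma>" using r by (auto simp: subset_iff)
  have eq: "A y = D y" if "y \<in> ball x (r / 2)" for y
    using has_derivative_unique[OF AT(1)[OF that] hessian] sub that by blast
  have xr: "x \<in> ball x (r / 2)" using r(1) by simp
  have T: "GDERIV (\<lambda>y. D y c \<bullet> b) x :> T b c x" if "b \<in> Basis" "c \<in> Basis" for b c
    using AT(2)[OF xr that] unfolding gderiv_def
    by (rule has_derivative_transform_within_open[OF _ open_ball xr]) (simp add: eq)
  moreover have "has_laplacian hessian_sq (\<Sum>b\<in>Basis. \<Sum>c\<in>Basis. 2 * (norm (T b c x))\<^sup>2) x"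
    by (rule has_laplacian_transform[OF AT(3)[OF xr] open_ball xr]) (simp add: eq hessian_sq_def)
  ultimately show "\<exists>T. (\<forall>b\<in>Basis. \<forall>c\<in>Basis. GDERIV (\<lambda>y. D y c \<bullet> b) x :> T b c) \<and>
      has_laplacian hessian_sq (\<Sum>b\<in>Basis. \<Sum>c\<in>Basis. 2 * (norm (T b c))\<^sup>2) x"
    by (intro exI[of _ "\<lambda>b c. T b c x"]) blast
  have "hessian_sq = (\<lambda>y. \<Sum>c\<in>Basis. \<Sum>b\<in>Basis. (D y c \<bullet> b)\<^sup>2)"
    unfolding hessian_sq_def[abs_def] power2_norm_eq_inner euclidean_inner[of "D y c" "D y c" for y c]
    by (simp add: power2_eq_square)
  moreover have "isCont (\<lambda>y. \<Sum>c\<in>Basis. \<Sum>b\<in>Basis. (D y c \<bullet> b)\<^sup>2) x"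
    by (intro continuous_intros GDERIV_isCont[OF T])
  ultimately show "isCont hessian_sq x" by simp
qed

text \<open>Even reflection across a face turns \<open>v\<close> into a continuously differentiable function that is
  harmonic off the face, and the norm of its Hessian is even.\<close>

lemma face_regularity:
  assumes i: "i \<in> J" "x0 \<bullet> \<nu> i = 0"
    and act: "\<And>j. j \<in> J \<Longrightarrow> x0 \<bullet> \<nu> j < 0 \<or> x0 \<bullet> \<nu> j = 0 \<and> \<nu> j = \<nu> i"
  shows "\<exists>W U k. open U \<and> x0 \<in> U \<and> (\<forall>y\<in>U \<inter> \<Gamma>. W y = hessian_sq y) \<and> GDERIV W x0 :> k \<and> k \<bullet> \<nu> i = 0"
proof -
  define n where "n = \<nu> i"
  have n: "norm n = 1" using norm_\<nu>[OF i(1)] by (simp add: n_def)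
  let ?R = "reflect n"
  have Rx0: "?R x0 = x0" using i(2) by (intro reflect_eq_self) (simp add: n_def)
  \<comment> \<open>Constraints with other normals remain strict near \<open>x0\<close>, so the ball
    meets the cone exactly in the half ball \<open>x \<bullet> n < 0\<close>.\<close>
  have "\<exists>r>0. \<forall>x\<in>ball x0 r. \<forall>j\<in>J. x0 \<bullet> \<nu> j < 0 \<longrightarrow> x \<bullet> \<nu> j < 0"
  proof -
    have "open (\<Inter>j\<in>{j \<in> J. x0 \<bullet> \<nu> j < 0}. {x. \<nu> j \<bullet> x < 0})"
      using finite_J by (intro open_INT ballI open_halfspace_lt) auto
    then obtain r where "0 < r" "ball x0 r \<subseteq> (\<Inter>j\<in>{j \<in> J. x0 \<bullet> \<nu> j < 0}. {x. \<nu> j \<bullet> x < 0})"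
      by (rule openE[of _ x0]) (auto simp: inner_commute)
    then show ?thesis by (intro exI[of _ r]) (auto simp: inner_commute dest!: subsetD)
  qed
  then obtain r where r: "0 < r" "\<And>x j. x \<in> ball x0 r \<Longrightarrow> j \<in> J \<Longrightarrow> x0 \<bullet> \<nu> j < 0 \<Longrightarrow> x \<bullet> \<nu> j < 0"
    by blast
  have in\<Gamma>: "x \<in> \<Gamma>" if "x \<in> ball x0 r" "x \<bullet> n < 0" for x
    unfolding cone(1)
  proof (intro CollectI ballI)
    fix j assume j: "j \<in> J"
    show "x \<bullet> \<nu> j < 0" using act[OF j] r(2)[OF that(1) j] that(2) by (auto simp: n_def)
  qed
  have incl: "x \<in> closure \<Gamma>" if "x \<in> ball x0 r" "x \<bullet> n \<le> 0" for x
  proof (rule closure_\<Gamma>I)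
    fix j assume j: "j \<in> J"
    show "x \<bullet> \<nu> j \<le> 0" using act[OF j] r(2)[OF that(1) j] that(2) by (auto simp: n_def)
  qed
  have Rball: "?R x \<in> ball x0 r" if "x \<in> ball x0 r" for x
  proof -
    have "norm (?R x - x0) = norm (?R (x - x0))" using Rx0 by (simp add: linear_diff[OF linear_reflect])
    then show ?thesis using that by (simp add: dist_norm norm_minus_commute norm_reflect[OF n])
  qed
  have neu: "g x \<bullet> n = 0" if "x \<in> ball x0 r" "x \<bullet> n = 0" for x
    using neumann_g[OF incl i(1), of x] that by (simp add: n_def)
  define v' where "v' x = (if x \<bullet> n \<le> 0 then v x else v (?R x))" for x
  \<comment> \<open>The chain rule gives the outer reflection, which is its own adjoint.\<close>
  define g' where "g' x = (if x \<bullet> n \<le> 0 then g x else ?R (g (?R x)))" for x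
  have open_lt: "open (ball x0 r \<inter> {x. x \<bullet> n < 0})" "open (ball x0 r \<inter> {x. 0 < x \<bullet> n})"
    using open_halfspace_lt[of n 0] open_halfspace_gt[of 0 n] by (auto simp: inner_commute)
  have gd_pos: "GDERIV (\<lambda>x. v (?R x)) x :> ?R (g (?R x))" if "x \<in> ball x0 r" "0 < x \<bullet> n" for x
  proof -
    have "?R x \<in> \<Gamma>" using in\<Gamma>[OF Rball[OF that(1)]] that(2) by (simp add: reflect_inner_normal[OF n])
    from gradient[OF this] show ?thesis
      unfolding gderiv_def reflect_inner[symmetric]
      by (intro has_derivative_compose[OF has_derivative_reflect]) auto
  qed
  have grad': "GDERIV v' x :> g' x" if x: "x \<in> ball x0 r" for x
  proof -
    consider "x \<bullet> n < 0" | "0 < x \<bullet> n" | "x \<bullet> n = 0" by linarith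
    then show ?thesis
    proof cases
      case 1
      then have "GDERIV v x :> g' x" using gradient[OF in\<Gamma>[OF x]] by (simp add: g'_def)
      then show ?thesis
        unfolding gderiv_def
        by (rule has_derivative_transform_within_open[OF _ open_lt(1)]) (use 1 x in \<open>auto simp: v'_def\<close>)
    next
      case 2
      then have "GDERIV (\<lambda>x. v (?R x)) x :> g' x" using gd_pos[OF x] by (simp add: g'_def)
      then show ?thesis
        unfolding gderiv_def
        by (rule has_derivative_transform_within_open[OF _ open_lt(2)]) (use 2 x in \<open>auto simp: v'_def\<close>)
    next
      case 3
      \<comment> \<open>The Neumann condition makes \<open>g x\<close> tangential, hence fixed by
        the reflection, so the expansions from the two sides have the same linear part.\<close>
      have Rx: "?R x = x" "?R (g x) = g x"
        using 3 neu[OF x 3] by (auto intro: reflect_eq_self)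
      have "(v has_derivative (\<lambda>h. h \<bullet> g x)) (at x within closure \<Gamma>)"
        using convex_\<Gamma> open_\<Gamma> cont_v cont_g gradient incl[OF x] 3
        by (intro has_derivative_within_closure) auto
      then have D: "\<And>e. 0 < e \<Longrightarrow> \<exists>d>0. \<forall>y\<in>closure \<Gamma>. norm (y - x) < d \<longrightarrow>
          norm (v y - v x - (y - x) \<bullet> g x) \<le> e * norm (y - x)"
        unfolding has_derivative_within_alt by blast
      have "(v' has_derivative (\<lambda>h. h \<bullet> g x)) (at x within UNIV)"
        unfolding has_derivative_within_alt
      proof (intro conjI allI impI bounded_linear_inner_left)
        fix e :: real assume "0 < e"
        from D[OF this] obtain d where d: "0 < d" "\<And>y. y \<in> closure \<Gamma> \<Longrightarrow> norm (y - x) < d \<Longrightarrow>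
          norm (v y - v x - (y - x) \<bullet> g x) \<le> e * norm (y - x)" by blast
        have "norm (v' y - v' x - (y - x) \<bullet> g x) \<le> e * norm (y - x)"
          if y: "norm (y - x) < min d (r - dist x0 x)" for y
        proof -
          have yb: "y \<in> ball x0 r"
            using y dist_triangle[of x0 y x] by (simp add: dist_norm norm_minus_commute)
          show ?thesis
          proof (cases "y \<bullet> n \<le> 0")
            case True
            then show ?thesis using d(2)[OF incl[OF yb True]] y 3 by (simp add: v'_def)
          next
            case False
            have e: "?R y - x = ?R (y - x)" using Rx(1) by (simp add: linear_diff[OF linear_reflect])
            have "?R y \<in> closure \<Gamma>"
              using False by (intro incl Rball yb) (simp add: reflect_inner_normal[OF n])
            from d(2)[OF this] have "norm (v (?R y) - v x - ?R (y - x) \<bullet> g x) \<le> e * norm (y - x)"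
              using y by (simp add: e norm_reflect[OF n])
            then show ?thesis using False 3 Rx(2) by (simp add: v'_def reflect_inner)
          qed
        qed
        then show "\<exists>d>0. \<forall>y\<in>UNIV. norm (y - x) < d \<longrightarrow> norm (v' y - v' x - (y - x) \<bullet> g x) \<le> e * norm (y - x)"
          using d(1) x by (intro exI[of _ "min d (r - dist x0 x)"]) auto
      qed
      then show ?thesis using 3 by (simp add: gderiv_def g'_def)
    qed
  qed
  have cont': "continuous_on (ball x0 r) g'"
    unfolding g'_def
  proof (rule continuous_on_cases_le)
    show "continuous_on {t \<in> ball x0 r. t \<bullet> n \<le> 0} g"
      using incl by (intro continuous_on_subset[OF cont_g]) auto
    have cR: "continuous_on S ?R" for S
      by (intro linear_continuous_on linear_conv_bounded_linear[THEN iffD1] linear_reflect)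
    have "continuous_on {t \<in> ball x0 r. 0 \<le> t \<bullet> n} (\<lambda>x. g (?R x))"
      using incl[OF Rball] by (intro continuous_on_compose2[OF cont_g cR]) (auto simp: reflect_inner_normal[OF n])
    then show "continuous_on {t \<in> ball x0 r. 0 \<le> t \<bullet> n} (\<lambda>x. ?R (g (?R x)))"
      by (rule continuous_on_compose2[OF cR[of UNIV]]) auto
    show "g t = ?R (g (?R t))" if "t \<in> ball x0 r" "t \<bullet> n = 0" for t
      using neu[OF that] that(2) by (simp add: reflect_eq_self)
  qed (intro continuous_intros)
  have pw: "piecewise_harmonic (ball x0 r) v'"
  proof (rule piecewise_harmonicI[of "{(n, 0)}"])
    fix x assume x: "x \<in> ball x0 r" and off: "\<And>a c. (a, c) \<in> {(n, 0)} \<Longrightarrow> a \<bullet> x \<noteq> c"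
    have "x \<bullet> n \<noteq> 0" using off[of n 0] by (simp add: inner_commute)
    then consider "x \<bullet> n < 0" | "0 < x \<bullet> n" by linarith
    then show "has_laplacian v' 0 x"
    proof cases
      case 1
      then have "x \<in> \<Gamma>" using in\<Gamma> x by blast
      then have "has_laplacian v 0 x"
        using has_laplacian_of_derivative[OF open_\<Gamma> _ gradient hessian, of x] trace_0 by simp
      then show ?thesis
        by (rule has_laplacian_transform[OF _ open_lt(1)]) (use x 1 in \<open>auto simp: v'_def\<close>)
    next
      case 2
      have R\<Gamma>: "?R x \<in> \<Gamma>" using in\<Gamma>[OF Rball[OF x]] 2 by (simp add: reflect_inner_normal[OF n])
      have "((\<lambda>y. ?R (g (?R y))) has_derivative (\<lambda>h. ?R (D (?R x) (?R h)))) (at x)"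
        using has_derivative_compose[OF has_derivative_compose[OF has_derivative_reflect hessian[OF R\<Gamma>]] has_derivative_reflect] .
      then have "has_laplacian (\<lambda>y. v (?R y)) (\<Sum>b\<in>Basis. ?R (D (?R x) (?R b)) \<bullet> b) x"
        by (rule has_laplacian_of_derivative[OF open_lt(2), rotated 2]) (use x 2 gd_pos in auto)
      moreover have "linear (D (?R x))" using hessian[OF R\<Gamma>] has_derivative_linear by blast
      then have "(\<Sum>b\<in>Basis. ?R (D (?R x) (?R b)) \<bullet> b) = 0"
        using trace_reflect[of "D (?R x)" n] n trace_0[OF R\<Gamma>] by (simp add: reflect_inner)
      ultimately have "has_laplacian (\<lambda>y. v (?R y)) 0 x" by simp
      then show ?thesis
        by (rule has_laplacian_transform[OF _ open_lt(2)]) (use x 2 in \<open>auto simp: v'_def\<close>)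
    qed
  next
    show "\<exists>g. GDERIV v' x :> g" if "x \<in> ball x0 r" for x using grad'[OF that] by blast
  qed (use n in auto)
  have r2: "0 < r / 2" "r / 2 < r" using r(1) by auto
  have "\<exists>A T. \<forall>x\<in>ball x0 (r / 2). (g' has_derivative A x) (at x) \<and>
     (\<forall>b\<in>Basis. \<forall>c\<in>Basis. GDERIV (\<lambda>x. A x c \<bullet> b) x :> T b c x) \<and>
     has_laplacian (\<lambda>x. \<Sum>c\<in>Basis. (norm (A x c))\<^sup>2) (\<Sum>b\<in>Basis. \<Sum>c\<in>Basis. 2 * (norm (T b c x))\<^sup>2) x"
    by (rule hessian_norm_regularity[OF pw grad' cont' r2])
  then obtain A T where A: "\<And>y. y \<in> ball x0 (r / 2) \<Longrightarrow> (g' has_derivative A y) (at y)"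
    and T: "\<And>y b c. y \<in> ball x0 (r / 2) \<Longrightarrow> b \<in> Basis \<Longrightarrow> c \<in> Basis \<Longrightarrow> GDERIV (\<lambda>x. A x c \<bullet> b) y :> T b c y"
    by blast
  define W where "W y = (\<Sum>b\<in>Basis. (norm (A y b))\<^sup>2)" for y
  have x0b: "x0 \<in> ball x0 (r / 2)" using r(1) by simp
  have Rb2: "?R y \<in> ball x0 (r / 2)" if "y \<in> ball x0 (r / 2)" for y
  proof -
    have "norm (?R y - x0) = norm (?R (y - x0))" using Rx0 by (simp add: linear_diff[OF linear_reflect])
    then show ?thesis using that by (simp add: dist_norm norm_minus_commute norm_reflect[OF n])
  qed
  have Ww: "W y = hessian_sq y" if y: "y \<in> ball x0 (r / 2)" "y \<in> \<Gamma>" for y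
  proof -
    have "y \<bullet> n < 0" using y(2) i(1) unfolding cone(1) n_def by blast
    have "y \<in> ball x0 r" using y(1) r2 by auto
    then have "(g has_derivative A y) (at y)"
      using \<open>y \<bullet> n < 0\<close>
      by (intro has_derivative_transform_within_open[OF A[OF y(1)] open_lt(1)]) (auto simp: g'_def)
    then have "A y = D y" using hessian[OF y(2)] by (rule has_derivative_unique)
    then show ?thesis by (simp add: W_def hessian_sq_def)
  qed
  have g'R: "g' (?R y) = ?R (g' y)" if "y \<in> ball x0 r" for y
  proof -
    consider "y \<bullet> n < 0" | "0 < y \<bullet> n" | "y \<bullet> n = 0" by linarith
    then show ?thesis
      by cases (use neu[OF that] in \<open>auto simp: g'_def reflect_inner_normal[OF n] reflect_reflect[OF n] reflect_eq_self\<close>)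
  qed
  \<comment> \<open>Differentiating the equivariance of \<open>g'\<close> shows that the Hessians at
    \<open>y\<close> and at its mirror image are conjugate under an isometry.\<close>
  have even: "W (?R y) = W y" if y: "y \<in> ball x0 (r / 2)" for y
  proof -
    have "((\<lambda>y. g' (?R y)) has_derivative (\<lambda>h. A (?R y) (?R h))) (at y)"
      by (rule has_derivative_compose[OF has_derivative_reflect A[OF Rb2[OF y]]])
    moreover have "((\<lambda>y. g' (?R y)) has_derivative (\<lambda>h. ?R (A y h))) (at y)"
      using has_derivative_compose[OF A[OF y] has_derivative_reflect]
      by (rule has_derivative_transform_within_open[OF _ open_ball y]) (use g'R r2 in auto)
    ultimately have "(\<lambda>h. A (?R y) (?R h)) = (\<lambda>h. ?R (A y h))" by (rule has_derivative_unique)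
    then have "norm (A (?R y) (?R h)) = norm (A y h)" for h by (metis norm_reflect[OF n])
    moreover have "linear (A (?R y))" using A[OF Rb2[OF y]] has_derivative_linear by blast
    ultimately show ?thesis
      using sum_norm_power2_reflect[of "A (?R y)" n] n by (simp add: W_def)
  qed
  have W_eq: "W = (\<lambda>y. \<Sum>c\<in>Basis. \<Sum>b\<in>Basis. (A y c \<bullet> b)\<^sup>2)"
    unfolding W_def[abs_def] power2_norm_eq_inner euclidean_inner[of "A y c" "A y c" for y c]
    by (simp add: power2_eq_square)
  have "((\<lambda>y. (A y c \<bullet> b)\<^sup>2) has_derivative (\<lambda>h. 2 * (A x0 c \<bullet> b) * (h \<bullet> T b c x0))) (at x0)"
    if "b \<in> Basis" "c \<in> Basis" for b c
    using has_derivative_power[OF T[OF x0b that, unfolded gderiv_def], of 2] by (simp add: mult_ac)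
  then have dW: "(W has_derivative (\<lambda>h. \<Sum>c\<in>Basis. \<Sum>b\<in>Basis. 2 * (A x0 c \<bullet> b) * (h \<bullet> T b c x0))) (at x0)"
    unfolding W_eq by (intro has_derivative_sum) auto
  define k where "k = (\<Sum>c\<in>Basis. \<Sum>b\<in>Basis. (2 * (A x0 c \<bullet> b)) *\<^sub>R T b c x0)"
  have "(\<lambda>h. \<Sum>c\<in>Basis. \<Sum>b\<in>Basis. 2 * (A x0 c \<bullet> b) * (h \<bullet> T b c x0)) = (\<lambda>h. h \<bullet> k)"
    by (simp add: k_def inner_sum_right)
  with dW have k: "GDERIV W x0 :> k" by (simp add: gderiv_def)
  \<comment> \<open>At a point fixed by the reflection the gradient of an even function is fixed
    too; testing with \<open>n\<close>, which is mapped to \<open>- n\<close>, gives the Neumann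
    condition.\<close>
  have "((\<lambda>y. W (?R y)) has_derivative (\<lambda>h. ?R h \<bullet> k)) (at x0)"
    by (rule has_derivative_compose[OF has_derivative_reflect]) (use k Rx0 in \<open>simp add: gderiv_def\<close>)
  then have "(W has_derivative (\<lambda>h. ?R h \<bullet> k)) (at x0)"
    by (rule has_derivative_transform_within_open[OF _ open_ball x0b]) (rule even)
  then have "(\<lambda>h. ?R h \<bullet> k) = (\<lambda>h. h \<bullet> k)" using k unfolding gderiv_def by (rule has_derivative_unique)
  from fun_cong[OF this, of n] have "?R n \<bullet> k = n \<bullet> k" .
  moreover have "?R n = - n" using n by (simp add: reflect_def norm_eq_1 scaleR_2)
  ultimately have "k \<bullet> \<nu> i = 0" by (simp add: n_def inner_commute)
  moreover have "\<forall>y\<in>ball x0 (r / 2) \<inter> \<Gamma>. W y = hessian_sq y" using Ww by blast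
  ultimately show ?thesis using k x0b open_ball by blast
qed

text \<open>The Lipschitz constant of the gradient bounds \<open>D x b\<close> for each basis
  vector, whence the upper bound; the even extension supplies the face condition.\<close>

lemma subharmonic_hessian_sq: "subharmonic_on_cone J \<nu> \<Gamma> hessian_sq (\<Sum>b\<in>(Basis :: 'a set). L\<^sup>2)"
proof
  show "hessian_sq x \<le> (\<Sum>b\<in>(Basis :: 'a set). L\<^sup>2)" if x: "x \<in> \<Gamma>" for x
    unfolding hessian_sq_def
  proof (intro sum_mono power_mono)
    fix b :: 'a assume "b \<in> Basis"
    then show "norm (D x b) \<le> L"
      using has_derivative_norm_le_lipschitz[OF open_\<Gamma> x lipschitz hessian[OF x], of b] by simp
  qed simp
  show "\<exists>l\<ge>0. has_laplacian hessian_sq l x" if x: "x \<in> \<Gamma>" for x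
  proof -
    obtain T where "\<forall>b\<in>Basis. \<forall>c\<in>Basis. GDERIV (\<lambda>y. D y c \<bullet> b) x :> T b c"
      "has_laplacian hessian_sq (\<Sum>b\<in>Basis. \<Sum>c\<in>Basis. 2 * (norm (T b c))\<^sup>2) x"
      using interior_regularity(2)[OF x] by (elim exE conjE) (rule that)
    then show ?thesis by (intro exI conjI) (auto intro!: sum_nonneg)
  qed
  show "\<exists>W U k. open U \<and> x \<in> U \<and> (\<forall>y\<in>U \<inter> \<Gamma>. W y = hessian_sq y) \<and> GDERIV W x :> k \<and> k \<bullet> \<nu> i = 0"
    if "i \<in> J" "x \<bullet> \<nu> i = 0" "\<And>j. j \<in> J \<Longrightarrow> x \<bullet> \<nu> j < 0 \<or> x \<bullet> \<nu> j = 0 \<and> \<nu> j = \<nu> i" for x i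
    using face_regularity[OF that] .
qed (use finite_J cone norm_\<nu> interior_regularity(1) in auto)

lemma hessian_sq_constant: "x \<in> \<Gamma> \<Longrightarrow> y \<in> \<Gamma> \<Longrightarrow> hessian_sq x = hessian_sq y"
proof -
  interpret S: subharmonic_on_cone J \<nu> \<Gamma> hessian_sq "\<Sum>b\<in>(Basis :: 'a set). L\<^sup>2" by (rule subharmonic_hessian_sq)
  have "hessian_sq (t *\<^sub>R x) = hessian_sq x" if "0 < t" "x \<in> \<Gamma>" for t x
    using hessian_homogeneous[OF that(2,1)] by (simp add: hessian_sq_def)
  from S.homogeneous_imp_constant[OF this] show "x \<in> \<Gamma> \<Longrightarrow> y \<in> \<Gamma> \<Longrightarrow> hessian_sq x = hessian_sq y"
    by (meson order_antisym)
qed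

text \<open>A constant has Laplacian 0, so the sum of squared third derivatives vanishes, and
  convexity of the cone connects any two points.\<close>

lemma hessian_constant:
  assumes "x \<in> \<Gamma>" "y \<in> \<Gamma>"
  shows "D x = D y"
proof -
  have der: "GDERIV (\<lambda>y. D y c \<bullet> b) x :> 0" if x: "x \<in> \<Gamma>" and bc: "b \<in> Basis" "c \<in> Basis" for x b c
  proof -
    obtain T where T: "\<forall>b\<in>Basis. \<forall>c\<in>Basis. GDERIV (\<lambda>y. D y c \<bullet> b) x :> T b c"
      "has_laplacian hessian_sq (\<Sum>b\<in>Basis. \<Sum>c\<in>Basis. 2 * (norm (T b c))\<^sup>2) x"
      using interior_regularity(2)[OF x] by (elim exE conjE) (rule that)
    have "has_laplacian hessian_sq 0 x"
      by (rule has_laplacian_transform[OF has_laplacian_const[of "hessian_sq x"] open_\<Gamma> x]) (rule hessian_sq_constant[OF x])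
    from has_laplacian_unique[OF T(2) this]
    have "\<forall>b\<in>Basis. (\<Sum>c\<in>Basis. 2 * (norm (T b c))\<^sup>2) = 0"
      by (subst (asm) sum_nonneg_eq_0_iff) (auto intro: sum_nonneg)
    then have "(\<Sum>c\<in>Basis. 2 * (norm (T b c))\<^sup>2) = 0" using bc(1) by (rule bspec)
    then have "\<forall>c\<in>Basis. 2 * (norm (T b c))\<^sup>2 = 0"
      by (subst (asm) sum_nonneg_eq_0_iff) auto
    then have "T b c = 0" using bc(2) by simp
    with bspec[OF bspec[OF T(1) bc(1)] bc(2)] show ?thesis by simp
  qed
  have comp: "D x c \<bullet> b = D y c \<bullet> b" if "b \<in> Basis" "c \<in> Basis" for b c
  proof -
    have "((\<lambda>y. D y c \<bullet> b) has_derivative (\<lambda>h. 0)) (at x within \<Gamma>)" if "x \<in> \<Gamma>" for x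
      using der[OF that \<open>b \<in> Basis\<close> \<open>c \<in> Basis\<close>] unfolding gderiv_def by (simp add: has_derivative_at_withinI)
    from has_derivative_zero_constant[OF convex_\<Gamma> this] obtain k where "\<And>x. x \<in> \<Gamma> \<Longrightarrow> D x c \<bullet> b = k"
      by blast
    then show ?thesis using assms by simp
  qed
  have "D x c = D y c" if "c \<in> Basis" for c
    by (rule euclidean_eqI) (rule comp[OF _ that])
  moreover have "linear (D x)" "linear (D y)" using hessian assms has_derivative_linear by blast+
  ultimately show ?thesis by (intro linear_eq_stdbasis)
qed

text \<open>A constant Hessian makes the gradient affine; Euler's identity
  \<open>2 * v x = x \<bullet> g x\<close>, from differentiating along the ray, then yields
  \<open>v\<close> without integration, and continuity extends the formula to the closure.\<close>

theorem quadratic: "\<exists>A b. linear A \<and> (\<forall>x\<in>closure \<Gamma>. v x = x \<bullet> A x + b \<bullet> x)"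
proof -
  obtain p where p: "p \<in> \<Gamma>" using cone(2) by blast
  have lin: "linear (D p)" using hessian[OF p] has_derivative_linear by blast
  have "((\<lambda>x. g x - D p x) has_derivative (\<lambda>h. 0)) (at x within \<Gamma>)" if x: "x \<in> \<Gamma>" for x
  proof -
    have "((\<lambda>x. g x - D p x) has_derivative (\<lambda>h. D x h - D p h)) (at x)"
      by (intro has_derivative_diff hessian x bounded_linear_imp_has_derivative lin[unfolded linear_conv_bounded_linear])
    then show ?thesis using hessian_constant[OF x p] by (simp add: has_derivative_at_withinI)
  qed
  then obtain k where k: "\<And>x. x \<in> \<Gamma> \<Longrightarrow> g x - D p x = k"
    using has_derivative_zero_constant[OF convex_\<Gamma>, of "\<lambda>x. g x - D p x"] by blast
  have euler: "v x = x \<bullet> ((1 / 2) *\<^sub>R D p x) + ((1 / 2) *\<^sub>R k) \<bullet> x" if x: "x \<in> \<Gamma>" for x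
  proof -
    have "((\<lambda>t. v (t *\<^sub>R x)) has_real_derivative x \<bullet> g x) (at 1)"
      using GDERIV_line[of v 0 1 x "g x"] gradient[OF x] by simp
    then have "((\<lambda>t. t\<^sup>2 * v x) has_real_derivative x \<bullet> g x) (at 1)"
      by (rule has_field_derivative_transform_within_open[of _ _ _ "{0<..}"]) (auto simp: homogeneous[OF x])
    moreover have "((\<lambda>t. t\<^sup>2 * v x) has_real_derivative 2 * v x) (at 1)"
      by (auto intro!: derivative_eq_intros)
    ultimately have "2 * v x = x \<bullet> g x" using DERIV_unique by blast
    moreover have "g x = D p x + k" using k[OF x] by (simp add: algebra_simps)
    ultimately show ?thesis by (simp add: inner_add_right inner_commute)
  qed
  have "continuous_on (closure \<Gamma>) (\<lambda>x. v x - (x \<bullet> ((1 / 2) *\<^sub>R D p x) + ((1 / 2) *\<^sub>R k) \<bullet> x))"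
    using lin by (intro continuous_intros cont_v linear_continuous_on) (simp add: linear_conv_bounded_linear)
  from continuous_constant_on_closure[OF this, of 0]
  have "v x = x \<bullet> ((1 / 2) *\<^sub>R D p x) + ((1 / 2) *\<^sub>R k) \<bullet> x" if "x \<in> closure \<Gamma>" for x
    using euler that by simp
  moreover have "linear (\<lambda>x. (1 / 2) *\<^sub>R D p x)" using lin by (rule linear_compose_scale_right)
  ultimately show ?thesis by blast
qed

end

section \<open>Transfer to matrices and coordinate vectors\<close>

theorem proposition6p1:
  fixes m :: nat
    and \<nu> :: "nat \<Rightarrow> real ^ 'n"
    and \<Gamma> :: "(real ^ 'n) set"
    and v :: "real ^ 'n \<Rightarrow> real"
  assumes "polyhedral_cone m \<nu> \<Gamma>"
    and "C11_upto_boundary \<Gamma> v"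
    and "homogeneous_degree_two_on (closure \<Gamma>) v"
    and "harmonic_on \<Gamma> v"
    and "neumann_condition m \<nu> \<Gamma> v"
  shows "quadratic_on (closure \<Gamma>) v"
proof -
  have cone: "\<Gamma> = {x. \<forall>i\<in>{1..m}. x \<bullet> \<nu> i < 0}" "\<Gamma> \<noteq> {}" "\<And>i. i \<in> {1..m} \<Longrightarrow> norm (\<nu> i) = 1"
    using assms(1) unfolding polyhedral_cone_def by auto
  have op: "open \<Gamma>" unfolding cone(1) by (rule open_polyhedral_cone) simp
  obtain g where g: "continuous_on (closure \<Gamma>) v" "continuous_on (closure \<Gamma>) g"
    "\<And>x. x \<in> \<Gamma> \<Longrightarrow> GDERIV v x :> g x"
    "\<And>i x. i \<in> {1..m} \<Longrightarrow> x \<in> closure \<Gamma> \<Longrightarrow> x \<bullet> \<nu> i = 0 \<Longrightarrow> g x \<bullet> \<nu> i = 0"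
    using assms(5) unfolding neumann_condition_def C1_gradient_upto_boundary_def by blast
  obtain g1 L where g1: "\<And>x. x \<in> \<Gamma> \<Longrightarrow> GDERIV v x :> g1 x" "L-lipschitz_on (closure \<Gamma>) g1"
    using assms(2) unfolding C11_upto_boundary_def C1_gradient_upto_boundary_def by blast
  obtain g2 and H :: "real ^ 'n \<Rightarrow> real ^ 'n ^ 'n" where g2: "\<And>x. x \<in> \<Gamma> \<Longrightarrow> GDERIV v x :> g2 x"
    "\<And>x. x \<in> \<Gamma> \<Longrightarrow> (g2 has_derivative (\<lambda>h. H x *v h)) (at x)" "\<And>x. x \<in> \<Gamma> \<Longrightarrow> trace (H x) = 0"
    using assms(4) unfolding harmonic_on_def by blast
  \<comment> \<open>The regularity, harmonicity and Neumann hypotheses each provide a gradient of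
    their own; on the open cone all three coincide, so one \<open>g\<close> inherits every
    property.\<close>
  have g1g: "g1 x = g x" and g2g: "g2 x = g x" if "x \<in> \<Gamma>" for x
    using GDERIV_unique g(3) g1(1) g2(1) that by blast+
  interpret homogeneous_neumann_solution "{1..m}" \<nu> \<Gamma> v g "\<lambda>x h. H x *v h" L
  proof
    show "(g has_derivative (\<lambda>h. H x *v h)) (at x)" if "x \<in> \<Gamma>" for x
      by (rule has_derivative_transform_within_open[OF g2(2)[OF that] op that g2g])
    show "(\<Sum>b\<in>Basis. (H x *v b) \<bullet> b) = 0" if "x \<in> \<Gamma>" for x
    proof -
      have "(\<Sum>b\<in>Basis. (H x *v b) \<bullet> b) = (\<Sum>i\<in>UNIV. (H x *v axis i 1) \<bullet> axis i 1)"
        by (subst sum.reindex[of "\<lambda>i. axis i 1" UNIV, unfolded o_def, symmetric])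
          (auto simp: Basis_vec_def inj_on_def axis_eq_axis intro: sum.cong)
      also have "\<dots> = trace (H x)" by (simp add: trace_def inner_axis matrix_vector_mul_component)
      finally show ?thesis using g2(3)[OF that] by simp
    qed
    have "L-lipschitz_on \<Gamma> g1" using g1(2) closure_subset by (rule lipschitz_on_subset)
    then show "L-lipschitz_on \<Gamma> g" by (rule lipschitz_on_transform) (simp add: g1g)
    show "v (t *\<^sub>R x) = t\<^sup>2 * v x" if "x \<in> \<Gamma>" "0 < t" for x t
      using assms(3) that closure_subset unfolding homogeneous_degree_two_on_def by blast
  qed (use cone g in auto)
  obtain A b where A: "linear A" "\<And>x. x \<in> closure \<Gamma> \<Longrightarrow> v x = x \<bullet> A x + b \<bullet> x" using quadratic by blast
  show ?thesis
    unfolding quadratic_on_def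
    by (rule exI[of _ "matrix A"], rule exI[of _ b], rule exI[of _ 0]) (simp add: A matrix_works)
qed

end
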